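(* Let $H$ be a finite-dimensional Hopf algebra. The functors (acting as the identity on underlying algebras and on morphisms) $$\mathfrak F_H:{}_H\mathfrak{YD}^H\to{}^{H^{\mathrm{op}}}\mathfrak{YD}_{H^{\mathrm{op}}},\ (X,\rhd,\delta)\mapsto(X,\dot\lhd,\delta_S),\qquad\mathfrak F'_H:{}^H\mathfrak{YD}_H\to{}_{H^{\mathrm{op}}}\mathfrak{YD}^{H^{\mathrm{op}}},\ (X,\lhd,\delta)\mapsto(X,\dot\rhd,{}_S\delta)$$ are equivalences of categories. Moreover, $\mathfrak F'_{H^{\mathrm{op}}}\mathfrak F_H$ is the identity functor of ${}_H\mathfrak{YD}^H$ and $\mathfrak F_{H^{\mathrm{op}}}\mathfrak F'_H$ is the identity functor of ${}^H\mathfrak{YD}_H$.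
   Context: $\Bbbk$ is a field, algebras are unital $\Bbbk$-algebras. For a finite-dimensional Hopf algebra $K$ with structure maps $\Delta,\varepsilon,S_K$ ($S_K$ bijective), $K^{\mathrm{op}}$ is the Hopf algebra with opposite product (elements $k^{\mathrm{op}}$), the same coproduct and antipode $k^{\mathrm{op}}\mapsto S_K^{-1}(k)^{\mathrm{op}}$; $(K^{\mathrm{op}})^{\mathrm{op}}=K$. Left/right coactions of $K$ on an algebra $X$ are coassociative, counital algebra homomorphisms $X\to K\otimes X$ / $X\to X\otimes K$; left/right actions are left/right $K$-module algebra structures. ${}_K\mathfrak{YD}^K$ (left-right Yetter--Drinfeld algebras over $K$): triples $(X,\rhd,\delta)$ with $\rhd$ a left action of $K$ and $\delta:X\to X\otimes K^{\mathrm{op}}$, $\delta(x)=x_{[0]}\otimes x_{[1]}^{\mathrm{op}}$, a right coaction of $K^{\mathrm{op}}$ such that $(k_{(1)}\rhd x_{[0]})\otimes k_{(2)}x_{[1]}=(k_{(2)}\rhd x)_{[0]}\otimes(k_{(2)}\rhd x)_{[1]}k_{(1)}$ for all $k\in K,x\in X$. ${}^K\mathfrak{YD}_K$ (right-left Yetter--Drinfeld algebras over $K$): triples $(X,\lhd,\delta)$ with $\lhd$ a right action of $K$ and $\delta:X\to K^{\mathrm{op}}\otimes X$, $\delta(x)=x_{[-1]}^{\mathrm{op}}\otimes x_{[0]}$, a left coaction of $K^{\mathrm{op}}$ such that $x_{[-1]}k_{(1)}\otimes(x_{[0]}\lhd k_{(2)})=k_{(2)}(x\lhd k_{(1)})_{[-1]}\otimes(x\lhd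 k_{(1)})_{[0]}$ for all $k\in K,x\in X$. In both categories morphisms are algebra homomorphisms intertwining the actions and the coactions. Notation: for a left action $\rhd$ of $H$, $x\,\dot\lhd\,h^{\mathrm{op}}=h\rhd x$ (a right action of $H^{\mathrm{op}}$); for a right action $\lhd$ of $H$, $h^{\mathrm{op}}\,\dot\rhd\,x=x\lhd h$. For $\delta:X\to X\otimes H^{\mathrm{op}}$, $\delta(x)=x_{[0]}\otimes x_{[1]}^{\mathrm{op}}$, put $\delta_S:X\to H\otimes X$, $\delta_S(x)=S(x_{[1]})\otimes x_{[0]}$; for $\delta:X\to H^{\mathrm{op}}\otimes X$, $\delta(x)=x_{[-1]}^{\mathrm{op}}\otimes x_{[0]}$, put ${}_S\delta:X\to X\otimes H$, ${}_S\delta(x)=x_{[0]}\otimes S(x_{[-1]})$, where $S$ is the antipode of $H$. The functors $\mathfrak F_{H^{\mathrm{op}}},\mathfrak F'_{H^{\mathrm{op}}}$ are defined by the same formulas with $H$ replaced by $H^{\mathrm{op}}$ (and $S$ by the antipode of $H^{\mathrm{op}}$). *)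

theory Defs
  imports "Jordan_Normal_Form.Missing_VectorSpace" "HOL-Algebra.AbelCoset" "HOL-Library.FuncSet"
begin

section \<open>Tensor products\<close>

text \<open>
  The tensor product is constructed as the free module on \<open>carrier A \<times> carrier B\<close> modulo the
  bilinearity relations, so a tensor is a coset of finitely supported functions.  As usual for
  \<^typ>\<open>('k, 'a) module\<close> records, \<open>mult\<close> and \<open>one\<close> carry no meaning for a mere module.
\<close>

definition free_module :: "'k ring \<Rightarrow> 'i set \<Rightarrow> ('k, 'i \<Rightarrow> 'k) module" where
  "free_module K I =
    \<lparr>carrier = {f. range f \<subseteq> carrier K \<and> finite {i. f i \<noteq> \<zero>\<^bsub>K\<^esub>} \<and> {i. f i \<noteq> \<zero>\<^bsub>K\<^esub>} \<subseteq> I},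
     mult = undefined,
     one = undefined,
     zero = (\<lambda>i. \<zero>\<^bsub>K\<^esub>),
     add = (\<lambda>f g i. f i \<oplus>\<^bsub>K\<^esub> g i),
     smult = (\<lambda>c f i. c \<otimes>\<^bsub>K\<^esub> f i)\<rparr>"

definition free_basis :: "'k ring \<Rightarrow> 'i \<Rightarrow> 'i \<Rightarrow> 'k" where
  "free_basis K i = (\<lambda>j. if j = i then \<one>\<^bsub>K\<^esub> else \<zero>\<^bsub>K\<^esub>)"

abbreviation pair_module ::
  "'k ring \<Rightarrow> ('k, 'a, 'm) module_scheme \<Rightarrow> ('k, 'b, 'n) module_scheme \<Rightarrow> ('k, 'a \<times> 'b \<Rightarrow> 'k) module"
  where "pair_module K A B \<equiv> free_module K (carrier A \<times> carrier B)"

definition bilinear_relations ::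
  "'k ring \<Rightarrow> ('k, 'a, 'm) module_scheme \<Rightarrow> ('k, 'b, 'n) module_scheme \<Rightarrow> ('a \<times> 'b \<Rightarrow> 'k) set" where
  "bilinear_relations K A B =
    (let F = pair_module K A B; e = (\<lambda>a b. free_basis K (a, b)) in
      {e (a \<oplus>\<^bsub>A\<^esub> a') b \<ominus>\<^bsub>F\<^esub> (e a b \<oplus>\<^bsub>F\<^esub> e a' b) | a a' b.
        a \<in> carrier A \<and> a' \<in> carrier A \<and> b \<in> carrier B} \<union>
      {e a (b \<oplus>\<^bsub>B\<^esub> b') \<ominus>\<^bsub>F\<^esub> (e a b \<oplus>\<^bsub>F\<^esub> e a b') | a b b'.
        a \<in> carrier A \<and> b \<in> carrier B \<and> b' \<in> carrier B} \<union>
      {e (c \<odot>\<^bsub>A\<^esub> a) b \<ominus>\<^bsub>F\<^esub> c \<odot>\<^bsub>F\<^esub> e a b | c a b.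
        c \<in> carrier K \<and> a \<in> carrier A \<and> b \<in> carrier B} \<union>
      {e a (c \<odot>\<^bsub>B\<^esub> b) \<ominus>\<^bsub>F\<^esub> c \<odot>\<^bsub>F\<^esub> e a b | c a b.
        c \<in> carrier K \<and> a \<in> carrier A \<and> b \<in> carrier B})"

definition relation_module ::
  "'k ring \<Rightarrow> ('k, 'a, 'm) module_scheme \<Rightarrow> ('k, 'b, 'n) module_scheme \<Rightarrow> ('a \<times> 'b \<Rightarrow> 'k) set" where
  "relation_module K A B = module.span K (pair_module K A B) (bilinear_relations K A B)"

text \<open>
  In \<open>smult\<close>, the product \<open>c \<odot> t\<close> is saturated by the relations, since for \<open>c = 0\<close> the
  elementwise multiples of a coset do not form a coset.
\<close>

definition tensor_space ::
  "'k ring \<Rightarrow> ('k, 'a, 'm) module_scheme \<Rightarrow> ('k, 'b, 'n) module_scheme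
    \<Rightarrow> ('k, ('a \<times> 'b \<Rightarrow> 'k) set) module" where
  "tensor_space K A B =
    (let F = pair_module K A B; N = relation_module K A B in
      \<lparr>carrier = a_rcosets\<^bsub>F\<^esub> N,
       mult = undefined,
       one = undefined,
       zero = N,
       add = (\<lambda>s t. s <+>\<^bsub>F\<^esub> t),
       smult = (\<lambda>c t. \<Union>r\<in>t. N +>\<^bsub>F\<^esub> (c \<odot>\<^bsub>F\<^esub> r))\<rparr>)"

definition tens ::
  "'k ring \<Rightarrow> ('k, 'a, 'm) module_scheme \<Rightarrow> ('k, 'b, 'n) module_scheme
    \<Rightarrow> 'a \<Rightarrow> 'b \<Rightarrow> ('a \<times> 'b \<Rightarrow> 'k) set" where
  "tens K A B a b = relation_module K A B +>\<^bsub>pair_module K A B\<^esub> free_basis K (a, b)"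

text \<open>
  \<open>tensor_lift K A B P f\<close> is the linear map \<open>A \<otimes> B \<rightarrow> P\<close> induced by a bilinear map \<open>f\<close>; the chosen
  representative of the coset is then irrelevant.  Sweedler notation is expressed through it: for
  \<open>t = \<Sum> t\<^sub>1 \<otimes> t\<^sub>2\<close>, the element \<open>\<Sum> f t\<^sub>1 t\<^sub>2\<close> of \<open>P\<close> is \<open>tensor_lift K A B P (\<lambda>t1 t2. f t1 t2) t\<close>.
\<close>

definition tensor_lift ::
  "'k ring \<Rightarrow> ('k, 'a, 'm) module_scheme \<Rightarrow> ('k, 'b, 'n) module_scheme \<Rightarrow> ('k, 'p, 'q) module_scheme
    \<Rightarrow> ('a \<Rightarrow> 'b \<Rightarrow> 'p) \<Rightarrow> ('a \<times> 'b \<Rightarrow> 'k) set \<Rightarrow> 'p" where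
  "tensor_lift K A B P f t =
    (let r = (SOME r. r \<in> t)
     in \<Oplus>\<^bsub>P\<^esub>i\<in>{i. r i \<noteq> \<zero>\<^bsub>K\<^esub>}. r i \<odot>\<^bsub>P\<^esub> f (fst i) (snd i))"

text \<open>\<open>f \<otimes> g : A \<otimes> B \<rightarrow> C \<otimes> D\<close>, and the associator \<open>(A \<otimes> B) \<otimes> C \<rightarrow> A \<otimes> (B \<otimes> C)\<close>\<close>

definition tensor_map ::
  "'k ring \<Rightarrow> ('k, 'a, 'm) module_scheme \<Rightarrow> ('k, 'b, 'n) module_scheme
    \<Rightarrow> ('k, 'c, 'p) module_scheme \<Rightarrow> ('k, 'd, 'q) module_scheme
    \<Rightarrow> ('a \<Rightarrow> 'c) \<Rightarrow> ('b \<Rightarrow> 'd) \<Rightarrow> ('a \<times> 'b \<Rightarrow> 'k) set \<Rightarrow> ('c \<times> 'd \<Rightarrow> 'k) set" where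
  "tensor_map K A B C D f g =
    tensor_lift K A B (tensor_space K C D) (\<lambda>a b. tens K C D (f a) (g b))"

definition tensor_assoc ::
  "'k ring \<Rightarrow> ('k, 'a, 'm) module_scheme \<Rightarrow> ('k, 'b, 'n) module_scheme \<Rightarrow> ('k, 'c, 'p) module_scheme
    \<Rightarrow> (('a \<times> 'b \<Rightarrow> 'k) set \<times> 'c \<Rightarrow> 'k) set \<Rightarrow> ('a \<times> ('b \<times> 'c \<Rightarrow> 'k) set \<Rightarrow> 'k) set" where
  "tensor_assoc K A B C =
    (let BC = tensor_space K B C; T = tensor_space K A BC in
      tensor_lift K (tensor_space K A B) C T
        (\<lambda>s c. tensor_lift K A B T (\<lambda>a b. tens K A BC a (tens K B C b c)) s))"

definition tensor_algebra ::
  "'k ring \<Rightarrow> ('k, 'a, 'm) module_scheme \<Rightarrow> ('k, 'b, 'n) module_scheme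
    \<Rightarrow> ('k, ('a \<times> 'b \<Rightarrow> 'k) set) module" where
  "tensor_algebra K A B =
    (let T = tensor_space K A B in
      T\<lparr>mult := (\<lambda>s t. tensor_lift K A B T
           (\<lambda>a b. tensor_lift K A B T (\<lambda>a' b'. tens K A B (a \<otimes>\<^bsub>A\<^esub> a') (b \<otimes>\<^bsub>B\<^esub> b')) t) s),
        one := tens K A B \<one>\<^bsub>A\<^esub> \<one>\<^bsub>B\<^esub>\<rparr>)"


section \<open>Algebras and Hopf algebras\<close>

text \<open>The library locale \<^locale>\<open>algebra\<close> is restricted to commutative algebras.\<close>

definition unital_algebra :: "'k ring \<Rightarrow> ('k, 'a, 'm) module_scheme \<Rightarrow> bool" where
  "unital_algebra K A \<longleftrightarrow> vectorspace K A \<and> ring A \<and>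
    (\<forall>c\<in>carrier K. \<forall>x\<in>carrier A. \<forall>y\<in>carrier A.
      (c \<odot>\<^bsub>A\<^esub> x) \<otimes>\<^bsub>A\<^esub> y = c \<odot>\<^bsub>A\<^esub> (x \<otimes>\<^bsub>A\<^esub> y) \<and> x \<otimes>\<^bsub>A\<^esub> (c \<odot>\<^bsub>A\<^esub> y) = c \<odot>\<^bsub>A\<^esub> (x \<otimes>\<^bsub>A\<^esub> y))"

definition algebra_hom ::
  "'k ring \<Rightarrow> ('k, 'a, 'm) module_scheme \<Rightarrow> ('k, 'b, 'n) module_scheme \<Rightarrow> ('a \<Rightarrow> 'b) set" where
  "algebra_hom K A B = module_hom K A B \<inter> ring_hom A B"

record ('k, 'h) hopf = "('k, 'h) module" +
  comult :: "'h \<Rightarrow> ('h \<times> 'h \<Rightarrow> 'k) set"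
  counit :: "'h \<Rightarrow> 'k"
  antipode :: "'h \<Rightarrow> 'h"

definition hopf_algebra :: "'k ring \<Rightarrow> ('k, 'h) hopf \<Rightarrow> bool" where
  "hopf_algebra K H \<longleftrightarrow>
    unital_algebra K H \<and>
    comult H \<in> algebra_hom K H (tensor_algebra K H H) \<and>
    counit H \<in> ring_hom H K \<and>
    (\<forall>c\<in>carrier K. \<forall>h\<in>carrier H. counit H (c \<odot>\<^bsub>H\<^esub> h) = c \<otimes>\<^bsub>K\<^esub> counit H h) \<and>
    antipode H \<in> module_hom K H H \<and>
    (\<forall>h\<in>carrier H.
      tensor_assoc K H H H (tensor_map K H H (tensor_space K H H) H (comult H) id (comult H h))
        = tensor_map K H H H (tensor_space K H H) id (comult H) (comult H h)) \<and>
    (\<forall>h\<in>carrier H.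
      tensor_lift K H H H (\<lambda>h1 h2. counit H h1 \<odot>\<^bsub>H\<^esub> h2) (comult H h) = h \<and>
      tensor_lift K H H H (\<lambda>h1 h2. counit H h2 \<odot>\<^bsub>H\<^esub> h1) (comult H h) = h) \<and>
    (\<forall>h\<in>carrier H.
      tensor_lift K H H H (\<lambda>h1 h2. antipode H h1 \<otimes>\<^bsub>H\<^esub> h2) (comult H h) = counit H h \<odot>\<^bsub>H\<^esub> \<one>\<^bsub>H\<^esub> \<and>
      tensor_lift K H H H (\<lambda>h1 h2. h1 \<otimes>\<^bsub>H\<^esub> antipode H h2) (comult H h) = counit H h \<odot>\<^bsub>H\<^esub> \<one>\<^bsub>H\<^esub>)"

text \<open>
  \<open>h\<^sup>o\<^sup>p\<close> is identified with \<open>h\<close>: only the product and the antipode change.  The inverse of the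
  antipode is meaningful because the antipode of a finite-dimensional Hopf algebra is bijective.
\<close>

definition hopf_op :: "('k, 'h) hopf \<Rightarrow> ('k, 'h) hopf" where
  "hopf_op H = H\<lparr>mult := (\<lambda>x y. y \<otimes>\<^bsub>H\<^esub> x), antipode := inv_into (carrier H) (antipode H)\<rparr>"


section \<open>Actions and coactions\<close>

text \<open>
  Actions, coactions and morphisms are extensional (\<open>undefined\<close> off the carriers), so that
  equal structure maps are equal as HOL functions.
\<close>

definition left_action ::
  "'k ring \<Rightarrow> ('k, 'h) hopf \<Rightarrow> ('k, 'x) module \<Rightarrow> ('h \<Rightarrow> 'x \<Rightarrow> 'x) \<Rightarrow> bool" where
  "left_action K H X act \<longleftrightarrow>
    act \<in> carrier H \<rightarrow>\<^sub>E carrier X \<rightarrow>\<^sub>E carrier X \<and>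
    (\<forall>h\<in>carrier H. act h \<in> module_hom K X X) \<and>
    (\<forall>x\<in>carrier X. (\<lambda>h. act h x) \<in> module_hom K H X) \<and>
    (\<forall>x\<in>carrier X. act \<one>\<^bsub>H\<^esub> x = x) \<and>
    (\<forall>h\<in>carrier H. \<forall>l\<in>carrier H. \<forall>x\<in>carrier X. act (h \<otimes>\<^bsub>H\<^esub> l) x = act h (act l x)) \<and>
    (\<forall>h\<in>carrier H. \<forall>x\<in>carrier X. \<forall>y\<in>carrier X.
      act h (x \<otimes>\<^bsub>X\<^esub> y) = tensor_lift K H H X (\<lambda>h1 h2. act h1 x \<otimes>\<^bsub>X\<^esub> act h2 y) (comult H h)) \<and>
    (\<forall>h\<in>carrier H. act h \<one>\<^bsub>X\<^esub> = counit H h \<odot>\<^bsub>X\<^esub> \<one>\<^bsub>X\<^esub>)"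

definition right_action ::
  "'k ring \<Rightarrow> ('k, 'h) hopf \<Rightarrow> ('k, 'x) module \<Rightarrow> ('x \<Rightarrow> 'h \<Rightarrow> 'x) \<Rightarrow> bool" where
  "right_action K H X act \<longleftrightarrow>
    act \<in> carrier X \<rightarrow>\<^sub>E carrier H \<rightarrow>\<^sub>E carrier X \<and>
    (\<forall>h\<in>carrier H. (\<lambda>x. act x h) \<in> module_hom K X X) \<and>
    (\<forall>x\<in>carrier X. act x \<in> module_hom K H X) \<and>
    (\<forall>x\<in>carrier X. act x \<one>\<^bsub>H\<^esub> = x) \<and>
    (\<forall>x\<in>carrier X. \<forall>h\<in>carrier H. \<forall>l\<in>carrier H. act x (h \<otimes>\<^bsub>H\<^esub> l) = act (act x h) l) \<and>
    (\<forall>x\<in>carrier X. \<forall>y\<in>carrier X. \<forall>h\<in>carrier H.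
      act (x \<otimes>\<^bsub>X\<^esub> y) h = tensor_lift K H H X (\<lambda>h1 h2. act x h1 \<otimes>\<^bsub>X\<^esub> act y h2) (comult H h)) \<and>
    (\<forall>h\<in>carrier H. act \<one>\<^bsub>X\<^esub> h = counit H h \<odot>\<^bsub>X\<^esub> \<one>\<^bsub>X\<^esub>)"

definition right_coaction ::
  "'k ring \<Rightarrow> ('k, 'h) hopf \<Rightarrow> ('k, 'x) module \<Rightarrow> ('x \<Rightarrow> ('x \<times> 'h \<Rightarrow> 'k) set) \<Rightarrow> bool" where
  "right_coaction K H X \<delta> \<longleftrightarrow>
    \<delta> \<in> extensional (carrier X) \<and>
    \<delta> \<in> algebra_hom K X (tensor_algebra K X H) \<and>
    (\<forall>x\<in>carrier X.
      tensor_assoc K X H H (tensor_map K X H (tensor_space K X H) H \<delta> id (\<delta> x))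
        = tensor_map K X H X (tensor_space K H H) id (comult H) (\<delta> x)) \<and>
    (\<forall>x\<in>carrier X. tensor_lift K X H X (\<lambda>x0 x1. counit H x1 \<odot>\<^bsub>X\<^esub> x0) (\<delta> x) = x)"

definition left_coaction ::
  "'k ring \<Rightarrow> ('k, 'h) hopf \<Rightarrow> ('k, 'x) module \<Rightarrow> ('x \<Rightarrow> ('h \<times> 'x \<Rightarrow> 'k) set) \<Rightarrow> bool" where
  "left_coaction K H X \<delta> \<longleftrightarrow>
    \<delta> \<in> extensional (carrier X) \<and>
    \<delta> \<in> algebra_hom K X (tensor_algebra K H X) \<and>
    (\<forall>x\<in>carrier X.
      tensor_assoc K H H X (tensor_map K H X (tensor_space K H H) X (comult H) id (\<delta> x))
        = tensor_map K H X H (tensor_space K H X) id \<delta> (\<delta> x)) \<and>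
    (\<forall>x\<in>carrier X. tensor_lift K H X X (\<lambda>x1 x0. counit H x1 \<odot>\<^bsub>X\<^esub> x0) (\<delta> x) = x)"


section \<open>Categories, functors and equivalences\<close>

text \<open>\<open>cmp C X Y Z g f\<close> is the composite of \<open>f : X \<rightarrow> Y\<close> and \<open>g : Y \<rightarrow> Z\<close>.\<close>

record ('o, 'a) category =
  Obj :: "'o set"
  Hom :: "'o \<Rightarrow> 'o \<Rightarrow> 'a set"
  ident :: "'o \<Rightarrow> 'a"
  cmp :: "'o \<Rightarrow> 'o \<Rightarrow> 'o \<Rightarrow> 'a \<Rightarrow> 'a \<Rightarrow> 'a"

definition is_category :: "('o, 'a) category \<Rightarrow> bool" where
  "is_category C \<longleftrightarrow>
    (\<forall>X\<in>Obj C. ident C X \<in> Hom C X X) \<and>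
    (\<forall>X\<in>Obj C. \<forall>Y\<in>Obj C. \<forall>Z\<in>Obj C. \<forall>f\<in>Hom C X Y. \<forall>g\<in>Hom C Y Z. cmp C X Y Z g f \<in> Hom C X Z) \<and>
    (\<forall>X\<in>Obj C. \<forall>Y\<in>Obj C. \<forall>f\<in>Hom C X Y.
      cmp C X X Y f (ident C X) = f \<and> cmp C X Y Y (ident C Y) f = f) \<and>
    (\<forall>W\<in>Obj C. \<forall>X\<in>Obj C. \<forall>Y\<in>Obj C. \<forall>Z\<in>Obj C.
      \<forall>f\<in>Hom C W X. \<forall>g\<in>Hom C X Y. \<forall>h\<in>Hom C Y Z.
        cmp C W X Z (cmp C X Y Z h g) f = cmp C W Y Z h (cmp C W X Y g f))"

definition isomorphism :: "('o, 'a) category \<Rightarrow> 'o \<Rightarrow> 'o \<Rightarrow> 'a \<Rightarrow> bool" where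
  "isomorphism C X Y f \<longleftrightarrow> f \<in> Hom C X Y \<and>
    (\<exists>g\<in>Hom C Y X. cmp C X Y X g f = ident C X \<and> cmp C Y X Y f g = ident C Y)"

record ('o, 'a, 'p, 'b) cat_functor =
  src :: "('o, 'a) category"
  tgt :: "('p, 'b) category"
  omap :: "'o \<Rightarrow> 'p"
  amap :: "'o \<Rightarrow> 'o \<Rightarrow> 'a \<Rightarrow> 'b"

definition is_functor :: "('o, 'a, 'p, 'b) cat_functor \<Rightarrow> bool" where
  "is_functor F \<longleftrightarrow>
    is_category (src F) \<and> is_category (tgt F) \<and>
    omap F \<in> Obj (src F) \<rightarrow>\<^sub>E Obj (tgt F) \<and>
    amap F \<in> (\<Pi>\<^sub>E X\<in>Obj (src F). \<Pi>\<^sub>E Y\<in>Obj (src F).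
      Hom (src F) X Y \<rightarrow>\<^sub>E Hom (tgt F) (omap F X) (omap F Y)) \<and>
    (\<forall>X\<in>Obj (src F). amap F X X (ident (src F) X) = ident (tgt F) (omap F X)) \<and>
    (\<forall>X\<in>Obj (src F). \<forall>Y\<in>Obj (src F). \<forall>Z\<in>Obj (src F).
      \<forall>f\<in>Hom (src F) X Y. \<forall>g\<in>Hom (src F) Y Z.
        amap F X Z (cmp (src F) X Y Z g f) =
          cmp (tgt F) (omap F X) (omap F Y) (omap F Z) (amap F Y Z g) (amap F X Y f))"

definition id_functor :: "('o, 'a) category \<Rightarrow> ('o, 'a, 'o, 'a) cat_functor" where
  "id_functor C =
    \<lparr>src = C, tgt = C, omap = (\<lambda>X\<in>Obj C. X), amap = (\<lambda>X\<in>Obj C. \<lambda>Y\<in>Obj C. \<lambda>f\<in>Hom C X Y. f)\<rparr>"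

definition comp_functor ::
  "('p, 'b, 'q, 'c) cat_functor \<Rightarrow> ('o, 'a, 'p, 'b) cat_functor \<Rightarrow> ('o, 'a, 'q, 'c) cat_functor" where
  "comp_functor G F =
    \<lparr>src = src F, tgt = tgt G,
     omap = (\<lambda>X\<in>Obj (src F). omap G (omap F X)),
     amap = (\<lambda>X\<in>Obj (src F). \<lambda>Y\<in>Obj (src F). \<lambda>f\<in>Hom (src F) X Y.
       amap G (omap F X) (omap F Y) (amap F X Y f))\<rparr>"

definition naturally_isomorphic ::
  "('o, 'a, 'p, 'b) cat_functor \<Rightarrow> ('o, 'a, 'p, 'b) cat_functor \<Rightarrow> bool" where
  "naturally_isomorphic F G \<longleftrightarrow>
    src F = src G \<and> tgt F = tgt G \<and>
    (\<exists>\<eta>. (\<forall>X\<in>Obj (src F). isomorphism (tgt F) (omap F X) (omap G X) (\<eta> X)) \<and>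
      (\<forall>X\<in>Obj (src F). \<forall>Y\<in>Obj (src F). \<forall>f\<in>Hom (src F) X Y.
        cmp (tgt F) (omap F X) (omap G X) (omap G Y) (amap G X Y f) (\<eta> X) =
        cmp (tgt F) (omap F X) (omap F Y) (omap G Y) (\<eta> Y) (amap F X Y f)))"

definition equivalence_of_categories :: "('o, 'a, 'p, 'b) cat_functor \<Rightarrow> bool" where
  "equivalence_of_categories F \<longleftrightarrow>
    is_functor F \<and>
    (\<exists>G. is_functor G \<and> src G = tgt F \<and> tgt G = src F \<and>
      naturally_isomorphic (comp_functor G F) (id_functor (src F)) \<and>
      naturally_isomorphic (comp_functor F G) (id_functor (tgt F)))"


section \<open>Yetter--Drinfeld algebras\<close>

type_synonym ('k, 'h, 'x) lr_object =
  "('k, 'x) module \<times> ('h \<Rightarrow> 'x \<Rightarrow> 'x) \<times> ('x \<Rightarrow> ('x \<times> 'h \<Rightarrow> 'k) set)"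

type_synonym ('k, 'h, 'x) rl_object =
  "('k, 'x) module \<times> ('x \<Rightarrow> 'h \<Rightarrow> 'x) \<times> ('x \<Rightarrow> ('h \<times> 'x \<Rightarrow> 'k) set)"

text \<open>
  The coaction takes values in the algebra \<open>X \<otimes> H\<^sup>o\<^sup>p\<close>, but the products of elements of \<open>H\<close> in the
  compatibility condition are those of \<open>H\<close>.
\<close>

definition lr_yetter_drinfeld :: "'k ring \<Rightarrow> ('k, 'h) hopf \<Rightarrow> ('k, 'h, 'x) lr_object \<Rightarrow> bool" where
  "lr_yetter_drinfeld K H = (\<lambda>(X, act, \<delta>).
    unital_algebra K X \<and> left_action K H X act \<and> right_coaction K (hopf_op H) X \<delta> \<and>
    (\<forall>k\<in>carrier H. \<forall>x\<in>carrier X.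
      tensor_lift K H H (tensor_space K X H)
        (\<lambda>k1 k2. tensor_lift K X H (tensor_space K X H)
          (\<lambda>x0 x1. tens K X H (act k1 x0) (k2 \<otimes>\<^bsub>H\<^esub> x1)) (\<delta> x)) (comult H k)
      = tensor_lift K H H (tensor_space K X H)
        (\<lambda>k1 k2. tensor_lift K X H (tensor_space K X H)
          (\<lambda>y0 y1. tens K X H y0 (y1 \<otimes>\<^bsub>H\<^esub> k1)) (\<delta> (act k2 x))) (comult H k)))"

definition rl_yetter_drinfeld :: "'k ring \<Rightarrow> ('k, 'h) hopf \<Rightarrow> ('k, 'h, 'x) rl_object \<Rightarrow> bool" where
  "rl_yetter_drinfeld K H = (\<lambda>(X, act, \<delta>).
    unital_algebra K X \<and> right_action K H X act \<and> left_coaction K (hopf_op H) X \<delta> \<and>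
    (\<forall>k\<in>carrier H. \<forall>x\<in>carrier X.
      tensor_lift K H H (tensor_space K H X)
        (\<lambda>k1 k2. tensor_lift K H X (tensor_space K H X)
          (\<lambda>x1 x0. tens K H X (x1 \<otimes>\<^bsub>H\<^esub> k1) (act x0 k2)) (\<delta> x)) (comult H k)
      = tensor_lift K H H (tensor_space K H X)
        (\<lambda>k1 k2. tensor_lift K H X (tensor_space K H X)
          (\<lambda>y1 y0. tens K H X (k2 \<otimes>\<^bsub>H\<^esub> y1) y0) (\<delta> (act x k1))) (comult H k)))"

definition lr_YD :: "'k ring \<Rightarrow> ('k, 'h) hopf \<Rightarrow> (('k, 'h, 'x) lr_object, 'x \<Rightarrow> 'x) category" where
  "lr_YD K H =
    \<lparr>Obj = {A. lr_yetter_drinfeld K H A},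
     Hom = (\<lambda>(X, act, \<delta>) (Y, act', \<delta>'). {f.
       f \<in> extensional (carrier X) \<and> f \<in> algebra_hom K X Y \<and>
       (\<forall>h\<in>carrier H. \<forall>x\<in>carrier X. f (act h x) = act' h (f x)) \<and>
       (\<forall>x\<in>carrier X. tensor_map K X H Y H f id (\<delta> x) = \<delta>' (f x))}),
     ident = (\<lambda>(X, _, _). \<lambda>x\<in>carrier X. x),
     cmp = (\<lambda>(X, _, _) _ _ g f. compose (carrier X) g f)\<rparr>"

definition rl_YD :: "'k ring \<Rightarrow> ('k, 'h) hopf \<Rightarrow> (('k, 'h, 'x) rl_object, 'x \<Rightarrow> 'x) category" where
  "rl_YD K H =
    \<lparr>Obj = {A. rl_yetter_drinfeld K H A},
     Hom = (\<lambda>(X, act, \<delta>) (Y, act', \<delta>'). {f.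
       f \<in> extensional (carrier X) \<and> f \<in> algebra_hom K X Y \<and>
       (\<forall>h\<in>carrier H. \<forall>x\<in>carrier X. f (act x h) = act' (f x) h) \<and>
       (\<forall>x\<in>carrier X. tensor_map K H X H Y id f (\<delta> x) = \<delta>' (f x))}),
     ident = (\<lambda>(X, _, _). \<lambda>x\<in>carrier X. x),
     cmp = (\<lambda>(X, _, _) _ _ g f. compose (carrier X) g f)\<rparr>"


section \<open>The functors\<close>

definition lr_to_rl ::
  "'k ring \<Rightarrow> ('k, 'h) hopf \<Rightarrow> ('k, 'h, 'x) lr_object \<Rightarrow> ('k, 'h, 'x) rl_object" where
  "lr_to_rl K H = (\<lambda>(X, act, \<delta>).
    (X,
     (\<lambda>x\<in>carrier X. \<lambda>h\<in>carrier H. act h x),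
     (\<lambda>x\<in>carrier X. tensor_lift K X H (tensor_space K H X)
        (\<lambda>x0 x1. tens K H X (antipode H x1) x0) (\<delta> x))))"

definition rl_to_lr ::
  "'k ring \<Rightarrow> ('k, 'h) hopf \<Rightarrow> ('k, 'h, 'x) rl_object \<Rightarrow> ('k, 'h, 'x) lr_object" where
  "rl_to_lr K H = (\<lambda>(X, act, \<delta>).
    (X,
     (\<lambda>h\<in>carrier H. \<lambda>x\<in>carrier X. act x h),
     (\<lambda>x\<in>carrier X. tensor_lift K H X (tensor_space K X H)
        (\<lambda>x1 x0. tens K X H x0 (antipode H x1)) (\<delta> x))))"

definition YD_functor ::
  "'k ring \<Rightarrow> ('k, 'h) hopf
    \<Rightarrow> (('k, 'h, 'x) lr_object, 'x \<Rightarrow> 'x, ('k, 'h, 'x) rl_object, 'x \<Rightarrow> 'x) cat_functor" where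
  "YD_functor K H =
    \<lparr>src = lr_YD K H,
     tgt = rl_YD K (hopf_op H),
     omap = (\<lambda>A\<in>Obj (lr_YD K H). lr_to_rl K H A),
     amap = (\<lambda>A\<in>Obj (lr_YD K H). \<lambda>B\<in>Obj (lr_YD K H). \<lambda>f\<in>Hom (lr_YD K H) A B. f)\<rparr>"

definition YD_functor' ::
  "'k ring \<Rightarrow> ('k, 'h) hopf
    \<Rightarrow> (('k, 'h, 'x) rl_object, 'x \<Rightarrow> 'x, ('k, 'h, 'x) lr_object, 'x \<Rightarrow> 'x) cat_functor" where
  "YD_functor' K H =
    \<lparr>src = rl_YD K H,
     tgt = lr_YD K (hopf_op H),
     omap = (\<lambda>A\<in>Obj (rl_YD K H). rl_to_lr K H A),
     amap = (\<lambda>A\<in>Obj (rl_YD K H). \<lambda>B\<in>Obj (rl_YD K H). \<lambda>f\<in>Hom (rl_YD K H) A B. f)\<rparr>"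

end

theory Submission
  imports Defs
begin

text \<open>
  Both functors keep the algebra, the morphisms and, up to the side on which it is written, the
  action; they compose the coaction with the antipode \<open>S\<close>.  Because \<open>S\<close> reverses products and
  coproducts (\<open>antipode_mult\<close>, \<open>antipode_comult\<close>), this turns a right coaction of \<open>H\<^sup>o\<^sup>p\<close> into a left
  coaction of \<open>(H\<^sup>o\<^sup>p)\<^sup>o\<^sup>p\<close> and vice versa (\<open>left_coaction_op\<close>, \<open>right_coaction_op\<close>).

  For the compatibility conditions, fix \<open>x \<in> X\<close> and let \<open>H\<close> act on both sides of the first factor of
  \<open>H \<otimes> X\<close>.  Put \<open>\<phi>(k) = \<Sum> S(x\<^sub>[\<^sub>1\<^sub>]) \<otimes> (k \<rhd> x\<^sub>[\<^sub>0\<^sub>])\<close> and \<open>\<psi>(k) = \<delta>\<^sub>S(k \<rhd> x)\<close>.  Applying \<open>S\<close> to the condition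
  over \<open>H\<close> gives \<open>\<phi> * S = S * \<psi>\<close> for the convolution product \<open>*\<close>, while the condition over \<open>H\<^sup>o\<^sup>p\<close> reads
  \<open>id * \<phi> = \<psi> * id\<close>.  As \<open>S\<close> and \<open>id\<close> are inverse to each other under convolution, the first equation
  implies the second (\<open>conv_intertwine\<close>).  The other functor exchanges \<open>\<phi>\<close> and \<open>\<psi>\<close>.

  The antipode of \<open>H\<^sup>o\<^sup>p\<close> is \<open>S\<^sup>-\<^sup>1\<close>, so the two composites with the functors of \<open>H\<^sup>o\<^sup>p\<close> are identities as soon
  as \<open>S\<close> is bijective.  This is where finite dimension enters (\<open>antipode_bij\<close>).  For a functional \<open>p\<close> let
  \<open>\<lambda>\<^sub>p(x)\<close> be the trace of \<open>a \<mapsto> \<Sum> p(a\<^sub>2) x S\<^sup>2(a\<^sub>1)\<close>.  Cyclicity of the trace gives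
  \<open>\<Sum> \<lambda>\<^sub>p(x\<^sub>2) x\<^sub>1 = \<lambda>\<^sub>p(x) 1\<close> (\<open>integral_invariant\<close>), and this invariance forces \<open>\<lambda>\<^sub>p(y) h = 0\<close> for all \<open>p\<close> and \<open>y\<close>
  whenever \<open>S(h) = 0\<close> (\<open>antipode_kernel_integral\<close>).  On the other hand \<open>\<Sum>\<^sub>k \<lambda>\<^sub>p(S(k)) = 1\<close> when \<open>k\<close> runs through
  a basis and \<open>p\<close> is the coordinate functional of \<open>k\<close> (\<open>integral_total\<close>).  Hence \<open>S\<close> is injective.

  That both functors are equivalences follows by using the two identities for \<open>H\<close> and for \<open>H\<^sup>o\<^sup>p\<close>.
  The antipode of \<open>(H\<^sup>o\<^sup>p)\<^sup>o\<^sup>p\<close> may differ from \<open>S\<close> outside the carrier, but the categories do not mention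
  the antipode (\<open>YD_op_op\<close>), and the functors see it on the carrier only (\<open>YD_functor_op_op\<close>).

  Sweedler sums are values of \<open>tensor_lift\<close> at multilinear maps, so that every calculation rests on
  the universal property of the tensor product (\<open>tensor_lift_tens\<close>, \<open>tensor_ext\<close>).
\<close>

section \<open>Linear and bilinear maps\<close>

abbreviation lin ::
  "'k ring \<Rightarrow> ('k, 'a, 'm) module_scheme \<Rightarrow> ('k, 'b, 'n) module_scheme \<Rightarrow> ('a \<Rightarrow> 'b) \<Rightarrow> bool" where
  "lin K A B f \<equiv> f \<in> module_hom K A B"

definition bilinear ::
  "'k ring \<Rightarrow> ('k, 'a, 'm) module_scheme \<Rightarrow> ('k, 'b, 'n) module_scheme \<Rightarrow> ('k, 'p, 'q) module_scheme
    \<Rightarrow> ('a \<Rightarrow> 'b \<Rightarrow> 'p) \<Rightarrow> bool" where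
  "bilinear K A B P f \<longleftrightarrow>
    (\<forall>a\<in>carrier A. lin K B P (f a)) \<and> (\<forall>b\<in>carrier B. lin K A P (\<lambda>a. f a b))"

lemma linI:
  assumes "\<And>x. x \<in> carrier A \<Longrightarrow> f x \<in> carrier B"
    and "\<And>x y. x \<in> carrier A \<Longrightarrow> y \<in> carrier A \<Longrightarrow> f (x \<oplus>\<^bsub>A\<^esub> y) = f x \<oplus>\<^bsub>B\<^esub> f y"
    and "\<And>c x. c \<in> carrier K \<Longrightarrow> x \<in> carrier A \<Longrightarrow> f (c \<odot>\<^bsub>A\<^esub> x) = c \<odot>\<^bsub>B\<^esub> f x"
  shows "lin K A B f"
  using assms by (auto simp: module_hom_def)

lemma lin_closed: "lin K A B f \<Longrightarrow> x \<in> carrier A \<Longrightarrow> f x \<in> carrier B"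
  by (auto simp: module_hom_def)

lemma lin_add:
  "lin K A B f \<Longrightarrow> x \<in> carrier A \<Longrightarrow> y \<in> carrier A \<Longrightarrow> f (x \<oplus>\<^bsub>A\<^esub> y) = f x \<oplus>\<^bsub>B\<^esub> f y"
  by (auto simp: module_hom_def)

lemma lin_smult:
  "lin K A B f \<Longrightarrow> c \<in> carrier K \<Longrightarrow> x \<in> carrier A \<Longrightarrow> f (c \<odot>\<^bsub>A\<^esub> x) = c \<odot>\<^bsub>B\<^esub> f x"
  by (auto simp: module_hom_def)

lemma lin_cong:
  assumes "\<And>x. x \<in> carrier A \<Longrightarrow> f x = g x" "module K A"
  shows "lin K A B f \<longleftrightarrow> lin K A B g"
proof -
  interpret A: module K A by fact
  show ?thesis
    using assms(1) by (auto simp: module_hom_def Pi_iff)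
qed

lemma lin_id: "lin K A A (\<lambda>x. x)"
  by (auto simp: module_hom_def)

lemma lin_compose: "lin K B C g \<Longrightarrow> lin K A B f \<Longrightarrow> lin K A C (\<lambda>x. g (f x))"
  by (auto simp: module_hom_def Pi_iff)

lemma lin_zero: "module K A \<Longrightarrow> module K B \<Longrightarrow> lin K A B f \<Longrightarrow> f \<zero>\<^bsub>A\<^esub> = \<zero>\<^bsub>B\<^esub>"
  by (rule mod_hom.f0_is_0) (simp add: mod_hom_def mod_hom_axioms_def)

lemma lin_finsum:
  assumes "module K A" "module K B" "lin K A B f" "finite J" "\<And>j. j \<in> J \<Longrightarrow> g j \<in> carrier A"
  shows "f (\<Oplus>\<^bsub>A\<^esub>j\<in>J. g j) = (\<Oplus>\<^bsub>B\<^esub>j\<in>J. f (g j))"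
proof -
  interpret A: module K A by fact
  interpret B: module K B by fact
  show ?thesis
    using assms(4,5)
  proof (induction J rule: finite_induct)
    case empty
    then show ?case using lin_zero[OF assms(1-3)] by simp
  next
    case (insert j J)
    then have "f (\<Oplus>\<^bsub>A\<^esub>j\<in>insert j J. g j) = f (g j) \<oplus>\<^bsub>B\<^esub> f (\<Oplus>\<^bsub>A\<^esub>j\<in>J. g j)"
      by (simp add: Pi_iff lin_add[OF assms(3)])
    then show ?case
      using insert lin_closed[OF assms(3)] by (simp add: Pi_iff)
  qed
qed

lemma lin_finsum_fun:
  assumes "module K A" "module K B" "finite J" "\<And>j. j \<in> J \<Longrightarrow> lin K A B (\<lambda>x. F x j)"
  shows "lin K A B (\<lambda>x. \<Oplus>\<^bsub>B\<^esub>j\<in>J. F x j)"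
proof -
  interpret A: module K A by fact
  interpret B: module K B by fact
  have cl: "\<And>j x. j \<in> J \<Longrightarrow> x \<in> carrier A \<Longrightarrow> F x j \<in> carrier B"
    using assms(4) lin_closed by fastforce
  show ?thesis
  proof (rule linI, goal_cases)
    case (1 x)
    then show ?case using cl by (auto intro!: B.finsum_closed)
  next
    case (2 x y)
    have "(\<Oplus>\<^bsub>B\<^esub>j\<in>J. F (x \<oplus>\<^bsub>A\<^esub> y) j) = (\<Oplus>\<^bsub>B\<^esub>j\<in>J. F x j \<oplus>\<^bsub>B\<^esub> F y j)"
      using 2 cl by (intro B.finsum_cong') (auto simp: lin_add[OF assms(4)])
    then show ?case
      using 2 cl by (simp add: B.finsum_addf Pi_iff)
  next
    case (3 c x)
    have "(\<Oplus>\<^bsub>B\<^esub>j\<in>J. F (c \<odot>\<^bsub>A\<^esub> x) j) = (\<Oplus>\<^bsub>B\<^esub>j\<in>J. c \<odot>\<^bsub>B\<^esub> F x j)"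
      using 3 cl by (intro B.finsum_cong') (auto simp: lin_smult[OF assms(4)])
    then show ?case
      using 3 cl assms(3) by (simp add: B.finsum_smult Pi_iff)
  qed
qed

lemma bilinearI:
  assumes "\<And>a. a \<in> carrier A \<Longrightarrow> lin K B P (\<lambda>b. f a b)"
    and "\<And>b. b \<in> carrier B \<Longrightarrow> lin K A P (\<lambda>a. f a b)"
  shows "bilinear K A B P (\<lambda>a b. f a b)"
  using assms by (simp add: bilinear_def)

lemma bilinear_left: "bilinear K A B P f \<Longrightarrow> b \<in> carrier B \<Longrightarrow> lin K A P (\<lambda>a. f a b)"
  by (simp add: bilinear_def)

lemma bilinear_right: "bilinear K A B P f \<Longrightarrow> a \<in> carrier A \<Longrightarrow> lin K B P (\<lambda>b. f a b)"
  by (simp add: bilinear_def)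

lemma bilinear_closed:
  "bilinear K A B P f \<Longrightarrow> a \<in> carrier A \<Longrightarrow> b \<in> carrier B \<Longrightarrow> f a b \<in> carrier P"
  using bilinear_left lin_closed by fastforce

section \<open>The universal property of the tensor product\<close>

text \<open>The sum that defines \<open>tensor_lift\<close>, as a function of the chosen representative.\<close>

definition free_lift ::
  "'k ring \<Rightarrow> ('k, 'p, 'q) module_scheme \<Rightarrow> ('i \<Rightarrow> 'p) \<Rightarrow> ('i \<Rightarrow> 'k) \<Rightarrow> 'p" where
  "free_lift K P f r = (\<Oplus>\<^bsub>P\<^esub>i\<in>{i. r i \<noteq> \<zero>\<^bsub>K\<^esub>}. r i \<odot>\<^bsub>P\<^esub> f i)"

lemma free_module_simps:
  "carrier (free_module K I) =
    {f. range f \<subseteq> carrier K \<and> finite {i. f i \<noteq> \<zero>\<^bsub>K\<^esub>} \<and> {i. f i \<noteq> \<zero>\<^bsub>K\<^esub>} \<subseteq> I}"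
  "\<zero>\<^bsub>free_module K I\<^esub> = (\<lambda>i. \<zero>\<^bsub>K\<^esub>)"
  "f \<oplus>\<^bsub>free_module K I\<^esub> g = (\<lambda>i. f i \<oplus>\<^bsub>K\<^esub> g i)"
  "c \<odot>\<^bsub>free_module K I\<^esub> f = (\<lambda>i. c \<otimes>\<^bsub>K\<^esub> f i)"
  by (simp_all add: free_module_def)

lemma free_module_is_module:
  assumes "cring K"
  shows "module K (free_module K I)"
proof -
  interpret cring K by fact
  have supp: "finite {i. f i \<noteq> \<zero>\<^bsub>K\<^esub>} \<and> {i. f i \<noteq> \<zero>\<^bsub>K\<^esub>} \<subseteq> I" "range f \<subseteq> carrier K"
    if "f \<in> carrier (free_module K I)" for f
    using that by (auto simp: free_module_simps)
  show ?thesis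
  proof (rule moduleI)
    show "abelian_group (free_module K I)"
    proof (rule abelian_groupI, goal_cases)
      case (1 f g)
      have sub: "{i. f i \<oplus>\<^bsub>K\<^esub> g i \<noteq> \<zero>\<^bsub>K\<^esub>} \<subseteq> {i. f i \<noteq> \<zero>\<^bsub>K\<^esub>} \<union> {i. g i \<noteq> \<zero>\<^bsub>K\<^esub>}"
        by auto
      moreover from sub have "finite {i. f i \<oplus>\<^bsub>K\<^esub> g i \<noteq> \<zero>\<^bsub>K\<^esub>}"
        using supp[OF 1(1)] supp[OF 1(2)] finite_subset by blast
      moreover have "{i. f i \<oplus>\<^bsub>K\<^esub> g i \<noteq> \<zero>\<^bsub>K\<^esub>} \<subseteq> I"
        using sub supp[OF 1(1)] supp[OF 1(2)] by blast
      moreover have "f i \<oplus>\<^bsub>K\<^esub> g i \<in> carrier K" for i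
        using supp(2)[OF 1(1)] supp(2)[OF 1(2)] by (auto simp: image_subset_iff)
      ultimately show ?case
        by (auto simp: free_module_simps)
    next
      case (6 f)
      have "(\<lambda>i. \<ominus>\<^bsub>K\<^esub> f i) \<in> carrier (free_module K I)"
        using supp[OF 6] by (auto simp: free_module_simps
            intro!: finite_subset[of "{i. \<ominus>\<^bsub>K\<^esub> f i \<noteq> \<zero>\<^bsub>K\<^esub>}" "{i. f i \<noteq> \<zero>\<^bsub>K\<^esub>}"])
      then show ?case
        using supp[OF 6]
        by (intro bexI[of _ "\<lambda>i. \<ominus>\<^bsub>K\<^esub> f i"]) (auto simp: free_module_simps fun_eq_iff l_neg image_subset_iff)
    qed (auto simp: free_module_simps fun_eq_iff a_ac image_subset_iff)
  next
    fix a f assume a: "a \<in> carrier K" "f \<in> carrier (free_module K I)"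
    show "a \<odot>\<^bsub>free_module K I\<^esub> f \<in> carrier (free_module K I)"
      using supp[OF a(2)] a(1)
      by (auto simp: free_module_simps
          intro!: finite_subset[of "{i. a \<otimes>\<^bsub>K\<^esub> f i \<noteq> \<zero>\<^bsub>K\<^esub>}" "{i. f i \<noteq> \<zero>\<^bsub>K\<^esub>}"])
  qed (auto simp: free_module_simps fun_eq_iff l_distr r_distr m_assoc image_subset_iff assms)
qed

lemma free_basis_closed:
  assumes "cring K" "i \<in> I"
  shows "free_basis K i \<in> carrier (free_module K I)"
proof -
  interpret cring K by fact
  show ?thesis
    using assms(2) by (auto simp: free_module_simps free_basis_def intro!: finite_subset[of _ "{i}"])
qed

text \<open>Two representatives have different supports; their sums become comparable over a common finite
  set of indices.\<close>

lemma free_lift_superset: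
  assumes "module K P" "r \<in> carrier (free_module K I)" "finite J" "{i. r i \<noteq> \<zero>\<^bsub>K\<^esub>} \<subseteq> J"
    and "\<And>i. i \<in> J \<Longrightarrow> f i \<in> carrier P"
  shows "free_lift K P f r = (\<Oplus>\<^bsub>P\<^esub>i\<in>J. r i \<odot>\<^bsub>P\<^esub> f i)"
proof -
  interpret P: module K P by fact
  have "range r \<subseteq> carrier K" using assms(2) by (simp add: free_module_simps)
  then show ?thesis
    unfolding free_lift_def using assms(3-)
    by (intro P.add.finprod_mono_neutral_cong_left) (auto simp: image_subset_iff)
qed

lemma free_lift_linear:
  assumes P: "module K P" and f: "\<And>i. i \<in> I \<Longrightarrow> f i \<in> carrier P"
  shows "lin K (free_module K I) P (free_lift K P f)"
proof -
  interpret P: module K P by fact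
  let ?F = "free_module K I"
  interpret F: module K ?F by (rule free_module_is_module) (rule P.is_cring)
  have supp: "finite {i. r i \<noteq> \<zero>\<^bsub>K\<^esub>}" "{i. r i \<noteq> \<zero>\<^bsub>K\<^esub>} \<subseteq> I" "\<And>i. r i \<in> carrier K"
    if "r \<in> carrier ?F" for r
    using that by (auto simp: free_module_simps)
  show ?thesis
  proof (rule linI, goal_cases)
    case (1 r)
    then show ?case
      unfolding free_lift_def using supp[OF 1] f by (intro P.finsum_closed) auto
  next
    case (2 r s)
    let ?J = "{i. r i \<noteq> \<zero>\<^bsub>K\<^esub>} \<union> {i. s i \<noteq> \<zero>\<^bsub>K\<^esub>}"
    have J: "finite ?J" "?J \<subseteq> I" using supp[OF 2(1)] supp[OF 2(2)] by auto
    have fJ: "\<And>i. i \<in> ?J \<Longrightarrow> f i \<in> carrier P" using J f by blast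
    have "free_lift K P f (r \<oplus>\<^bsub>?F\<^esub> s) = (\<Oplus>\<^bsub>P\<^esub>i\<in>?J. (r \<oplus>\<^bsub>?F\<^esub> s) i \<odot>\<^bsub>P\<^esub> f i)"
      using fJ J by (intro free_lift_superset[OF P F.a_closed[OF 2]]) (auto simp: free_module_simps(3))
    also have "\<dots> = (\<Oplus>\<^bsub>P\<^esub>i\<in>?J. r i \<odot>\<^bsub>P\<^esub> f i \<oplus>\<^bsub>P\<^esub> s i \<odot>\<^bsub>P\<^esub> f i)"
      using fJ supp(3)[OF 2(1)] supp(3)[OF 2(2)]
      by (intro P.finsum_cong') (auto simp: free_module_simps(3) P.smult_l_distr)
    also have "\<dots> = (\<Oplus>\<^bsub>P\<^esub>i\<in>?J. r i \<odot>\<^bsub>P\<^esub> f i) \<oplus>\<^bsub>P\<^esub> (\<Oplus>\<^bsub>P\<^esub>i\<in>?J. s i \<odot>\<^bsub>P\<^esub> f i)"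
      using fJ supp(3)[OF 2(1)] supp(3)[OF 2(2)] by (intro P.finsum_addf) auto
    finally show ?case
      using free_lift_superset[OF P 2(1) J(1) _ fJ] free_lift_superset[OF P 2(2) J(1) _ fJ] by auto
  next
    case (3 c r)
    let ?J = "{i. r i \<noteq> \<zero>\<^bsub>K\<^esub>}"
    have J: "finite ?J" "?J \<subseteq> I" using supp[OF 3(2)] by auto
    have fJ: "\<And>i. i \<in> ?J \<Longrightarrow> f i \<in> carrier P" using J f by blast
    have "free_lift K P f (c \<odot>\<^bsub>?F\<^esub> r) = (\<Oplus>\<^bsub>P\<^esub>i\<in>?J. (c \<odot>\<^bsub>?F\<^esub> r) i \<odot>\<^bsub>P\<^esub> f i)"
      using 3(1) fJ J by (intro free_lift_superset[OF P F.smult_closed[OF 3]]) (auto simp: free_module_simps(4))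
    also have "\<dots> = (\<Oplus>\<^bsub>P\<^esub>i\<in>?J. c \<odot>\<^bsub>P\<^esub> (r i \<odot>\<^bsub>P\<^esub> f i))"
      using fJ supp(3)[OF 3(2)] 3(1)
      by (intro P.finsum_cong') (auto simp: free_module_simps(4) P.smult_assoc1)
    also have "\<dots> = c \<odot>\<^bsub>P\<^esub> (\<Oplus>\<^bsub>P\<^esub>i\<in>?J. r i \<odot>\<^bsub>P\<^esub> f i)"
      using fJ supp(3)[OF 3(2)] 3(1) J by (intro P.finsum_smult[symmetric]) auto
    finally show ?case unfolding free_lift_def .
  qed
qed

lemma free_lift_basis:
  assumes P: "module K P" and "f i \<in> carrier P"
  shows "free_lift K P f (free_basis K i) = f i"
proof -
  interpret P: module K P by fact
  have "free_lift K P f (free_basis K i) = (\<Oplus>\<^bsub>P\<^esub>j\<in>{i}. free_basis K i j \<odot>\<^bsub>P\<^esub> f j)"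
    using assms(2) by (intro free_lift_superset[OF P free_basis_closed[of K i "{i}"]])
      (auto simp: free_basis_def P.is_cring)
  then show ?thesis using assms(2) by (simp add: free_basis_def)
qed

lemma free_lift_unique:
  assumes P: "module K P" and g: "lin K (free_module K I) P g" and r: "r \<in> carrier (free_module K I)"
  shows "g r = free_lift K P (\<lambda>i. g (free_basis K i)) r"
proof -
  interpret P: module K P by fact
  let ?F = "free_module K I"
  interpret F: module K ?F by (rule free_module_is_module) (rule P.is_cring)
  have supp: "finite {i. r i \<noteq> \<zero>\<^bsub>K\<^esub>}" "{i. r i \<noteq> \<zero>\<^bsub>K\<^esub>} \<subseteq> I" "\<And>i. r i \<in> carrier K"
    using r by (auto simp: free_module_simps)
  have sum: "(\<Oplus>\<^bsub>?F\<^esub>i\<in>J. r i \<odot>\<^bsub>?F\<^esub> free_basis K i) = (\<lambda>j. if j \<in> J then r j else \<zero>\<^bsub>K\<^esub>)"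
    if "finite J" "J \<subseteq> I" for J
    using that
  proof (induction J rule: finite_induct)
    case empty
    then show ?case by (simp add: free_module_simps)
  next
    case (insert i J)
    have "(\<Oplus>\<^bsub>?F\<^esub>i\<in>insert i J. r i \<odot>\<^bsub>?F\<^esub> free_basis K i) =
      r i \<odot>\<^bsub>?F\<^esub> free_basis K i \<oplus>\<^bsub>?F\<^esub> (\<Oplus>\<^bsub>?F\<^esub>i\<in>J. r i \<odot>\<^bsub>?F\<^esub> free_basis K i)"
      using insert supp(3) by (intro F.finsum_insert) (auto intro!: F.smult_closed free_basis_closed P.is_cring)
    then show ?case
      using insert supp(3) by (auto simp: free_module_simps free_basis_def fun_eq_iff)
  qed
  have "g r = g (\<Oplus>\<^bsub>?F\<^esub>i\<in>{i. r i \<noteq> \<zero>\<^bsub>K\<^esub>}. r i \<odot>\<^bsub>?F\<^esub> free_basis K i)"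
    by (subst sum) (use supp in \<open>auto intro!: arg_cong[of _ _ g]\<close>)
  also have "\<dots> = (\<Oplus>\<^bsub>P\<^esub>i\<in>{i. r i \<noteq> \<zero>\<^bsub>K\<^esub>}. g (r i \<odot>\<^bsub>?F\<^esub> free_basis K i))"
    using supp by (intro lin_finsum[OF F.module_axioms P g]) (auto intro!: F.smult_closed free_basis_closed P.is_cring)
  also have "\<dots> = (\<Oplus>\<^bsub>P\<^esub>i\<in>{i. r i \<noteq> \<zero>\<^bsub>K\<^esub>}. r i \<odot>\<^bsub>P\<^esub> g (free_basis K i))"
    using supp by (intro P.finsum_cong')
      (auto intro!: lin_smult[OF g] P.smult_closed lin_closed[OF g] free_basis_closed P.is_cring)
  finally show ?thesis by (simp add: free_lift_def)
qed

lemma span_subset: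
  assumes "module K M" "S \<subseteq> carrier M" "submodule K N M" "S \<subseteq> N"
  shows "module.span K M S \<subseteq> N"
  using module.span_is_subset[OF assms(1,4,3)] .

definition coset_map ::
  "'k ring \<Rightarrow> ('k, 'a, 'm) module_scheme \<Rightarrow> ('k, 'b, 'n) module_scheme \<Rightarrow> ('a \<times> 'b \<Rightarrow> 'k)
    \<Rightarrow> ('a \<times> 'b \<Rightarrow> 'k) set" where
  "coset_map K A B r = relation_module K A B +>\<^bsub>pair_module K A B\<^esub> r"

locale module_pair = A: module K A + B: module K B
  for K :: "'k ring" and A :: "('k, 'a, 'm) module_scheme" and B :: "('k, 'b, 'n) module_scheme"
begin

abbreviation "F \<equiv> pair_module K A B"
abbreviation "N \<equiv> relation_module K A B"
abbreviation "T \<equiv> tensor_space K A B"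

sublocale F: module K F
  by (rule free_module_is_module) (rule A.is_cring)

lemma basis_closed: "a \<in> carrier A \<Longrightarrow> b \<in> carrier B \<Longrightarrow> free_basis K (a, b) \<in> carrier F"
  by (rule free_basis_closed) (auto simp: A.is_cring)

lemma relations_closed: "bilinear_relations K A B \<subseteq> carrier F"
  unfolding bilinear_relations_def Let_def
  by (auto intro!: F.M.minus_closed F.M.a_closed F.smult_closed basis_closed)

lemma N_submodule: "submodule K N F"
  unfolding relation_module_def by (rule F.span_is_submodule[OF relations_closed])

lemma relation_in_N: "r \<in> bilinear_relations K A B \<Longrightarrow> r \<in> N"
  unfolding relation_module_def using F.in_own_span[OF relations_closed] by blast

lemma N_subset: "N \<subseteq> carrier F"
  using N_submodule by (simp add: submodule_def)

lemma N_smult: "c \<in> carrier K \<Longrightarrow> r \<in> N \<Longrightarrow> c \<odot>\<^bsub>F\<^esub> r \<in> N"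
  using N_submodule by (simp add: submodule_def)

sublocale N: abelian_subgroup N F
proof (rule abelian_subgroupI3)
  have neg: "\<ominus>\<^bsub>F\<^esub> r \<in> N" if "r \<in> N" for r
    using N_smult[of "\<ominus>\<^bsub>K\<^esub> \<one>\<^bsub>K\<^esub>" r] that N_subset F.smult_minus_1[of r] by auto
  have "subgroup N (add_monoid F)"
    using N_submodule N_subset neg
    by (intro subgroup.intro) (auto simp: submodule_def a_inv_def[symmetric])
  then show "additive_subgroup N F" by (rule additive_subgroup.intro)
qed (rule F.M.abelian_group_axioms)

abbreviation "q \<equiv> coset_map K A B"

lemma q_eq_iff:
  assumes "r \<in> carrier F" "s \<in> carrier F"
  shows "q r = q s \<longleftrightarrow> r \<ominus>\<^bsub>F\<^esub> s \<in> N"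
  unfolding coset_map_def a_minus_def
  using N.a_rcos_module[OF assms(2,1)] N.a_repr_independence'[of r s] N.a_rcos_self[of r] assms
  by (metis N.a_repr_independenceD)

lemma mem_q: "r \<in> carrier F \<Longrightarrow> r \<in> q r"
  unfolding coset_map_def by (rule N.a_rcos_self)

lemma q_mem_eq: "s \<in> q r \<Longrightarrow> r \<in> carrier F \<Longrightarrow> s \<in> carrier F \<and> q s = q r"
  unfolding coset_map_def using N.a_elemrcos_carrier N.a_repr_independence' by metis

lemma T_carrier: "carrier T = q ` carrier F"
  by (auto simp: tensor_space_def Let_def coset_map_def A_RCOSETS_def' a_r_coset_def)

lemma T_zero: "\<zero>\<^bsub>T\<^esub> = q \<zero>\<^bsub>F\<^esub>"
  using N_subset F.M.a_coset_add_zero[of N] by (simp add: tensor_space_def Let_def coset_map_def)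

lemma T_add: "r \<in> carrier F \<Longrightarrow> s \<in> carrier F \<Longrightarrow> q r \<oplus>\<^bsub>T\<^esub> q s = q (r \<oplus>\<^bsub>F\<^esub> s)"
  by (simp add: tensor_space_def Let_def coset_map_def N.a_rcos_sum)

text \<open>The scalar multiple of a coset is defined as a union over representatives.  Multiples of two
  representatives differ by a multiple of a relation, so all members of the union are the same coset.\<close>

lemma T_smult:
  assumes "c \<in> carrier K" "r \<in> carrier F"
  shows "c \<odot>\<^bsub>T\<^esub> q r = q (c \<odot>\<^bsub>F\<^esub> r)"
proof -
  have "q (c \<odot>\<^bsub>F\<^esub> s) = q (c \<odot>\<^bsub>F\<^esub> r)" if "s \<in> q r" for s
  proof -
    from q_mem_eq[OF that assms(2)] have s: "s \<in> carrier F" "q s = q r" by auto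
    then have "c \<odot>\<^bsub>F\<^esub> (s \<ominus>\<^bsub>F\<^esub> r) \<in> N"
      using q_eq_iff assms N_smult by blast
    moreover have "c \<odot>\<^bsub>F\<^esub> (s \<ominus>\<^bsub>F\<^esub> r) = c \<odot>\<^bsub>F\<^esub> s \<ominus>\<^bsub>F\<^esub> c \<odot>\<^bsub>F\<^esub> r"
      using s assms by (simp add: a_minus_def F.smult_r_distr F.smult_r_minus)
    ultimately show ?thesis using s assms by (simp add: q_eq_iff)
  qed
  then have "(\<Union>s\<in>q r. q (c \<odot>\<^bsub>F\<^esub> s)) = (\<Union>s\<in>q r. q (c \<odot>\<^bsub>F\<^esub> r))"
    by (rule SUP_cong[OF refl])
  moreover have "c \<odot>\<^bsub>T\<^esub> q r = (\<Union>s\<in>q r. q (c \<odot>\<^bsub>F\<^esub> s))"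
    by (simp add: tensor_space_def Let_def coset_map_def)
  moreover have "q r \<noteq> {}" using mem_q[OF assms(2)] by blast
  ultimately show ?thesis by simp
qed

sublocale T: module K T
proof (rule moduleI)
  show "abelian_group T"
  proof (rule abelian_groupI, goal_cases)
    case (6 x)
    then obtain r where "r \<in> carrier F" "x = q r" by (auto simp: T_carrier)
    then show ?case
      by (intro bexI[of _ "q (\<ominus>\<^bsub>F\<^esub> r)"]) (auto simp: T_carrier T_add T_zero F.M.l_neg)
  qed (auto simp: T_carrier T_add T_zero F.M.a_ac)
next
  fix a x assume "a \<in> carrier K" "x \<in> carrier T"
  then show "a \<odot>\<^bsub>T\<^esub> x \<in> carrier T" by (auto simp: T_carrier T_smult)
next
  fix a b x assume "a \<in> carrier K" "b \<in> carrier K" "x \<in> carrier T"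
  then show "(a \<oplus>\<^bsub>K\<^esub> b) \<odot>\<^bsub>T\<^esub> x = a \<odot>\<^bsub>T\<^esub> x \<oplus>\<^bsub>T\<^esub> b \<odot>\<^bsub>T\<^esub> x"
    by (clarsimp simp: T_carrier T_smult T_add) (simp only: F.smult_l_distr)
next
  fix a x y assume "a \<in> carrier K" "x \<in> carrier T" "y \<in> carrier T"
  then show "a \<odot>\<^bsub>T\<^esub> (x \<oplus>\<^bsub>T\<^esub> y) = a \<odot>\<^bsub>T\<^esub> x \<oplus>\<^bsub>T\<^esub> a \<odot>\<^bsub>T\<^esub> y"
    by (clarsimp simp: T_carrier T_smult T_add) (simp only: F.smult_r_distr)
next
  fix a b x assume "a \<in> carrier K" "b \<in> carrier K" "x \<in> carrier T"
  then show "(a \<otimes>\<^bsub>K\<^esub> b) \<odot>\<^bsub>T\<^esub> x = a \<odot>\<^bsub>T\<^esub> (b \<odot>\<^bsub>T\<^esub> x)"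
    by (clarsimp simp: T_carrier T_smult) (simp only: F.smult_assoc1)
next
  fix x assume "x \<in> carrier T"
  then show "\<one>\<^bsub>K\<^esub> \<odot>\<^bsub>T\<^esub> x = x" by (clarsimp simp: T_carrier T_smult)
qed (rule A.is_cring)

lemma q_linear: "lin K F T q"
  by (rule linI) (auto simp: T_carrier T_add T_smult)

lemma tens_q: "tens K A B a b = q (free_basis K (a, b))"
  by (simp add: tens_def coset_map_def)

lemma relations:
  "a \<in> carrier A \<Longrightarrow> a' \<in> carrier A \<Longrightarrow> b \<in> carrier B \<Longrightarrow>
    free_basis K (a \<oplus>\<^bsub>A\<^esub> a', b) \<ominus>\<^bsub>F\<^esub> (free_basis K (a, b) \<oplus>\<^bsub>F\<^esub> free_basis K (a', b)) \<in> N"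
  "a \<in> carrier A \<Longrightarrow> b \<in> carrier B \<Longrightarrow> b' \<in> carrier B \<Longrightarrow>
    free_basis K (a, b \<oplus>\<^bsub>B\<^esub> b') \<ominus>\<^bsub>F\<^esub> (free_basis K (a, b) \<oplus>\<^bsub>F\<^esub> free_basis K (a, b')) \<in> N"
  "c \<in> carrier K \<Longrightarrow> a \<in> carrier A \<Longrightarrow> b \<in> carrier B \<Longrightarrow>
    free_basis K (c \<odot>\<^bsub>A\<^esub> a, b) \<ominus>\<^bsub>F\<^esub> c \<odot>\<^bsub>F\<^esub> free_basis K (a, b) \<in> N"
  "c \<in> carrier K \<Longrightarrow> a \<in> carrier A \<Longrightarrow> b \<in> carrier B \<Longrightarrow>
    free_basis K (a, c \<odot>\<^bsub>B\<^esub> b) \<ominus>\<^bsub>F\<^esub> c \<odot>\<^bsub>F\<^esub> free_basis K (a, b) \<in> N"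
  subgoal by (rule relation_in_N, unfold bilinear_relations_def Let_def,
        rule UnI1, rule UnI1, rule UnI1, rule CollectI, intro exI conjI, rule refl)
  subgoal by (rule relation_in_N, unfold bilinear_relations_def Let_def,
        rule UnI1, rule UnI1, rule UnI2, rule CollectI, intro exI conjI, rule refl)
  subgoal by (rule relation_in_N, unfold bilinear_relations_def Let_def,
        rule UnI1, rule UnI2, rule CollectI, intro exI conjI, rule refl)
  subgoal by (rule relation_in_N, unfold bilinear_relations_def Let_def,
        rule UnI2, rule CollectI, intro exI conjI, rule refl)
  done

lemma tens_bilinear: "bilinear K A B T (tens K A B)"
proof -
  note e = basis_closed
  have "q (free_basis K (a \<oplus>\<^bsub>A\<^esub> a', b)) = q (free_basis K (a, b) \<oplus>\<^bsub>F\<^esub> free_basis K (a', b))"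
    if "a \<in> carrier A" "a' \<in> carrier A" "b \<in> carrier B" for a a' b
    using that by (subst q_eq_iff) (simp_all add: relations e)
  moreover have "q (free_basis K (a, b \<oplus>\<^bsub>B\<^esub> b')) = q (free_basis K (a, b) \<oplus>\<^bsub>F\<^esub> free_basis K (a, b'))"
    if "a \<in> carrier A" "b \<in> carrier B" "b' \<in> carrier B" for a b b'
    using that by (subst q_eq_iff) (simp_all add: relations e)
  moreover have "q (free_basis K (c \<odot>\<^bsub>A\<^esub> a, b)) = q (c \<odot>\<^bsub>F\<^esub> free_basis K (a, b))"
    if "c \<in> carrier K" "a \<in> carrier A" "b \<in> carrier B" for c a b
    using that by (subst q_eq_iff) (simp_all add: relations e)
  moreover have "q (free_basis K (a, c \<odot>\<^bsub>B\<^esub> b)) = q (c \<odot>\<^bsub>F\<^esub> free_basis K (a, b))"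
    if "c \<in> carrier K" "a \<in> carrier A" "b \<in> carrier B" for c a b
    using that by (subst q_eq_iff) (simp_all add: relations e)
  ultimately show ?thesis
    unfolding tens_q
    by (intro bilinearI linI) (simp_all add: T_carrier T_add T_smult e)
qed

context
  fixes P :: "('k, 'p, 'q) module_scheme" and f
  assumes P: "module K P" and f: "bilinear K A B P f"
begin

interpretation P: module K P by (rule P)

text \<open>The relations lie in the kernel of the induced linear map because \<open>f\<close> is bilinear; the kernel is
  a submodule and therefore contains their span.\<close>

lemma free_lift_kills_relations:
  assumes "r \<in> N"
  shows "free_lift K P (\<lambda>i. f (fst i) (snd i)) r = \<zero>\<^bsub>P\<^esub>"
proof -
  let ?g = "free_lift K P (\<lambda>i. f (fst i) (snd i))"
  have cl: "f a b \<in> carrier P" if "a \<in> carrier A" "b \<in> carrier B" for a b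
    using that bilinear_closed[OF f] by blast
  have lin: "lin K F P ?g"
    by (rule free_lift_linear[OF P]) (auto simp: cl)
  have g: "?g (free_basis K (a, b)) = f a b" if "a \<in> carrier A" "b \<in> carrier B" for a b
    by (subst free_lift_basis[OF P]) (auto simp: cl that)
  interpret g: mod_hom K F P ?g
    by (intro mod_hom.intro mod_hom_axioms.intro F.module_axioms P lin)
  have "bilinear_relations K A B \<subseteq> g.ker"
    unfolding bilinear_relations_def Let_def g.ker_def
    by (auto intro!: F.M.minus_closed F.M.a_closed F.smult_closed basis_closed
        simp: g basis_closed cl P.M.r_neg a_minus_def[of P]
          lin_add[OF bilinear_left[OF f]] lin_add[OF bilinear_right[OF f]]
          lin_smult[OF bilinear_left[OF f]] lin_smult[OF bilinear_right[OF f]])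
  then have "N \<subseteq> g.ker"
    unfolding relation_module_def
    by (intro span_subset F.module_axioms relations_closed g.ker_is_submodule)
  then show ?thesis using assms by (auto simp: g.ker_def)
qed

lemma tensor_lift_q:
  assumes "r \<in> carrier F"
  shows "tensor_lift K A B P f (q r) = free_lift K P (\<lambda>i. f (fst i) (snd i)) r"
proof -
  let ?g = "free_lift K P (\<lambda>i. f (fst i) (snd i))"
  define s where "s = (SOME s. s \<in> q r)"
  have "s \<in> q r" unfolding s_def by (rule someI[of _ r]) (rule mem_q[OF assms])
  then have "s \<in> carrier F" "q s = q r"
    using q_mem_eq[OF _ assms] by auto
  then have s: "s \<in> carrier F" "s \<ominus>\<^bsub>F\<^esub> r \<in> N"
    using q_eq_iff[OF _ assms] by simp_all
  have lin: "lin K F P ?g"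
    by (rule free_lift_linear[OF P]) (auto intro: bilinear_closed[OF f])
  have "s = (s \<ominus>\<^bsub>F\<^esub> r) \<oplus>\<^bsub>F\<^esub> r"
    using s(1) assms by (simp add: a_minus_def F.M.a_assoc F.M.l_neg)
  then have "?g s = ?g (s \<ominus>\<^bsub>F\<^esub> r) \<oplus>\<^bsub>P\<^esub> ?g r"
    using lin_add[OF lin, of "s \<ominus>\<^bsub>F\<^esub> r" r] s assms by simp
  then have "?g s = ?g r"
    using free_lift_kills_relations[OF s(2)] lin_closed[OF lin assms] by simp
  moreover have "tensor_lift K A B P f (q r) = ?g s"
    by (simp add: tensor_lift_def free_lift_def s_def Let_def)
  ultimately show ?thesis by simp
qed

lemma tensor_lift_linear: "lin K T P (tensor_lift K A B P f)"
proof -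
  have lin: "lin K F P (free_lift K P (\<lambda>i. f (fst i) (snd i)))"
    by (rule free_lift_linear[OF P]) (auto intro: bilinear_closed[OF f])
  show ?thesis
    by (rule linI) (auto simp: T_carrier T_add T_smult tensor_lift_q lin_closed[OF lin] lin_add[OF lin]
        lin_smult[OF lin])
qed

lemma tensor_lift_tens:
  assumes "a \<in> carrier A" "b \<in> carrier B"
  shows "tensor_lift K A B P f (tens K A B a b) = f a b"
  using assms bilinear_closed[OF f]
  by (simp add: tens_q tensor_lift_q basis_closed free_lift_basis[OF P])

end

lemma tensor_ext:
  assumes P: "module K P" and g: "lin K T P g" and h: "lin K T P h"
    and eq: "\<And>a b. a \<in> carrier A \<Longrightarrow> b \<in> carrier B \<Longrightarrow> g (tens K A B a b) = h (tens K A B a b)"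
    and t: "t \<in> carrier T"
  shows "g t = h t"
proof -
  interpret P: module K P by (rule P)
  obtain r where r: "r \<in> carrier F" "t = q r" using t by (auto simp: T_carrier)
  have lins: "lin K F P (\<lambda>r. g (q r))" "lin K F P (\<lambda>r. h (q r))"
    using lin_compose[OF g q_linear] lin_compose[OF h q_linear] by auto
  have supp: "{i. r i \<noteq> \<zero>\<^bsub>K\<^esub>} \<subseteq> carrier A \<times> carrier B" "\<And>i. r i \<in> carrier K"
    using r(1) by (auto simp: free_module_simps)
  have "g (q r) = free_lift K P (\<lambda>i. g (q (free_basis K i))) r"
    by (rule free_lift_unique[OF P lins(1) r(1)])
  also have "\<dots> = free_lift K P (\<lambda>i. h (q (free_basis K i))) r"
    unfolding free_lift_def
  proof (intro P.finsum_cong')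
    show "(\<lambda>i. r i \<odot>\<^bsub>P\<^esub> h (q (free_basis K i))) \<in> {i. r i \<noteq> \<zero>\<^bsub>K\<^esub>} \<rightarrow> carrier P"
      using supp by (auto intro!: P.smult_closed lin_closed[OF lins(2)] basis_closed)
    show "r i \<odot>\<^bsub>P\<^esub> g (q (free_basis K i)) = r i \<odot>\<^bsub>P\<^esub> h (q (free_basis K i))"
      if "i \<in> {i. r i \<noteq> \<zero>\<^bsub>K\<^esub>}" for i
      using that supp(1) eq[of "fst i" "snd i"] by (auto simp: tens_q)
  qed simp
  also have "\<dots> = h (q r)"
    by (rule free_lift_unique[OF P lins(2) r(1), symmetric])
  finally show ?thesis by (simp add: r)
qed

end

section \<open>Calculating with tensors\<close>

text \<open>Every step with Sweedler sums carries the obligation that its terms are multilinear.  The rules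
  collected here reduce such an obligation to the outermost operation of the term.\<close>

named_theorems lin_intros

lemma tensor_module [lin_intros]:
  assumes "module K A" "module K B"
  shows "module K (tensor_space K A B)"
proof -
  interpret module_pair K A B using assms by (rule module_pair.intro)
  show ?thesis by (rule T.module_axioms)
qed

lemma tens_bilinear:
  assumes "module K A" "module K B"
  shows "bilinear K A B (tensor_space K A B) (tens K A B)"
  using assms by (intro module_pair.tens_bilinear module_pair.intro)

lemma tens_closed [lin_intros]:
  assumes "module K A" "module K B" "a \<in> carrier A" "b \<in> carrier B"
  shows "tens K A B a b \<in> carrier (tensor_space K A B)"
  using assms by (intro bilinear_closed[OF tens_bilinear])

lemma lift_linear:
  assumes "module K A" "module K B" "module K P" "bilinear K A B P f"
  shows "lin K (tensor_space K A B) P (tensor_lift K A B P f)"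
  using assms by (intro module_pair.tensor_lift_linear module_pair.intro)

lemma lift_tens:
  assumes "module K A" "module K B" "module K P" "bilinear K A B P f" "a \<in> carrier A" "b \<in> carrier B"
  shows "tensor_lift K A B P f (tens K A B a b) = f a b"
  using assms by (intro module_pair.tensor_lift_tens module_pair.intro)

lemma tensor_ext:
  assumes "module K A" "module K B" "module K P"
    and "lin K (tensor_space K A B) P g" "lin K (tensor_space K A B) P h"
    and "\<And>a b. a \<in> carrier A \<Longrightarrow> b \<in> carrier B \<Longrightarrow> g (tens K A B a b) = h (tens K A B a b)"
    and "t \<in> carrier (tensor_space K A B)"
  shows "g t = h t"
  using module_pair.tensor_ext[OF module_pair.intro[OF assms(1,2)] assms(3-7)] .

lemma lift_closed [lin_intros]:
  assumes "module K A" "module K B" "module K P" "bilinear K A B P f"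
    "t \<in> carrier (tensor_space K A B)"
  shows "tensor_lift K A B P f t \<in> carrier P"
  using lin_closed[OF lift_linear] assms by blast

lemma bilinear_cong:
  assumes "\<And>a b. a \<in> carrier A \<Longrightarrow> b \<in> carrier B \<Longrightarrow> f a b = g a b" "module K A" "module K B"
  shows "bilinear K A B P f \<longleftrightarrow> bilinear K A B P g"
  unfolding bilinear_def using assms by (auto cong: lin_cong)

lemma lift_cong:
  assumes "module K A" "module K B" "module K P" "bilinear K A B P g"
    "t \<in> carrier (tensor_space K A B)"
    and eq: "\<And>a b. a \<in> carrier A \<Longrightarrow> b \<in> carrier B \<Longrightarrow> f a b = g a b"
  shows "tensor_lift K A B P f t = tensor_lift K A B P g t"
proof -
  have f: "bilinear K A B P f" using assms by (subst bilinear_cong) auto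
  show ?thesis
    by (rule tensor_ext[OF assms(1-3) lift_linear[OF assms(1-3) f] lift_linear[OF assms(1-4)] _ assms(5)])
      (simp add: lift_tens assms f)
qed

lemma lin_lift_comp:
  assumes "module K A" "module K B" "module K P" "module K Q" "bilinear K A B P f" "lin K P Q g"
    "t \<in> carrier (tensor_space K A B)"
  shows "g (tensor_lift K A B P f t) = tensor_lift K A B Q (\<lambda>a b. g (f a b)) t"
proof -
  have b: "bilinear K A B Q (\<lambda>a b. g (f a b))"
    by (intro bilinearI lin_compose[OF assms(6)] bilinear_left[OF assms(5)] bilinear_right[OF assms(5)])
  show ?thesis
    by (rule tensor_ext[OF assms(1,2,4) lin_compose[OF assms(6)] _ _ assms(7)])
      (simp_all add: lift_linear lift_tens assms b)
qed

lemma lin_smult_const [lin_intros]: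
  assumes "module K P" "c \<in> carrier K" "lin K X P f"
  shows "lin K X P (\<lambda>x. c \<odot>\<^bsub>P\<^esub> f x)"
proof -
  interpret P: module K P by fact
  show ?thesis
    using assms(2) by (intro linI)
      (auto simp: lin_closed[OF assms(3)] lin_add[OF assms(3)] lin_smult[OF assms(3)] P.smult_r_distr
        P.smult_assoc1[symmetric] P.m_comm)
qed

lemma lin_zero_map:
  assumes "module K P"
  shows "lin K X P (\<lambda>x. \<zero>\<^bsub>P\<^esub>)"
proof -
  interpret P: module K P by fact
  show ?thesis by (intro linI) auto
qed

lemma lin_add_fun:
  assumes "module K X" "module K P" "lin K X P f" "lin K X P g"
  shows "lin K X P (\<lambda>x. f x \<oplus>\<^bsub>P\<^esub> g x)"
proof -
  interpret X: module K X by fact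
  interpret P: module K P by fact
  show ?thesis
    by (intro linI) (auto simp: lin_closed[OF assms(3)] lin_closed[OF assms(4)]
       lin_add[OF assms(3)] lin_smult[OF assms(3)] lin_add[OF assms(4)] lin_smult[OF assms(4)]
       P.smult_r_distr P.M.a_ac)
qed

lemma lin_tens_left [lin_intros]:
  assumes "module K A" "module K B" "b \<in> carrier B" "lin K X A f"
  shows "lin K X (tensor_space K A B) (\<lambda>x. tens K A B (f x) b)"
  using lin_compose[OF bilinear_left[OF tens_bilinear[OF assms(1,2)] assms(3)] assms(4)] .

lemma lin_tens_right [lin_intros]:
  assumes "module K A" "module K B" "a \<in> carrier A" "lin K X B f"
  shows "lin K X (tensor_space K A B) (\<lambda>x. tens K A B a (f x))"
  using lin_compose[OF bilinear_right[OF tens_bilinear[OF assms(1,2)] assms(3)] assms(4)] .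

lemma lin_lift_arg [lin_intros]:
  assumes "module K A" "module K B" "module K P" "bilinear K A B P F" "lin K X (tensor_space K A B) t"
  shows "lin K X P (\<lambda>x. tensor_lift K A B P F (t x))"
  using lin_compose[OF lift_linear[OF assms(1-4)] assms(5)] .

text \<open>A Sweedler sum depends linearly on a parameter of its summands; additivity and homogeneity are
  identities of linear maps in the tensor, hence can be checked on pure tensors.\<close>

lemma lin_lift_fun [lin_intros]:
  assumes "module K X" "module K A" "module K B" "module K P" and t: "t \<in> carrier (tensor_space K A B)"
    and lin: "\<And>a b. a \<in> carrier A \<Longrightarrow> b \<in> carrier B \<Longrightarrow> lin K X P (\<lambda>x. F x a b)"
    and bil: "\<And>x. x \<in> carrier X \<Longrightarrow> bilinear K A B P (\<lambda>a b. F x a b)"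
  shows "lin K X P (\<lambda>x. tensor_lift K A B P (\<lambda>a b. F x a b) t)"
proof -
  interpret X: module K X by fact
  interpret P: module K P by fact
  note L = lift_linear[OF assms(2-4)]
  note m = assms(2-4)
  interpret T: module K "tensor_space K A B" by (rule tensor_module[OF m(1,2)])
  show ?thesis
  proof (rule linI)
    fix x y assume xy: "x \<in> carrier X" "y \<in> carrier X"
    have b: "bilinear K A B P (\<lambda>a b. F (x \<oplus>\<^bsub>X\<^esub> y) a b)" using xy by (intro bil) auto
    show "tensor_lift K A B P (\<lambda>a b. F (x \<oplus>\<^bsub>X\<^esub> y) a b) t =
      tensor_lift K A B P (\<lambda>a b. F x a b) t \<oplus>\<^bsub>P\<^esub> tensor_lift K A B P (\<lambda>a b. F y a b) t"
      by (rule tensor_ext[OF m L[OF b] lin_add_fun[OF T.module_axioms m(3) L L] _ t])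
        (simp_all add: bil xy lift_tens m b lin_add[OF lin])
  next
    fix c x assume c: "c \<in> carrier K" "x \<in> carrier X"
    have b: "bilinear K A B P (\<lambda>a b. F (c \<odot>\<^bsub>X\<^esub> x) a b)" using c by (intro bil) auto
    show "tensor_lift K A B P (\<lambda>a b. F (c \<odot>\<^bsub>X\<^esub> x) a b) t =
      c \<odot>\<^bsub>P\<^esub> tensor_lift K A B P (\<lambda>a b. F x a b) t"
      by (rule tensor_ext[OF m L[OF b] lin_smult_const[OF m(3) c(1) L] _ t])
        (simp_all add: bil c lift_tens m b lin_smult[OF lin])
  qed (intro lift_closed m bil t)
qed

declare lin_id [lin_intros] bilinearI [lin_intros]

text \<open>Fubini's theorem for Sweedler sums: both sides are linear in \<open>t\<close> and agree on pure tensors.\<close>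

lemma lift_swap:
  assumes "module K A" "module K B" "module K C" "module K D" "module K P"
    and s: "s \<in> carrier (tensor_space K A B)" and t: "t \<in> carrier (tensor_space K C D)"
    and b1: "\<And>a b. a \<in> carrier A \<Longrightarrow> b \<in> carrier B \<Longrightarrow> bilinear K C D P (F a b)"
    and b2: "\<And>c d. c \<in> carrier C \<Longrightarrow> d \<in> carrier D \<Longrightarrow> bilinear K A B P (\<lambda>a b. F a b c d)"
  shows "tensor_lift K A B P (\<lambda>a b. tensor_lift K C D P (F a b) t) s =
    tensor_lift K C D P (\<lambda>c d. tensor_lift K A B P (\<lambda>a b. F a b c d) s) t"
proof -
  note m = assms(1-5)
  have b: "bilinear K A B P (\<lambda>a b. tensor_lift K C D P (F a b) t)" if "t \<in> carrier (tensor_space K C D)" for t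
    by (intro bilinearI lin_lift_fun m that b1 bilinear_left[OF b2] bilinear_right[OF b2])
  have b': "bilinear K C D P (\<lambda>c d. tensor_lift K A B P (\<lambda>a b. F a b c d) s)"
    by (intro bilinearI lin_lift_fun m s b2 bilinear_left[OF b1] bilinear_right[OF b1])
  have l1: "lin K (tensor_space K C D) P (\<lambda>t. tensor_lift K A B P (\<lambda>a b. tensor_lift K C D P (F a b) t) s)"
    by (intro lin_lift_fun tensor_module m s lift_linear b1 b)
  show ?thesis
  proof (rule tensor_ext[OF m(3-5) l1 lift_linear[OF m(3-5) b'] _ t])
    fix c d assume cd: "c \<in> carrier C" "d \<in> carrier D"
    have "tensor_lift K A B P (\<lambda>a b. tensor_lift K C D P (F a b) (tens K C D c d)) s =
      tensor_lift K A B P (\<lambda>a b. F a b c d) s"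
      by (rule lift_cong) (auto intro: m b2 s cd simp: lift_tens m b1 cd)
    then show "tensor_lift K A B P (\<lambda>a b. tensor_lift K C D P (F a b) (tens K C D c d)) s =
      tensor_lift K C D P (\<lambda>c d. tensor_lift K A B P (\<lambda>a b. F a b c d) s) (tens K C D c d)"
      by (simp add: lift_tens m b' cd)
  qed
qed

definition trilinear ::
  "'k ring \<Rightarrow> ('k, 'a, 'm) module_scheme \<Rightarrow> ('k, 'b, 'n) module_scheme \<Rightarrow> ('k, 'c, 'o) module_scheme
    \<Rightarrow> ('k, 'p, 'q) module_scheme \<Rightarrow> ('a \<Rightarrow> 'b \<Rightarrow> 'c \<Rightarrow> 'p) \<Rightarrow> bool" where
  "trilinear K A B C P F \<longleftrightarrow>
    (\<forall>a\<in>carrier A. bilinear K B C P (F a)) \<and>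
    (\<forall>b\<in>carrier B. \<forall>c\<in>carrier C. lin K A P (\<lambda>a. F a b c))"

lemma trilinearI [lin_intros]:
  assumes "\<And>a. a \<in> carrier A \<Longrightarrow> bilinear K B C P (\<lambda>b c. F a b c)"
    and "\<And>b c. b \<in> carrier B \<Longrightarrow> c \<in> carrier C \<Longrightarrow> lin K A P (\<lambda>a. F a b c)"
  shows "trilinear K A B C P (\<lambda>a b c. F a b c)"
  using assms by (simp add: trilinear_def)

lemma trilinearD:
  assumes "trilinear K A B C P F"
  shows "a \<in> carrier A \<Longrightarrow> bilinear K B C P (F a)"
    and "b \<in> carrier B \<Longrightarrow> c \<in> carrier C \<Longrightarrow> lin K A P (\<lambda>a. F a b c)"
    and "a \<in> carrier A \<Longrightarrow> c \<in> carrier C \<Longrightarrow> lin K B P (\<lambda>b. F a b c)"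
    and "a \<in> carrier A \<Longrightarrow> b \<in> carrier B \<Longrightarrow> lin K C P (\<lambda>c. F a b c)"
    and "c \<in> carrier C \<Longrightarrow> bilinear K A B P (\<lambda>a b. F a b c)"
  using assms by (auto simp: trilinear_def bilinear_def)

lemma lift_tensor_map:
  assumes m: "module K A" "module K B" "module K C" "module K D" "module K P"
    and f: "lin K A C f" and g: "lin K B D g" and F: "bilinear K C D P F"
    and t: "t \<in> carrier (tensor_space K A B)"
  shows "tensor_lift K C D P F (tensor_map K A B C D f g t) =
    tensor_lift K A B P (\<lambda>a b. F (f a) (g b)) t"
proof -
  have "tensor_lift K C D P F (tensor_map K A B C D f g t) =
    tensor_lift K A B P (\<lambda>a b. tensor_lift K C D P F (tens K C D (f a) (g b))) t"
    unfolding tensor_map_def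
    by (intro lin_lift_comp[OF m(1,2) _ m(5)] lin_intros m f g F t lift_linear lin_closed[OF f] lin_closed[OF g])
  also have "\<dots> = tensor_lift K A B P (\<lambda>a b. F (f a) (g b)) t"
    by (rule lift_cong) (auto intro: m t simp: lift_tens m F lin_closed[OF f] lin_closed[OF g]
        intro!: bilinearI lin_compose[OF bilinear_left[OF F] f] lin_compose[OF bilinear_right[OF F] g]
          lin_closed[OF f] lin_closed[OF g])
  finally show ?thesis .
qed

text \<open>The two sides of coassociativity live in a nested quotient on which the associator cannot be
  computed directly.  Evaluating a trilinear map on both sides eliminates the associator.\<close>

lemma assoc_tensor_map:
  assumes m: "module K A'" "module K A" "module K B" "module K C"
    and d: "lin K A' (tensor_space K A B) d" and t: "t \<in> carrier (tensor_space K A' C)"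
  shows "tensor_assoc K A B C (tensor_map K A' C (tensor_space K A B) C d id t) =
    tensor_lift K A' C (tensor_space K A (tensor_space K B C))
      (\<lambda>a c. tensor_lift K A B (tensor_space K A (tensor_space K B C))
        (\<lambda>x y. tens K A (tensor_space K B C) x (tens K B C y c)) (d a)) t"
  unfolding tensor_assoc_def Let_def
  by (subst lift_tensor_map) (auto intro!: lin_intros m d t simp: id_def)

lemma coassoc_left:
  assumes m: "module K A'" "module K A" "module K B" "module K C" "module K P"
    and d: "lin K A' (tensor_space K A B) d" and t: "t \<in> carrier (tensor_space K A' C)"
    and F: "trilinear K A B C P F"
  shows "tensor_lift K A (tensor_space K B C) P (\<lambda>x s. tensor_lift K B C P (F x) s)
      (tensor_assoc K A B C (tensor_map K A' C (tensor_space K A B) C d id t)) =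
    tensor_lift K A' C P (\<lambda>a c. tensor_lift K A B P (\<lambda>x y. F x y c) (d a)) t"
proof -
  let ?T = "tensor_space K A (tensor_space K B C)"
  note F' = trilinearD[OF F]
  note dc = lin_closed[OF d]
  have mT: "module K ?T" by (intro lin_intros m)
  have bF: "bilinear K A (tensor_space K B C) P (\<lambda>x s. tensor_lift K B C P (F x) s)"
    by (intro lin_intros m F')
  have L: "lin K ?T P (tensor_lift K A (tensor_space K B C) P (\<lambda>x s. tensor_lift K B C P (F x) s))"
    by (intro lift_linear lin_intros m bF)
  have "tensor_lift K A (tensor_space K B C) P (\<lambda>x s. tensor_lift K B C P (F x) s)
      (tensor_assoc K A B C (tensor_map K A' C (tensor_space K A B) C d id t)) =
    tensor_lift K A' C P (\<lambda>a c. tensor_lift K A B P (\<lambda>x y.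
      tensor_lift K A (tensor_space K B C) P (\<lambda>x s. tensor_lift K B C P (F x) s)
        (tens K A (tensor_space K B C) x (tens K B C y c))) (d a)) t"
    by (simp add: assoc_tensor_map[OF m(1-4) d t])
     (subst lin_lift_comp[OF m(1,4) mT m(5) _ L t],
       (intro lin_intros m d dc; assumption)+,
       rule lift_cong[OF m(1,4,5) _ t], 
       (intro lin_intros m d dc bF; assumption)+,
       subst lin_lift_comp[OF m(2,3) mT m(5) _ L], (intro lin_intros m d dc; assumption)+, rule refl)
  also have "\<dots> = tensor_lift K A' C P (\<lambda>a c. tensor_lift K A B P (\<lambda>x y. F x y c) (d a)) t"
    by (intro lift_cong m t dc lin_intros d F')
      (simp_all add: lift_tens m bF F' tens_closed tensor_module)
  finally show ?thesis .
qed

lemma coassoc_right: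
  assumes m: "module K A" "module K B'" "module K B" "module K C" "module K P"
    and d: "lin K B' (tensor_space K B C) d" and t: "t \<in> carrier (tensor_space K A B')"
    and F: "trilinear K A B C P F"
  shows "tensor_lift K A (tensor_space K B C) P (\<lambda>x s. tensor_lift K B C P (F x) s)
      (tensor_map K A B' A (tensor_space K B C) id d t) =
    tensor_lift K A B' P (\<lambda>a b. tensor_lift K B C P (F a) (d b)) t"
  using lift_tensor_map[of K A B' A "tensor_space K B C" P id d _ t]
  by (simp add: m t d lin_id[folded id_def] tensor_module)
    (subst lift_tensor_map[of K A B' A "tensor_space K B C" P id d _ t],
     (intro lin_intros m t d trilinearD[OF F] lin_id[folded id_def]; assumption)+, simp)

text \<open>Coassociativity in the form in which Sweedler notation uses it: the indices of a threefold
  coproduct may be read from either iteration.\<close>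

lemma coassoc_trilinear:
  assumes m: "module K A" "module K B" "module K C" "module K D" "module K E" "module K P"
    and d: "lin K D (tensor_space K A B) d" and t: "t \<in> carrier (tensor_space K D C)"
    and d': "lin K E (tensor_space K B C) d'" and t': "t' \<in> carrier (tensor_space K A E)"
    and eq: "tensor_assoc K A B C (tensor_map K D C (tensor_space K A B) C d id t) =
      tensor_map K A E A (tensor_space K B C) id d' t'"
    and F: "trilinear K A B C P F"
  shows "tensor_lift K D C P (\<lambda>a c. tensor_lift K A B P (\<lambda>x y. F x y c) (d a)) t =
    tensor_lift K A E P (\<lambda>a b. tensor_lift K B C P (F a) (d' b)) t'"
  using coassoc_left[OF m(4,1,2,3,6) d t F] coassoc_right[OF m(1,5,2,3,6) d' t' F] eq by simp

lemma lift_tens_id: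
  assumes m: "module K A" "module K B" and t: "t \<in> carrier (tensor_space K A B)"
  shows "tensor_lift K A B (tensor_space K A B) (tens K A B) t = t"
  by (rule tensor_ext[OF m tensor_module[OF m] lift_linear lin_id _ t])
    (simp_all add: m tensor_module tens_bilinear lift_tens)

text \<open>Conversely, the canonical trilinear map into the threefold tensor product detects equality.\<close>

lemma coassocI:
  assumes m: "module K A" "module K B" "module K C" "module K D" "module K E"
    and d: "lin K D (tensor_space K A B) d" and t: "t \<in> carrier (tensor_space K D C)"
    and d': "lin K E (tensor_space K B C) d'" and t': "t' \<in> carrier (tensor_space K A E)"
    and eq: "tensor_lift K D C (tensor_space K A (tensor_space K B C))
        (\<lambda>a c. tensor_lift K A B (tensor_space K A (tensor_space K B C))
          (\<lambda>x y. tens K A (tensor_space K B C) x (tens K B C y c)) (d a)) t =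
      tensor_lift K A E (tensor_space K A (tensor_space K B C))
        (\<lambda>a b. tensor_lift K B C (tensor_space K A (tensor_space K B C))
          (\<lambda>x y. tens K A (tensor_space K B C) a (tens K B C x y)) (d' b)) t'"
  shows "tensor_assoc K A B C (tensor_map K D C (tensor_space K A B) C d id t) =
      tensor_map K A E A (tensor_space K B C) id d' t'"
proof -
  have "tensor_map K A E A (tensor_space K B C) id d' t' = tensor_lift K A E (tensor_space K A (tensor_space K B C))
        (\<lambda>a b. tensor_lift K B C (tensor_space K A (tensor_space K B C))
          (\<lambda>x y. tens K A (tensor_space K B C) a (tens K B C x y)) (d' b)) t'"
    unfolding tensor_map_def id_def
  proof (rule lift_cong[OF m(1,5) _ _ t'])
    fix a e assume a: "a \<in> carrier A" "e \<in> carrier E"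
    note l = lin_lift_comp[OF m(2,3) tensor_module[OF m(2,3)] tensor_module[OF m(1) tensor_module[OF m(2,3)]]
        tens_bilinear[OF m(2,3)] bilinear_right[OF tens_bilinear[OF m(1) tensor_module[OF m(2,3)]] a(1)]
        lin_closed[OF d' a(2)]]
    show "tens K A (tensor_space K B C) a (d' e) = tensor_lift K B C (tensor_space K A (tensor_space K B C))
          (\<lambda>x y. tens K A (tensor_space K B C) a (tens K B C x y)) (d' e)"
      using l by (simp add: lift_tens_id[OF m(2,3) lin_closed[OF d' a(2)]])
  qed (intro lin_intros m d' lin_closed[OF d']; assumption)+
  then show ?thesis
    using assoc_tensor_map[OF m(4,1,2,3) d t] eq by simp
qed

section \<open>Modules that share their linear structure\<close>

text \<open>Passing to the opposite algebra, or to a tensor product algebra, changes the product and the unit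
  only.  All linear constructions are then literally equal, whatever the multiplicative fields are.\<close>

definition same_module ::
  "('k, 'a, 'm) module_scheme \<Rightarrow> ('k, 'a, 'n) module_scheme \<Rightarrow> bool" where
  "same_module M N \<longleftrightarrow> carrier M = carrier N \<and> (\<oplus>\<^bsub>M\<^esub>) = (\<oplus>\<^bsub>N\<^esub>) \<and> \<zero>\<^bsub>M\<^esub> = \<zero>\<^bsub>N\<^esub> \<and>
    (\<odot>\<^bsub>M\<^esub>) = (\<odot>\<^bsub>N\<^esub>)"

lemma same_module_refl: "same_module M M"
  by (simp add: same_module_def)

lemma same_module_sym: "same_module M N \<Longrightarrow> same_module N M"
  by (simp add: same_module_def)

lemma same_module_finsum:
  "same_module M N \<Longrightarrow> finsum M f A = finsum N f A"
  by (simp add: same_module_def finsum_def finprod_def)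

lemma same_module_module:
  assumes "same_module M N" "module K M"
  shows "module K N"
proof -
  interpret M: module K M by fact
  have eq: "carrier M = carrier N" "(\<oplus>\<^bsub>M\<^esub>) = (\<oplus>\<^bsub>N\<^esub>)" "\<zero>\<^bsub>M\<^esub> = \<zero>\<^bsub>N\<^esub>" "(\<odot>\<^bsub>M\<^esub>) = (\<odot>\<^bsub>N\<^esub>)"
    using assms(1) by (auto simp: same_module_def)
  show ?thesis
  proof (rule moduleI)
    show "abelian_group N"
    proof (rule abelian_groupI, unfold eq[symmetric], goal_cases)
      case (6 x)
      then show ?case by (intro bexI[of _ "\<ominus>\<^bsub>M\<^esub> x"]) (simp_all add: M.M.l_neg)
    qed (simp_all add: M.M.a_ac)
  qed (use M.is_cring M.smult_l_distr M.smult_r_distr M.smult_assoc1 M.smult_closed M.smult_one in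
      \<open>simp_all add: eq\<close>)
qed

lemma same_module_lin:
  assumes "same_module M M'" "same_module N N'"
  shows "lin K M N f = lin K M' N' f"
  using assms by (simp add: same_module_def module_hom_def)

lemma same_module_span:
  assumes "module K M" "same_module M N"
  shows "module.span K M S = module.span K N S"
  unfolding module.span_def[OF assms(1)] module.span_def[OF same_module_module[OF assms(2,1)]]
    module.lincomb_def[OF assms(1)] module.lincomb_def[OF same_module_module[OF assms(2,1)]]
  using assms(2) by (simp add: same_module_finsum[OF assms(2)]) (simp add: same_module_def)

lemma same_module_tensor_space:
  assumes "same_module A A'" "same_module B B'"
  shows "tensor_space K A B = tensor_space K A' B'"
    and "tens K A B = tens K A' B'"
  using assms
  by (simp_all add: tensor_space_def tens_def relation_module_def bilinear_relations_def same_module_def fun_eq_iff)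

lemma same_module_tensor_lift:
  assumes "same_module P P'"
  shows "tensor_lift K A B P f = tensor_lift K A' B' P' f"
  unfolding tensor_lift_def fun_eq_iff Let_def
  using assms by (simp add: same_module_finsum[OF assms]) (simp add: same_module_def)

lemma same_module_tensor_map:
  assumes "same_module A A'" "same_module B B'" "same_module C C'" "same_module D D'"
  shows "tensor_map K A B C D f g = tensor_map K A' B' C' D' f g"
  unfolding tensor_map_def same_module_tensor_space[OF assms(3,4)]
  by (rule same_module_tensor_lift[OF same_module_refl])

lemma same_module_tensor_assoc:
  assumes "same_module A A'" "same_module B B'" "same_module C C'"
  shows "tensor_assoc K A B C = tensor_assoc K A' B' C'"
proof -
  note sp = same_module_tensor_space[OF assms(2,3)] same_module_tensor_space[OF assms(1,2)]
    same_module_tensor_space[OF assms(1) same_module_refl[of "tensor_space K B' C'"]]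
  let ?T = "tensor_space K A' (tensor_space K B' C')"
  have "tensor_lift K A B ?T f = tensor_lift K A' B' ?T f" for f
    by (rule same_module_tensor_lift[OF same_module_refl])
  then have "tensor_assoc K A B C = tensor_lift K (tensor_space K A' B') C ?T
      (\<lambda>s c. tensor_lift K A' B' ?T (\<lambda>a b. tens K A' (tensor_space K B' C') a (tens K B' C' b c)) s)"
    by (simp add: tensor_assoc_def Let_def sp)
  also have "\<dots> = tensor_assoc K A' B' C'"
    unfolding tensor_assoc_def Let_def by (rule same_module_tensor_lift[OF same_module_refl])
  finally show ?thesis .
qed

section \<open>Algebras and their tensor products\<close>

lemma unital_algebra_module: "unital_algebra K A \<Longrightarrow> module K A"
  by (simp add: unital_algebra_def vectorspace_def)

lemma unital_algebra_ring: "unital_algebra K A \<Longrightarrow> ring A"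
  by (simp add: unital_algebra_def)

lemma mult_bilinear:
  assumes "unital_algebra K A"
  shows "bilinear K A A A (\<lambda>x y. x \<otimes>\<^bsub>A\<^esub> y)"
proof -
  interpret ring A using assms by (rule unital_algebra_ring)
  show ?thesis
    using assms by (intro bilinearI linI) (auto simp: unital_algebra_def l_distr r_distr)
qed

lemma lin_mult_left [lin_intros]:
  assumes "unital_algebra K A" "b \<in> carrier A" "lin K X A f"
  shows "lin K X A (\<lambda>x. f x \<otimes>\<^bsub>A\<^esub> b)"
  using lin_compose[OF bilinear_left[OF mult_bilinear[OF assms(1)] assms(2)] assms(3)] .

lemma lin_mult_right [lin_intros]:
  assumes "unital_algebra K A" "a \<in> carrier A" "lin K X A f"
  shows "lin K X A (\<lambda>x. a \<otimes>\<^bsub>A\<^esub> f x)"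
  using lin_compose[OF bilinear_right[OF mult_bilinear[OF assms(1)] assms(2)] assms(3)] .

lemma mult_closed [lin_intros]:
  assumes "ring A" "a \<in> carrier A" "b \<in> carrier A"
  shows "a \<otimes>\<^bsub>A\<^esub> b \<in> carrier A"
proof -
  interpret ring A by fact
  show ?thesis using assms by simp
qed

lemma tensor_algebra_same_module: "same_module (tensor_algebra K A B) (tensor_space K A B)"
  by (simp add: same_module_def tensor_algebra_def Let_def)

lemma tensor_algebra_simps [simp]:
  "carrier (tensor_algebra K A B) = carrier (tensor_space K A B)"
  "\<one>\<^bsub>tensor_algebra K A B\<^esub> = tens K A B \<one>\<^bsub>A\<^esub> \<one>\<^bsub>B\<^esub>"
  "s \<oplus>\<^bsub>tensor_algebra K A B\<^esub> t = s \<oplus>\<^bsub>tensor_space K A B\<^esub> t"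
  "c \<odot>\<^bsub>tensor_algebra K A B\<^esub> t = c \<odot>\<^bsub>tensor_space K A B\<^esub> t"
  "\<zero>\<^bsub>tensor_algebra K A B\<^esub> = \<zero>\<^bsub>tensor_space K A B\<^esub>"
  by (simp_all add: tensor_algebra_def Let_def)

lemma tensor_algebra_mult:
  "s \<otimes>\<^bsub>tensor_algebra K A B\<^esub> t = tensor_lift K A B (tensor_space K A B)
     (\<lambda>a b. tensor_lift K A B (tensor_space K A B)
        (\<lambda>a' b'. tens K A B (a \<otimes>\<^bsub>A\<^esub> a') (b \<otimes>\<^bsub>B\<^esub> b')) t) s"
  by (simp add: tensor_algebra_def Let_def)

context
  fixes K :: "'k ring" and A :: "('k, 'a, 'm) module_scheme" and B :: "('k, 'b, 'n) module_scheme"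
  assumes A: "unital_algebra K A" and B: "unital_algebra K B"
begin

interpretation A: ring A using A by (rule unital_algebra_ring)
interpretation B: ring B using B by (rule unital_algebra_ring)

private lemma m: "module K A" "module K B"
  using A B by (simp_all add: unital_algebra_module)

lemma tensor_mult_bilinear:
  "bilinear K (tensor_space K A B) (tensor_space K A B) (tensor_space K A B)
    (\<lambda>s t. s \<otimes>\<^bsub>tensor_algebra K A B\<^esub> t)"
  unfolding tensor_algebra_mult by (intro lin_intros m A B A.ring_axioms B.ring_axioms)

lemma tensor_mult_tens:
  assumes "a \<in> carrier A" "b \<in> carrier B" "a' \<in> carrier A" "b' \<in> carrier B"
  shows "tens K A B a b \<otimes>\<^bsub>tensor_algebra K A B\<^esub> tens K A B a' b' =
    tens K A B (a \<otimes>\<^bsub>A\<^esub> a') (b \<otimes>\<^bsub>B\<^esub> b')"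
proof -
  have 1: "bilinear K A B (tensor_space K A B) (\<lambda>a b. tensor_lift K A B (tensor_space K A B)
        (\<lambda>a' b'. tens K A B (a \<otimes>\<^bsub>A\<^esub> a') (b \<otimes>\<^bsub>B\<^esub> b')) t)"
    if "t \<in> carrier (tensor_space K A B)" for t
    by (intro lin_intros m A B that A.ring_axioms B.ring_axioms)
  have 2: "bilinear K A B (tensor_space K A B) (\<lambda>a' b'. tens K A B (a \<otimes>\<^bsub>A\<^esub> a') (b \<otimes>\<^bsub>B\<^esub> b'))"
    by (intro lin_intros m A B assms A.ring_axioms B.ring_axioms)
  show ?thesis
    unfolding tensor_algebra_mult
    by (simp add: lift_tens m tensor_module 1 2 assms tens_closed)
qed

text \<open>Both sides of each ring axiom are linear in every variable, so that pure tensors suffice.\<close>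

lemma tensor_algebra_unital: "unital_algebra K (tensor_algebra K A B)"
proof -
  let ?T = "tensor_space K A B" and ?A = "tensor_algebra K A B"
  have mT: "module K ?T" by (intro lin_intros m)
  interpret T: module K ?T by (rule mT)
  have mA: "module K ?A"
    by (rule same_module_module[OF same_module_sym[OF tensor_algebra_same_module] mT])
  interpret TA: module K ?A by (rule mA)
  note mult = tensor_mult_bilinear
  note L = bilinear_left[OF mult] and R = bilinear_right[OF mult]
  note cl = bilinear_closed[OF mult]
  have one: "\<one>\<^bsub>?A\<^esub> \<in> carrier ?T"
    by (simp add: tens_closed m)
  have assoc: "(s \<otimes>\<^bsub>?A\<^esub> t) \<otimes>\<^bsub>?A\<^esub> u = s \<otimes>\<^bsub>?A\<^esub> (t \<otimes>\<^bsub>?A\<^esub> u)"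
    if s: "s \<in> carrier ?T" and t: "t \<in> carrier ?T" and u: "u \<in> carrier ?T" for s t u
  proof (rule tensor_ext[OF m mT _ _ _ s])
    show "lin K ?T ?T (\<lambda>s. (s \<otimes>\<^bsub>?A\<^esub> t) \<otimes>\<^bsub>?A\<^esub> u)" by (rule lin_compose[OF L[OF u] L[OF t]])
    show "lin K ?T ?T (\<lambda>s. s \<otimes>\<^bsub>?A\<^esub> (t \<otimes>\<^bsub>?A\<^esub> u))" by (rule L[OF cl[OF t u]])
    fix a b assume ab: "a \<in> carrier A" "b \<in> carrier B"
    then have s: "tens K A B a b \<in> carrier ?T" by (intro tens_closed m)
    show "(tens K A B a b \<otimes>\<^bsub>?A\<^esub> t) \<otimes>\<^bsub>?A\<^esub> u = tens K A B a b \<otimes>\<^bsub>?A\<^esub> (t \<otimes>\<^bsub>?A\<^esub> u)"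
    proof (rule tensor_ext[OF m mT _ _ _ t])
      show "lin K ?T ?T (\<lambda>t. (tens K A B a b \<otimes>\<^bsub>?A\<^esub> t) \<otimes>\<^bsub>?A\<^esub> u)" by (rule lin_compose[OF L[OF u] R[OF s]])
      show "lin K ?T ?T (\<lambda>t. tens K A B a b \<otimes>\<^bsub>?A\<^esub> (t \<otimes>\<^bsub>?A\<^esub> u))" by (rule lin_compose[OF R[OF s] L[OF u]])
      fix c d assume cd: "c \<in> carrier A" "d \<in> carrier B"
      then have t: "tens K A B c d \<in> carrier ?T" by (intro tens_closed m)
      show "(tens K A B a b \<otimes>\<^bsub>?A\<^esub> tens K A B c d) \<otimes>\<^bsub>?A\<^esub> u =
        tens K A B a b \<otimes>\<^bsub>?A\<^esub> (tens K A B c d \<otimes>\<^bsub>?A\<^esub> u)"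
        by (rule tensor_ext[OF m mT _ _ _ u], rule R[OF cl[OF s t]], rule lin_compose[OF R[OF s] R[OF t]])
          (simp add: tensor_mult_tens ab cd A.m_assoc B.m_assoc)
    qed
  qed
  have unit: "\<one>\<^bsub>?A\<^esub> \<otimes>\<^bsub>?A\<^esub> s = s" "s \<otimes>\<^bsub>?A\<^esub> \<one>\<^bsub>?A\<^esub> = s" if s: "s \<in> carrier ?T" for s
    by (rule tensor_ext[OF m mT R[OF one] lin_id _ s], simp add: tensor_mult_tens)
      (rule tensor_ext[OF m mT L[OF one] lin_id _ s], simp add: tensor_mult_tens)
  have "ring ?A"
  proof (rule ringI)
    show "abelian_group ?A" by (rule TA.abelian_group_axioms)
    show "monoid ?A"
      by (rule monoidI) (use one cl assoc unit in auto)
  qed (use lin_add[OF L] lin_add[OF R] in auto)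
  moreover have "vectorspace K ?A"
    using A mA by (simp add: unital_algebra_def vectorspace_def)
  ultimately show ?thesis
    using lin_smult[OF L] lin_smult[OF R] by (auto simp: unital_algebra_def)
qed

end

text \<open>The Sweedler rule for a product of tensors: \<open>s t = \<Sum> s\<^sub>1 t\<^sub>1 \<otimes> s\<^sub>2 t\<^sub>2\<close>.\<close>

lemma lift_tensor_mult:
  assumes A: "unital_algebra K A" and B: "unital_algebra K B" and P: "module K P"
    and F: "bilinear K A B P F"
    and s: "s \<in> carrier (tensor_space K A B)" and t: "t \<in> carrier (tensor_space K A B)"
  shows "tensor_lift K A B P F (s \<otimes>\<^bsub>tensor_algebra K A B\<^esub> t) =
    tensor_lift K A B P (\<lambda>a b. tensor_lift K A B P (\<lambda>a' b'. F (a \<otimes>\<^bsub>A\<^esub> a') (b \<otimes>\<^bsub>B\<^esub> b')) t) s"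
proof -
  note m = unital_algebra_module[OF A] unital_algebra_module[OF B]
  note r = unital_algebra_ring[OF A] unital_algebra_ring[OF B]
  have mT: "module K (tensor_space K A B)" by (intro lin_intros m)
  note L = lift_linear[OF m P F]
  have b: "bilinear K A B P (\<lambda>a' b'. F (a \<otimes>\<^bsub>A\<^esub> a') (b \<otimes>\<^bsub>B\<^esub> b'))"
    if "a \<in> carrier A" "b \<in> carrier B" for a b
    by (intro bilinearI lin_compose[OF bilinear_left[OF F]] lin_compose[OF bilinear_right[OF F]]
        lin_intros A B r that)
  have b': "bilinear K A B P (\<lambda>a b. F (a \<otimes>\<^bsub>A\<^esub> a') (b \<otimes>\<^bsub>B\<^esub> b'))"
    if "a' \<in> carrier A" "b' \<in> carrier B" for a' b'
    by (intro bilinearI lin_compose[OF bilinear_left[OF F]] lin_compose[OF bilinear_right[OF F]]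
        lin_intros A B r that)
  have "tensor_lift K A B P F (s \<otimes>\<^bsub>tensor_algebra K A B\<^esub> t) =
    tensor_lift K A B P (\<lambda>a b. tensor_lift K A B P F (tensor_lift K A B (tensor_space K A B)
        (\<lambda>a' b'. tens K A B (a \<otimes>\<^bsub>A\<^esub> a') (b \<otimes>\<^bsub>B\<^esub> b')) t)) s"
    unfolding tensor_algebra_mult by (intro lin_lift_comp m mT P L s lin_intros A B r t)
  also have "\<dots> = tensor_lift K A B P (\<lambda>a b. tensor_lift K A B P (\<lambda>a' b'. F (a \<otimes>\<^bsub>A\<^esub> a') (b \<otimes>\<^bsub>B\<^esub> b')) t) s"
  proof (rule lift_cong[OF m P _ s])
    show "bilinear K A B P (\<lambda>a b. tensor_lift K A B P (\<lambda>a' b'. F (a \<otimes>\<^bsub>A\<^esub> a') (b \<otimes>\<^bsub>B\<^esub> b')) t)"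
      by (intro bilinearI lin_lift_fun m P t bilinear_left[OF b'] bilinear_right[OF b'] b)
    fix a b assume ab: "a \<in> carrier A" "b \<in> carrier B"
    have "tensor_lift K A B P F (tensor_lift K A B (tensor_space K A B)
        (\<lambda>a' b'. tens K A B (a \<otimes>\<^bsub>A\<^esub> a') (b \<otimes>\<^bsub>B\<^esub> b')) t) =
       tensor_lift K A B P (\<lambda>a' b'. tensor_lift K A B P F (tens K A B (a \<otimes>\<^bsub>A\<^esub> a') (b \<otimes>\<^bsub>B\<^esub> b'))) t"
      by (intro lin_lift_comp m mT P L lin_intros A B r t ab)
    also have "\<dots> = tensor_lift K A B P (\<lambda>a' b'. F (a \<otimes>\<^bsub>A\<^esub> a') (b \<otimes>\<^bsub>B\<^esub> b')) t"
      by (intro lift_cong[OF m P b[OF ab] t] lift_tens[OF m P F] lin_intros r ab)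
    finally show "tensor_lift K A B P F (tensor_lift K A B (tensor_space K A B)
        (\<lambda>a' b'. tens K A B (a \<otimes>\<^bsub>A\<^esub> a') (b \<otimes>\<^bsub>B\<^esub> b')) t) =
      tensor_lift K A B P (\<lambda>a' b'. F (a \<otimes>\<^bsub>A\<^esub> a') (b \<otimes>\<^bsub>B\<^esub> b')) t" .
  qed
  finally show ?thesis .
qed

text \<open>With the scalars viewed as a module over themselves, functionals are linear maps.\<close>

definition scalar_module :: "'k ring \<Rightarrow> ('k, 'k) module" where
  "scalar_module K = \<lparr>carrier = carrier K, mult = mult K, one = \<one>\<^bsub>K\<^esub>, zero = \<zero>\<^bsub>K\<^esub>,
    add = add K, smult = mult K\<rparr>"

lemma scalar_module_simps [simp]:
  "carrier (scalar_module K) = carrier K" "\<zero>\<^bsub>scalar_module K\<^esub> = \<zero>\<^bsub>K\<^esub>"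
  "x \<oplus>\<^bsub>scalar_module K\<^esub> y = x \<oplus>\<^bsub>K\<^esub> y" "c \<odot>\<^bsub>scalar_module K\<^esub> x = c \<otimes>\<^bsub>K\<^esub> x"
  by (simp_all add: scalar_module_def)

lemma scalar_module_module [lin_intros]:
  assumes "cring K"
  shows "module K (scalar_module K)"
proof -
  interpret cring K by fact
  show ?thesis
  proof (rule moduleI)
    show "abelian_group (scalar_module K)"
    proof (rule abelian_groupI, goal_cases)
      case (6 x)
      then show ?case by (intro bexI[of _ "\<ominus>\<^bsub>K\<^esub> x"]) (simp_all add: l_neg)
    qed (simp_all add: a_ac)
  qed (use assms in \<open>simp_all add: l_distr r_distr m_assoc\<close>)
qed

lemma smult_bilinear:
  assumes "module K P"
  shows "bilinear K (scalar_module K) P P (\<lambda>c p. c \<odot>\<^bsub>P\<^esub> p)"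
proof -
  interpret P: module K P by fact
  show ?thesis
    by (intro bilinearI linI) (auto simp: P.smult_l_distr P.smult_r_distr
        P.smult_assoc1[symmetric] P.m_comm)
qed

lemma lin_smult_fun [lin_intros]:
  assumes "module K P" "p \<in> carrier P" "lin K X (scalar_module K) f"
  shows "lin K X P (\<lambda>x. f x \<odot>\<^bsub>P\<^esub> p)"
  using lin_compose[OF bilinear_left[OF smult_bilinear[OF assms(1)] assms(2)] assms(3)] .

section \<open>The antipode reverses products and coproducts\<close>

locale hopf =
  fixes K :: "'k ring" and H :: "('k, 'h) hopf" (structure)
  assumes hopf: "hopf_algebra K H"
begin

abbreviation "HH \<equiv> tensor_space K H H"
abbreviation "\<Delta> \<equiv> comult H"
abbreviation "\<epsilon> \<equiv> counit H"
abbreviation "S \<equiv> antipode H"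

lemma H_algebra: "unital_algebra K H"
  using hopf by (simp add: hopf_algebra_def)

lemma H_module: "module K H"
  by (rule unital_algebra_module[OF H_algebra])

lemma HH_module: "module K HH"
  by (intro lin_intros H_module)

sublocale HM: module K H by (rule H_module)
sublocale H: ring H by (rule unital_algebra_ring[OF H_algebra])
sublocale HH: module K HH by (rule HH_module)

lemma K_module: "module K (scalar_module K)"
  by (intro lin_intros HM.is_cring)

lemma comult_linear: "lin K H HH \<Delta>"
  using hopf by (simp add: hopf_algebra_def algebra_hom_def
      same_module_lin[OF same_module_refl tensor_algebra_same_module])

lemma comult_closed: "h \<in> carrier H \<Longrightarrow> \<Delta> h \<in> carrier HH"
  by (rule lin_closed[OF comult_linear])

lemma comult_mult: "x \<in> carrier H \<Longrightarrow> y \<in> carrier H \<Longrightarrow>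
    \<Delta> (x \<otimes> y) = \<Delta> x \<otimes>\<^bsub>tensor_algebra K H H\<^esub> \<Delta> y"
  using hopf by (auto simp: hopf_algebra_def algebra_hom_def ring_hom_def)

lemma comult_one: "\<Delta> \<one> = tens K H H \<one> \<one>"
  using hopf by (auto simp: hopf_algebra_def algebra_hom_def ring_hom_def)

lemma counit_closed: "h \<in> carrier H \<Longrightarrow> \<epsilon> h \<in> carrier K"
  using hopf by (auto simp: hopf_algebra_def ring_hom_def)

lemma counit_linear: "lin K H (scalar_module K) \<epsilon>"
  using hopf by (intro linI) (auto simp: hopf_algebra_def ring_hom_def)

lemma counit_mult: "x \<in> carrier H \<Longrightarrow> y \<in> carrier H \<Longrightarrow> \<epsilon> (x \<otimes> y) = \<epsilon> x \<otimes>\<^bsub>K\<^esub> \<epsilon> y"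
  using hopf by (auto simp: hopf_algebra_def ring_hom_def)

lemma counit_one: "\<epsilon> \<one> = \<one>\<^bsub>K\<^esub>"
  using hopf by (auto simp: hopf_algebra_def ring_hom_def)

lemma antipode_linear: "lin K H H S"
  using hopf by (simp add: hopf_algebra_def)

lemma antipode_closed: "h \<in> carrier H \<Longrightarrow> S h \<in> carrier H"
  by (rule lin_closed[OF antipode_linear])

lemmas lin_comult [lin_intros] = lin_compose[OF comult_linear]
lemmas lin_counit [lin_intros] = lin_compose[OF counit_linear]
lemmas lin_antipode [lin_intros] = lin_compose[OF antipode_linear]
declare comult_closed [lin_intros] counit_closed [lin_intros] antipode_closed [lin_intros]
declare H_module [lin_intros] K_module [lin_intros] H_algebra [lin_intros]
declare HM.smult_closed [lin_intros] H.one_closed [lin_intros] H.ring_axioms [lin_intros]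

lemmas cong_HH = lift_cong[OF H_module H_module]
lemmas comp_HH = lin_lift_comp[OF H_module H_module]

lemma coassoc:
  assumes "h \<in> carrier H" "module K P" "trilinear K H H H P F"
  shows "tensor_lift K H H P (\<lambda>a c. tensor_lift K H H P (\<lambda>x y. F x y c) (\<Delta> a)) (\<Delta> h) =
    tensor_lift K H H P (\<lambda>a b. tensor_lift K H H P (F a) (\<Delta> b)) (\<Delta> h)"
  by (rule coassoc_trilinear[OF H_module H_module H_module H_module H_module assms(2) comult_linear
        comult_closed[OF assms(1)] comult_linear comult_closed[OF assms(1)] _ assms(3)])
    (use hopf assms(1) in \<open>simp add: hopf_algebra_def\<close>)

lemma counit_left: "h \<in> carrier H \<Longrightarrow> tensor_lift K H H H (\<lambda>a b. \<epsilon> a \<odot> b) (\<Delta> h) = h"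
  and counit_right: "h \<in> carrier H \<Longrightarrow> tensor_lift K H H H (\<lambda>a b. \<epsilon> b \<odot> a) (\<Delta> h) = h"
  and antipode_left:
    "h \<in> carrier H \<Longrightarrow> tensor_lift K H H H (\<lambda>a b. S a \<otimes> b) (\<Delta> h) = \<epsilon> h \<odot> \<one>"
  and antipode_right:
    "h \<in> carrier H \<Longrightarrow> tensor_lift K H H H (\<lambda>a b. a \<otimes> S b) (\<Delta> h) = \<epsilon> h \<odot> \<one>"
  using hopf by (auto simp: hopf_algebra_def)

text \<open>Convolution along an arbitrary pairing \<open>\<mu>\<close>.  It covers the product of the convolution algebra and
  also the actions of that algebra on linear maps into a bimodule.\<close>

definition conv ::
  "('k, 'p, 'q) module_scheme \<Rightarrow> ('a \<Rightarrow> 'b \<Rightarrow> 'p) \<Rightarrow> ('h \<Rightarrow> 'a) \<Rightarrow> ('h \<Rightarrow> 'b) \<Rightarrow> 'h \<Rightarrow> 'p" where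
  "conv P \<mu> f g h = tensor_lift K H H P (\<lambda>a b. \<mu> (f a) (g b)) (\<Delta> h)"

lemma conv_bilinear:
  assumes "bilinear K A B P \<mu>" "lin K H A f" "lin K H B g"
  shows "bilinear K H H P (\<lambda>a b. \<mu> (f a) (g b))"
  by (intro bilinearI lin_compose[OF bilinear_left[OF assms(1)] assms(2)]
      lin_compose[OF bilinear_right[OF assms(1)] assms(3)] lin_closed[OF assms(2)] lin_closed[OF assms(3)])

lemma conv_linear:
  assumes "module K P" "bilinear K A B P \<mu>" "lin K H A f" "lin K H B g"
  shows "lin K H P (conv P \<mu> f g)"
  unfolding conv_def[abs_def]
  by (intro lin_intros assms(1) conv_bilinear[OF assms(2-4)])

lemma conv_cong:
  assumes "module K P" "bilinear K A B P \<mu>" "lin K H A f" "lin K H B g" "h \<in> carrier H"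
    and "\<And>x. x \<in> carrier H \<Longrightarrow> f' x = f x" "\<And>x. x \<in> carrier H \<Longrightarrow> g' x = g x"
  shows "conv P \<mu> f' g' h = conv P \<mu> f g h"
  unfolding conv_def
  by (rule cong_HH[OF assms(1) conv_bilinear[OF assms(2-4)] comult_closed[OF assms(5)]])
    (simp add: assms(6,7))

text \<open>Every associative law between convolutions used below is an instance of this one, in which the
  four pairings may be different.\<close>

lemma conv_assoc:
  assumes m: "module K D" "module K E" "module K P"
    and b: "bilinear K A B D \<mu>" "bilinear K D C P \<nu>" "bilinear K B C E \<mu>'" "bilinear K A E P \<nu>'"
    and assoc: "\<And>a b c. a \<in> carrier A \<Longrightarrow> b \<in> carrier B \<Longrightarrow> c \<in> carrier C \<Longrightarrow>
      \<nu> (\<mu> a b) c = \<nu>' a (\<mu>' b c)"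
    and l: "lin K H A f" "lin K H B g" "lin K H C k" and h: "h \<in> carrier H"
  shows "conv P \<nu> (conv D \<mu> f g) k h = conv P \<nu>' f (conv E \<mu>' g k) h"
proof -
  note c = lin_closed[OF l(1)] lin_closed[OF l(2)] lin_closed[OF l(3)]
  note bD = conv_bilinear[OF b(1) l(1,2)] and bE = conv_bilinear[OF b(3) l(2,3)]
  have L: "bilinear K H H P (\<lambda>x y. \<nu> (\<mu> (f x) (g y)) (k z))" if "z \<in> carrier H" for z
    by (intro bilinearI lin_compose[OF bilinear_left[OF b(2)]] c that
        bilinear_left[OF bD] bilinear_right[OF bD])
  have R: "bilinear K H H P (\<lambda>y z. \<nu>' (f x) (\<mu>' (g y) (k z)))" if "x \<in> carrier H" for x
    by (intro bilinearI lin_compose[OF bilinear_right[OF b(4)]] c that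
        bilinear_left[OF bE] bilinear_right[OF bE])
  have tri: "trilinear K H H H P (\<lambda>x y z. \<nu> (\<mu> (f x) (g y)) (k z))"
  proof (rule trilinearI)
    fix x assume x: "x \<in> carrier H"
    show "bilinear K H H P (\<lambda>y z. \<nu> (\<mu> (f x) (g y)) (k z))"
      by (subst bilinear_cong[OF _ H_module H_module, of _ "\<lambda>y z. \<nu>' (f x) (\<mu>' (g y) (k z))"])
        (simp_all add: assoc c x R)
  next
    fix y z assume "y \<in> carrier H" "z \<in> carrier H"
    then show "lin K H P (\<lambda>x. \<nu> (\<mu> (f x) (g y)) (k z))" using bilinear_left[OF L] by blast
  qed
  have "conv P \<nu> (conv D \<mu> f g) k h = tensor_lift K H H P
      (\<lambda>a c. tensor_lift K H H P (\<lambda>x y. \<nu> (\<mu> (f x) (g y)) (k c)) (\<Delta> a)) (\<Delta> h)"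
    unfolding conv_def
  proof (rule cong_HH[OF m(3) _ comult_closed[OF h]])
    show "bilinear K H H P (\<lambda>a c. tensor_lift K H H P (\<lambda>x y. \<nu> (\<mu> (f x) (g y)) (k c)) (\<Delta> a))"
      by (intro lin_intros m L bilinear_left[OF L] trilinearD[OF tri])
  qed (intro comp_HH[OF m(1,3) bD] bilinear_left[OF b(2)] c comult_closed; assumption)
  also have "\<dots> = tensor_lift K H H P (\<lambda>a b. tensor_lift K H H P (\<lambda>y z. \<nu> (\<mu> (f a) (g y)) (k z)) (\<Delta> b)) (\<Delta> h)"
    by (rule coassoc[OF h m(3) tri])
  also have "\<dots> = conv P \<nu>' f (conv E \<mu>' g k) h"
    unfolding conv_def
  proof (rule cong_HH[OF m(3) _ comult_closed[OF h]])
    have l': "lin K H E (\<lambda>b. tensor_lift K H H E (\<lambda>a b. \<mu>' (g a) (k b)) (\<Delta> b))"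
      by (intro lin_intros m bE)
    show "bilinear K H H P (\<lambda>a b. \<nu>' (f a) (tensor_lift K H H E (\<lambda>a b. \<mu>' (g a) (k b)) (\<Delta> b)))"
      by (rule conv_bilinear[OF b(4) l(1) l'])
    fix x y assume xy: "x \<in> carrier H" "y \<in> carrier H"
    have "tensor_lift K H H P (\<lambda>y z. \<nu> (\<mu> (f x) (g y)) (k z)) (\<Delta> y) =
      tensor_lift K H H P (\<lambda>y z. \<nu>' (f x) (\<mu>' (g y) (k z))) (\<Delta> y)"
      by (rule cong_HH[OF m(3) R comult_closed]) (simp_all add: assoc c xy)
    also have "\<dots> = \<nu>' (f x) (tensor_lift K H H E (\<lambda>y z. \<mu>' (g y) (k z)) (\<Delta> y))"
      by (intro comp_HH[OF m(2,3) bE, symmetric]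
          bilinear_right[OF b(4)] c comult_closed xy)
    finally show "tensor_lift K H H P (\<lambda>y z. \<nu> (\<mu> (f x) (g y)) (k z)) (\<Delta> y) =
      \<nu>' (f x) (tensor_lift K H H E (\<lambda>a b. \<mu>' (g a) (k b)) (\<Delta> y))" .
  qed
  finally show ?thesis .
qed

lemma conv_unit_right:
  assumes m: "module K B" "module K P" and b: "bilinear K A B P \<mu>" and f: "lin K H A f"
    and u: "u \<in> carrier B" and h: "h \<in> carrier H"
  shows "conv P \<mu> f (\<lambda>x. \<epsilon> x \<odot>\<^bsub>B\<^esub> u) h = \<mu> (f h) u"
proof -
  have l: "lin K H P (\<lambda>x. \<mu> (f x) u)" by (rule lin_compose[OF bilinear_left[OF b u] f])
  have "\<mu> (f h) u = \<mu> (f (tensor_lift K H H H (\<lambda>a b. \<epsilon> b \<odot> a) (\<Delta> h))) u"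
    using counit_right h by simp
  also have "\<dots> = tensor_lift K H H P (\<lambda>a b. \<mu> (f (\<epsilon> b \<odot> a)) u) (\<Delta> h)"
    by (rule comp_HH[OF H_module m(2) _ l comult_closed[OF h]]) (intro lin_intros)
  also have "\<dots> = conv P \<mu> f (\<lambda>x. \<epsilon> x \<odot>\<^bsub>B\<^esub> u) h"
    unfolding conv_def
    by (rule cong_HH[OF m(2) conv_bilinear[OF b f] comult_closed[OF h]])
      (intro lin_intros m u, simp add: lin_smult[OF l] counit_closed
        lin_smult[OF bilinear_right[OF b lin_closed[OF f]]] u)
  finally show ?thesis ..
qed

lemma conv_unit_left:
  assumes m: "module K A" "module K P" and b: "bilinear K A B P \<mu>" and f: "lin K H B f"
    and u: "u \<in> carrier A" and h: "h \<in> carrier H"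
  shows "conv P \<mu> (\<lambda>x. \<epsilon> x \<odot>\<^bsub>A\<^esub> u) f h = \<mu> u (f h)"
proof -
  have l: "lin K H P (\<lambda>x. \<mu> u (f x))" by (rule lin_compose[OF bilinear_right[OF b u] f])
  have "\<mu> u (f h) = \<mu> u (f (tensor_lift K H H H (\<lambda>a b. \<epsilon> a \<odot> b) (\<Delta> h)))"
    using counit_left h by simp
  also have "\<dots> = tensor_lift K H H P (\<lambda>a b. \<mu> u (f (\<epsilon> a \<odot> b))) (\<Delta> h)"
    by (rule comp_HH[OF H_module m(2) _ l comult_closed[OF h]]) (intro lin_intros)
  also have "\<dots> = conv P \<mu> (\<lambda>x. \<epsilon> x \<odot>\<^bsub>A\<^esub> u) f h"
    unfolding conv_def
    by (rule cong_HH[OF m(2) conv_bilinear[OF b _ f] comult_closed[OF h]])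
      (intro lin_intros m u, simp add: lin_smult[OF l] counit_closed
        lin_smult[OF bilinear_left[OF b lin_closed[OF f]]] u)
  finally show ?thesis ..
qed

lemma conv_lin_comp:
  assumes "module K P" "module K Q" "bilinear K A B P \<mu>" "lin K H A f" "lin K H B k" "lin K P Q g"
    "h \<in> carrier H"
  shows "g (conv P \<mu> f k h) = conv Q (\<lambda>a b. g (\<mu> a b)) f k h"
  unfolding conv_def
  using comp_HH[OF assms(1,2) conv_bilinear[OF assms(3-5)] assms(6) comult_closed[OF assms(7)]] .

abbreviation "mulH \<equiv> (\<lambda>x y. x \<otimes> y)"
abbreviation "idH \<equiv> (\<lambda>x. x)"
abbreviation "unitH \<equiv> (\<lambda>h. \<epsilon> h \<odot> \<one>)"

lemma mulH_bilinear: "bilinear K H H H mulH"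
  by (rule mult_bilinear[OF H_algebra])

lemma conv_antipode_id: "h \<in> carrier H \<Longrightarrow> conv H mulH S idH h = unitH h"
  and conv_id_antipode: "h \<in> carrier H \<Longrightarrow> conv H mulH idH S h = unitH h"
  by (simp_all add: conv_def antipode_left antipode_right)

text \<open>\<open>\<Sum> a h\<^sub>1 S(h\<^sub>2) = \<epsilon>(h) a\<close>\<close>

lemma conv_left_mult_antipode:
  assumes "a \<in> carrier H" "h \<in> carrier H"
  shows "conv H mulH (\<lambda>x. a \<otimes> x) S h = \<epsilon> h \<odot> a"
proof -
  have "conv H mulH (\<lambda>x. a \<otimes> x) S h = conv H (\<lambda>x y. a \<otimes> mulH x y) idH S h"
    unfolding conv_def
    by (rule cong_HH[OF H_module _ comult_closed[OF assms(2)]])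
      (use assms in \<open>auto intro!: lin_intros simp: H.m_assoc antipode_closed\<close>)
  also have "\<dots> = a \<otimes> conv H mulH idH S h"
    by (rule conv_lin_comp[OF H_module H_module mulH_bilinear _ _ _ assms(2), symmetric])
      (intro lin_intros antipode_linear assms)+
  finally show ?thesis
    using assms H_algebra by (simp add: conv_id_antipode unital_algebra_def counit_closed)
qed

text \<open>Evaluate \<open>\<Sum> S(a\<^sub>1 b\<^sub>1) a\<^sub>2 b\<^sub>2 S(b\<^sub>3)\<close> in two ways.  Cancelling \<open>b\<^sub>2 S(b\<^sub>3)\<close> leaves the left-hand
  side; the inverse law for the product \<open>a b\<^sub>1\<close> collapses the first part and leaves \<open>\<epsilon>(a) S(b)\<close>.\<close>

lemma antipode_partial_anti_mult:
  assumes a: "a \<in> carrier H" and b: "b \<in> carrier H"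
  shows "conv H mulH (\<lambda>x. S (x \<otimes> b)) idH a = \<epsilon> a \<odot> S b"
proof -
  let ?f = "\<lambda>x y. S (x \<otimes> y)"
  let ?l = "\<lambda>x y. x \<otimes> y"
  have lf: "lin K H H (?f x)" "lin K H H (?l x)" if "x \<in> carrier H" for x
    by (intro lin_intros that)+
  have step: "mulH (?f x b) y = conv H mulH (conv H mulH (?f x) (?l y)) S b"
    if xy: "x \<in> carrier H" "y \<in> carrier H" for x y
  proof -
    have "conv H mulH (conv H mulH (?f x) (?l y)) S b = conv H mulH (?f x) (conv H mulH (?l y) S) b"
      by (rule conv_assoc[OF H_module H_module H_module mulH_bilinear mulH_bilinear mulH_bilinear
            mulH_bilinear H.m_assoc lf(1)[OF xy(1)] lf(2)[OF xy(2)] antipode_linear b]) 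
    also have "\<dots> = conv H mulH (?f x) (\<lambda>h. \<epsilon> h \<odot> y) b"
      by (rule conv_cong[OF H_module mulH_bilinear lf(1)[OF xy(1)] _ b])
        (use xy in \<open>auto intro!: lin_intros counit_linear simp: conv_left_mult_antipode\<close>)
    also have "\<dots> = mulH (?f x b) y"
      by (rule conv_unit_right[OF H_module H_module mulH_bilinear lf(1)[OF xy(1)] xy(2) b])
    finally show ?thesis ..
  qed
  have bil1: "bilinear K H H H (\<lambda>x y. mulH (?f x z) (mulH y w))"
    if "z \<in> carrier H" "w \<in> carrier H" for z w
    by (intro lin_intros that)
  have bil2: "bilinear K H H H (\<lambda>z w. mulH (?f x z) (mulH y w))"
    if "x \<in> carrier H" "y \<in> carrier H" for x y
    by (intro lin_intros that)
  have inner: "tensor_lift K H H H (\<lambda>x y. conv H mulH (?f x) (?l y) z) (\<Delta> a) =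
    (\<epsilon> a \<otimes>\<^bsub>K\<^esub> \<epsilon> z) \<odot> \<one>" if z: "z \<in> carrier H" for z
  proof -
    have bS: "bilinear K H H H (\<lambda>a b. S a \<otimes> b)" by (intro lin_intros)
    have "(\<epsilon> a \<otimes>\<^bsub>K\<^esub> \<epsilon> z) \<odot> \<one> = tensor_lift K H H H (\<lambda>a b. S a \<otimes> b) (\<Delta> (a \<otimes> z))"
      using a z by (simp add: antipode_left counit_mult)
    also have "\<dots> = tensor_lift K H H H (\<lambda>x y. conv H mulH (?f x) (?l y) z) (\<Delta> a)"
      unfolding conv_def using a z
      by (simp add: comult_mult lift_tensor_mult[OF H_algebra H_algebra H_module bS] comult_closed)
    finally show ?thesis ..
  qed
  have bconv: "bilinear K H H H (\<lambda>x y. conv H mulH (?f x) (?l y) z)" if "z \<in> carrier H" for z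
    unfolding conv_def by (intro lin_intros that)
  have "conv H mulH (\<lambda>x. S (x \<otimes> b)) idH a =
    tensor_lift K H H H (\<lambda>x y. conv H mulH (conv H mulH (?f x) (?l y)) S b) (\<Delta> a)"
    unfolding conv_def[of _ _ _ idH a]
  proof (rule cong_HH[OF H_module _ comult_closed[OF a]])
    show "bilinear K H H H (\<lambda>x y. conv H mulH (conv H mulH (?f x) (?l y)) S b)"
      unfolding conv_def by (intro lin_intros b)
  qed (rule step)
  also have "\<dots> = tensor_lift K H H H (\<lambda>z w. tensor_lift K H H H
      (\<lambda>x y. conv H mulH (?f x) (?l y) z \<otimes> S w) (\<Delta> a)) (\<Delta> b)"
    unfolding conv_def
    by (intro lift_swap H_module comult_closed a b lin_intros)
  also have "\<dots> = tensor_lift K H H H (\<lambda>z w. \<epsilon> a \<odot> (\<epsilon> z \<odot> S w)) (\<Delta> b)"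
  proof (rule cong_HH[OF H_module _ comult_closed[OF b]])
    show "bilinear K H H H (\<lambda>z w. \<epsilon> a \<odot> (\<epsilon> z \<odot> S w))"
      by (intro lin_intros a counit_linear)
    fix z w assume zw: "z \<in> carrier H" "w \<in> carrier H"
    have "tensor_lift K H H H (\<lambda>x y. conv H mulH (?f x) (?l y) z \<otimes> S w) (\<Delta> a) =
      tensor_lift K H H H (\<lambda>x y. conv H mulH (?f x) (?l y) z) (\<Delta> a) \<otimes> S w"
      by (rule comp_HH[OF H_module H_module bconv[OF zw(1)] _ comult_closed[OF a], symmetric])
        (intro lin_intros zw)
    also have "\<dots> = \<epsilon> a \<odot> (\<epsilon> z \<odot> S w)"
      using H_algebra zw a by (simp add: inner unital_algebra_def HM.smult_assoc1 counit_closed antipode_closed)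
    finally show "tensor_lift K H H H (\<lambda>x y. conv H mulH (?f x) (?l y) z \<otimes> S w) (\<Delta> a) =
      \<epsilon> a \<odot> (\<epsilon> z \<odot> S w)" .
  qed
  also have "\<dots> = \<epsilon> a \<odot> S (tensor_lift K H H H (\<lambda>z w. \<epsilon> z \<odot> w) (\<Delta> b))"
  proof -
    have b1: "bilinear K H H H (\<lambda>z w. \<epsilon> z \<odot> w)" by (intro lin_intros counit_linear)
    have l: "lin K H H (\<lambda>x. \<epsilon> a \<odot> S x)" by (intro lin_intros a)
    have "tensor_lift K H H H (\<lambda>z w. \<epsilon> a \<odot> S (\<epsilon> z \<odot> w)) (\<Delta> b) =
      tensor_lift K H H H (\<lambda>z w. \<epsilon> a \<odot> (\<epsilon> z \<odot> S w)) (\<Delta> b)"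
      by (rule cong_HH[OF H_module _ comult_closed[OF b]])
        ((intro lin_intros a counit_linear; assumption)+, simp add: lin_smult[OF antipode_linear] counit_closed)
    then show ?thesis
      using comp_HH[OF H_module H_module b1 l comult_closed[OF b]] by simp
  qed
  finally show ?thesis by (simp add: counit_left b)
qed

text \<open>Convolve the preceding identity, read as a function of \<open>a\<close>, with \<open>S\<close>.\<close>

lemma antipode_mult:
  assumes a: "a \<in> carrier H" and b: "b \<in> carrier H"
  shows "S (a \<otimes> b) = S b \<otimes> S a"
proof -
  let ?f = "\<lambda>x. S (x \<otimes> b)"
  have lf: "lin K H H ?f" by (intro lin_intros b)
  have "conv H mulH (conv H mulH ?f idH) S a = conv H mulH ?f (conv H mulH idH S) a"
    by (rule conv_assoc[OF H_module H_module H_module mulH_bilinear mulH_bilinear mulH_bilinear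
          mulH_bilinear H.m_assoc lf lin_id antipode_linear a])
  also have "\<dots> = conv H mulH ?f unitH a"
    by (rule conv_cong[OF H_module mulH_bilinear lf _ a])
      (auto intro!: lin_intros counit_linear simp: conv_id_antipode)
  also have "\<dots> = S (a \<otimes> b) \<otimes> \<one>"
    by (rule conv_unit_right[OF H_module H_module mulH_bilinear lf H.one_closed a])
  finally have "S (a \<otimes> b) = conv H mulH (conv H mulH ?f idH) S a"
    using a b by (simp add: antipode_closed)
  also have "\<dots> = conv H mulH (\<lambda>x. \<epsilon> x \<odot> S b) S a"
    by (rule conv_cong[OF H_module mulH_bilinear _ antipode_linear a])
      (auto intro!: lin_intros counit_linear b simp: antipode_partial_anti_mult b)
  also have "\<dots> = S b \<otimes> S a"
    by (rule conv_unit_left[OF H_module H_module mulH_bilinear antipode_linear antipode_closed[OF b] a])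
  finally show ?thesis .
qed

lemma lift_comult_one:
  "module K P \<Longrightarrow> bilinear K H H P f \<Longrightarrow> tensor_lift K H H P f (\<Delta> \<one>) = f \<one> \<one>"
  by (simp add: comult_one lift_tens H_module)

lemma antipode_one: "S \<one> = \<one>"
proof -
  have "bilinear K H H H (\<lambda>a b. S a \<otimes> b)" by (intro lin_intros)
  then show ?thesis
    using antipode_left[OF H.one_closed] lift_comult_one[OF H_module]
    by (simp add: counit_one antipode_closed)
qed

lemma counit_smult: "c \<in> carrier K \<Longrightarrow> h \<in> carrier H \<Longrightarrow> \<epsilon> (c \<odot> h) = c \<otimes>\<^bsub>K\<^esub> \<epsilon> h"
  using lin_smult[OF counit_linear] by simp

text \<open>Apply \<open>\<epsilon>\<close> to \<open>\<Sum> S(h\<^sub>1) h\<^sub>2 = \<epsilon>(h) 1\<close>.\<close>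

lemma counit_antipode:
  assumes h: "h \<in> carrier H"
  shows "\<epsilon> (S h) = \<epsilon> h"
proof -
  have "\<epsilon> h = \<epsilon> (tensor_lift K H H H (\<lambda>a b. S a \<otimes> b) (\<Delta> h))"
    using h lin_smult[OF counit_linear, of "\<epsilon> h" "\<one>"]
    by (simp add: antipode_left counit_closed counit_one)
  also have "\<dots> = tensor_lift K H H (scalar_module K) (\<lambda>a b. \<epsilon> (S a \<otimes> b)) (\<Delta> h)"
    by (intro lin_lift_comp lin_intros counit_linear h)
  also have "\<dots> = tensor_lift K H H (scalar_module K) (\<lambda>a b. \<epsilon> (S (\<epsilon> b \<odot> a))) (\<Delta> h)"
    by (rule cong_HH[OF K_module _ comult_closed[OF h]])
      ((intro lin_intros counit_linear; assumption)+, simp add: counit_mult antipode_closed counit_closed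
        counit_smult lin_smult[OF antipode_linear] HM.m_comm)
  also have "\<dots> = \<epsilon> (S (tensor_lift K H H H (\<lambda>a b. \<epsilon> b \<odot> a) (\<Delta> h)))"
    by (rule comp_HH[OF H_module K_module _ _ comult_closed[OF h], symmetric])
      (intro lin_intros counit_linear; assumption)+
  finally show ?thesis by (simp add: counit_right h)
qed

abbreviation "mulHH \<equiv> (\<lambda>s t. s \<otimes>\<^bsub>tensor_algebra K H H\<^esub> t)"
abbreviation "oneHH \<equiv> tens K H H \<one> \<one>"

lemma mulHH_bilinear: "bilinear K HH HH HH mulHH"
  by (rule tensor_mult_bilinear[OF H_algebra H_algebra])

lemma HH_ring: "ring (tensor_algebra K H H)"
  by (rule unital_algebra_ring[OF tensor_algebra_unital[OF H_algebra H_algebra]])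

lemma mulHH_assoc: "s \<in> carrier HH \<Longrightarrow> t \<in> carrier HH \<Longrightarrow> u \<in> carrier HH \<Longrightarrow>
    mulHH (mulHH s t) u = mulHH s (mulHH t u)"
  using monoid.m_assoc[OF ring.is_monoid[OF HH_ring]] by simp

lemma mulHH_one: "s \<in> carrier HH \<Longrightarrow> mulHH oneHH s = s" "s \<in> carrier HH \<Longrightarrow> mulHH s oneHH = s"
  using monoid.l_one[OF ring.is_monoid[OF HH_ring]] monoid.r_one[OF ring.is_monoid[OF HH_ring]] by simp_all

lemma oneHH_closed: "oneHH \<in> carrier HH"
  by (intro lin_intros)

text \<open>The image of the inverse laws of \<open>S\<close> under an algebra map \<open>i\<close>: the convolution inverse of \<open>i\<close> is
  \<open>i \<circ> S\<close>.\<close>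

lemma conv_algebra_map_antipode:
  assumes m: "module K P" and i: "lin K H P i"
    and mult: "\<And>x y. x \<in> carrier H \<Longrightarrow> y \<in> carrier H \<Longrightarrow> i (x \<otimes> y) = \<mu> (i x) (i y)"
    and h: "h \<in> carrier H"
  shows "conv P \<mu> (\<lambda>x. i (S x)) i h = \<epsilon> h \<odot>\<^bsub>P\<^esub> i \<one>"
    and "conv P \<mu> i (\<lambda>x. i (S x)) h = \<epsilon> h \<odot>\<^bsub>P\<^esub> i \<one>"
proof -
  have 1: "tensor_lift K H H P (\<lambda>a b. \<mu> (i (S a)) (i b)) (\<Delta> h) =
    tensor_lift K H H P (\<lambda>a b. i (S a \<otimes> b)) (\<Delta> h)"
    by (rule cong_HH[OF m _ comult_closed[OF h]])
      ((intro bilinearI lin_compose[OF i] lin_intros; assumption)+, simp add: mult antipode_closed)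
  have 2: "tensor_lift K H H P (\<lambda>a b. \<mu> (i a) (i (S b))) (\<Delta> h) =
    tensor_lift K H H P (\<lambda>a b. i (a \<otimes> S b)) (\<Delta> h)"
    by (rule cong_HH[OF m _ comult_closed[OF h]])
      ((intro bilinearI lin_compose[OF i] lin_intros; assumption)+, simp add: mult antipode_closed)
  have 3: "tensor_lift K H H P (\<lambda>a b. i (S a \<otimes> b)) (\<Delta> h) = i (tensor_lift K H H H (\<lambda>a b. S a \<otimes> b) (\<Delta> h))"
    by (rule comp_HH[OF H_module m _ i comult_closed[OF h], symmetric]) (intro lin_intros)
  have 4: "tensor_lift K H H P (\<lambda>a b. i (a \<otimes> S b)) (\<Delta> h) = i (tensor_lift K H H H (\<lambda>a b. a \<otimes> S b) (\<Delta> h))"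
    by (rule comp_HH[OF H_module m _ i comult_closed[OF h], symmetric]) (intro lin_intros)
  show "conv P \<mu> (\<lambda>x. i (S x)) i h = \<epsilon> h \<odot>\<^bsub>P\<^esub> i \<one>" "conv P \<mu> i (\<lambda>x. i (S x)) h = \<epsilon> h \<odot>\<^bsub>P\<^esub> i \<one>"
    unfolding conv_def 1 2 3 4 by (simp_all add: h antipode_left antipode_right lin_smult[OF i] counit_closed)
qed

text \<open>By the preceding lemma \<open>\<Delta> \<circ> S\<close> is the convolution inverse of the algebra map \<open>\<Delta>\<close>.  But \<open>\<Delta>\<close> is also
  the convolution product of the algebra maps \<open>x \<mapsto> x \<otimes> 1\<close> and \<open>x \<mapsto> 1 \<otimes> x\<close>, with convolution inverses
  \<open>x \<mapsto> S(x) \<otimes> 1\<close> and \<open>x \<mapsto> 1 \<otimes> S(x)\<close>; the product of these two, in the opposite order, is therefore the same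
  map.\<close>

lemma antipode_comult:
  assumes h: "h \<in> carrier H"
  shows "\<Delta> (S h) = tensor_lift K H H HH (\<lambda>a b. tens K H H (S b) (S a)) (\<Delta> h)"
proof -
  let ?l = "\<lambda>x. tens K H H x \<one>" and ?r = "\<lambda>x. tens K H H \<one> x"
  let ?C = "conv HH mulHH"
  let ?u = "\<lambda>h. \<epsilon> h \<odot>\<^bsub>HH\<^esub> oneHH"
  note M = HH_module HH_module HH_module mulHH_bilinear mulHH_bilinear mulHH_bilinear mulHH_bilinear
  have l: "lin K H HH ?l" "lin K H HH ?r" "lin K H HH (\<lambda>x. ?l (S x))" "lin K H HH (\<lambda>x. ?r (S x))"
    "lin K H HH ?u" "lin K H HH (\<lambda>x. \<Delta> (S x))"
    by (intro lin_intros counit_linear)+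
  have inv: "?C ?l (\<lambda>x. ?l (S x)) x = ?u x" "?C ?r (\<lambda>x. ?r (S x)) x = ?u x" "?C (\<lambda>x. \<Delta> (S x)) \<Delta> x = ?u x"
    if "x \<in> carrier H" for x
  proof -
    show "?C ?l (\<lambda>x. ?l (S x)) x = ?u x" "?C ?r (\<lambda>x. ?r (S x)) x = ?u x"
      by (rule conv_algebra_map_antipode(2)[OF HH_module l(1) _ that]
          conv_algebra_map_antipode(2)[OF HH_module l(2) _ that],
        simp add: tensor_mult_tens[OF H_algebra H_algebra])+
    show "?C (\<lambda>x. \<Delta> (S x)) \<Delta> x = ?u x"
      using conv_algebra_map_antipode(1)[OF HH_module comult_linear comult_mult that] by (simp add: comult_one)
  qed
  have fac: "\<Delta> x = ?C ?l ?r x" if x: "x \<in> carrier H" for x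
  proof -
    have "\<Delta> x = tensor_lift K H H HH (tens K H H) (\<Delta> x)"
      by (simp add: lift_tens_id H_module comult_closed x)
    also have "\<dots> = ?C ?l ?r x"
      unfolding conv_def
      by (rule cong_HH[OF HH_module conv_bilinear[OF mulHH_bilinear l(1,2)] comult_closed[OF x]])
        (simp add: tensor_mult_tens[OF H_algebra H_algebra])
    finally show ?thesis .
  qed
  let ?G = "?C (\<lambda>x. ?r (S x)) (\<lambda>x. ?l (S x))"
  have lG: "lin K H HH ?G" by (rule conv_linear[OF HH_module mulHH_bilinear l(4,3)])
  have lrr: "lin K H HH (?C ?r (\<lambda>x. ?r (S x)))" by (rule conv_linear[OF HH_module mulHH_bilinear l(2,4)])
  have right_inv: "?C \<Delta> ?G x = ?u x" if x: "x \<in> carrier H" for x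
  proof -
    have "?C \<Delta> ?G x = ?C (?C ?l ?r) ?G x"
      by (rule conv_cong[OF HH_module mulHH_bilinear conv_linear[OF HH_module mulHH_bilinear l(1,2)] lG x])
        (simp_all add: fac)
    also have "\<dots> = ?C ?l (?C ?r ?G) x"
      by (rule conv_assoc[OF M mulHH_assoc l(1,2) lG x])
    also have "\<dots> = ?C ?l (?C (?C ?r (\<lambda>x. ?r (S x))) (\<lambda>x. ?l (S x))) x"
      by (rule conv_cong[OF HH_module mulHH_bilinear l(1) _ x])
        (simp_all add: conv_linear[OF HH_module mulHH_bilinear lrr l(3)] conv_assoc[OF M mulHH_assoc l(2,4,3)])
    also have "\<dots> = ?C ?l (\<lambda>x. ?l (S x)) x"
    proof (rule conv_cong[OF HH_module mulHH_bilinear l(1,3) x])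
      fix y assume y: "y \<in> carrier H"
      have "?C (?C ?r (\<lambda>x. ?r (S x))) (\<lambda>x. ?l (S x)) y = ?C ?u (\<lambda>x. ?l (S x)) y"
        by (rule conv_cong[OF HH_module mulHH_bilinear l(5,3) y]) (simp_all add: inv)
      also have "\<dots> = mulHH oneHH (?l (S y))"
        by (rule conv_unit_left[OF HH_module HH_module mulHH_bilinear l(3) oneHH_closed y])
      finally show "?C (?C ?r (\<lambda>x. ?r (S x))) (\<lambda>x. ?l (S x)) y = ?l (S y)"
        by (simp add: mulHH_one lin_closed[OF l(3)] y)
    qed simp
    also have "\<dots> = ?u x" by (rule inv(1)[OF x])
    finally show ?thesis .
  qed
  have "\<Delta> (S h) = ?C (\<lambda>x. \<Delta> (S x)) ?u h"
    using conv_unit_right[OF HH_module HH_module mulHH_bilinear l(6) oneHH_closed h]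
    by (simp add: mulHH_one lin_closed[OF l(6)] h)
  also have "\<dots> = ?C (\<lambda>x. \<Delta> (S x)) (?C \<Delta> ?G) h"
    by (rule conv_cong[OF HH_module mulHH_bilinear l(6) conv_linear[OF HH_module mulHH_bilinear comult_linear lG] h])
      (simp_all add: right_inv)
  also have "\<dots> = ?C (?C (\<lambda>x. \<Delta> (S x)) \<Delta>) ?G h"
    by (rule conv_assoc[OF M mulHH_assoc l(6) comult_linear lG h, symmetric])
  also have "\<dots> = ?C ?u ?G h"
    by (rule conv_cong[OF HH_module mulHH_bilinear l(5) lG h]) (simp_all add: inv)
  also have "\<dots> = mulHH oneHH (?G h)"
    by (rule conv_unit_left[OF HH_module HH_module mulHH_bilinear lG oneHH_closed h])
  also have "\<dots> = ?G h" by (simp add: mulHH_one lin_closed[OF lG] h)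
  also have "\<dots> = tensor_lift K H H HH (\<lambda>a b. tens K H H (S b) (S a)) (\<Delta> h)"
    unfolding conv_def
    by (rule cong_HH[OF HH_module _ comult_closed[OF h]])
      (auto intro!: lin_intros antipode_linear simp: tensor_mult_tens[OF H_algebra H_algebra] antipode_closed)
  finally show ?thesis .
qed

lemma lift_comult_antipode:
  assumes m: "module K P" and F: "bilinear K H H P F" and h: "h \<in> carrier H"
  shows "tensor_lift K H H P F (\<Delta> (S h)) = tensor_lift K H H P (\<lambda>a b. F (S b) (S a)) (\<Delta> h)"
proof -
  have "tensor_lift K H H P F (\<Delta> (S h)) =
    tensor_lift K H H P (\<lambda>a b. tensor_lift K H H P F (tens K H H (S b) (S a))) (\<Delta> h)"
    unfolding antipode_comult[OF h]
    by (intro lin_lift_comp H_module HH_module m lift_linear F comult_closed h lin_intros antipode_linear)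
  also have "\<dots> = tensor_lift K H H P (\<lambda>a b. F (S b) (S a)) (\<Delta> h)"
    by (rule cong_HH[OF m _ comult_closed[OF h]])
      (auto intro!: bilinearI lin_compose[OF bilinear_left[OF F] antipode_linear] lin_compose[OF bilinear_right[OF F] antipode_linear]
          antipode_closed simp: lift_tens H_module m F antipode_closed)
  finally show ?thesis .
qed

end

section \<open>Bijectivity of the antipode in finite dimension\<close>

lemma lin_finsum_bilinear:
  assumes "module K A" "module K B" "module K P" "finite J" "\<And>j. j \<in> J \<Longrightarrow> bilinear K A B P (F j)"
  shows "bilinear K A B P (\<lambda>a b. \<Oplus>\<^bsub>P\<^esub>j\<in>J. F j a b)"
  by (intro bilinearI lin_finsum_fun assms(1-4) bilinear_left[OF assms(5)] bilinear_right[OF assms(5)])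

lemma lift_finsum:
  assumes m: "module K A" "module K B" "module K P" and J: "finite J"
    and b: "\<And>j. j \<in> J \<Longrightarrow> bilinear K A B P (F j)" and t: "t \<in> carrier (tensor_space K A B)"
  shows "tensor_lift K A B P (\<lambda>a b. \<Oplus>\<^bsub>P\<^esub>j\<in>J. F j a b) t = (\<Oplus>\<^bsub>P\<^esub>j\<in>J. tensor_lift K A B P (F j) t)"
proof -
  interpret P: module K P by (rule m(3))
  have bs: "bilinear K A B P (\<lambda>a b. \<Oplus>\<^bsub>P\<^esub>j\<in>J. F j a b)"
    by (rule lin_finsum_bilinear[OF m J b])
  have l: "lin K (tensor_space K A B) P (\<lambda>t. \<Oplus>\<^bsub>P\<^esub>j\<in>J. tensor_lift K A B P (F j) t)"
    by (intro lin_finsum_fun tensor_module m J lift_linear b)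
  show ?thesis
  proof (rule tensor_ext[OF m lift_linear[OF m bs] l _ t])
    fix a c assume ac: "a \<in> carrier A" "c \<in> carrier B"
    have "(\<Oplus>\<^bsub>P\<^esub>j\<in>J. F j a c) = (\<Oplus>\<^bsub>P\<^esub>j\<in>J. tensor_lift K A B P (F j) (tens K A B a c))"
      using bilinear_closed[OF b ac] by (intro P.finsum_cong') (auto simp: lift_tens m b ac)
    then show "tensor_lift K A B P (\<lambda>a b. \<Oplus>\<^bsub>P\<^esub>j\<in>J. F j a b) (tens K A B a c) =
        (\<Oplus>\<^bsub>P\<^esub>j\<in>J. tensor_lift K A B P (F j) (tens K A B a c))"
      by (simp add: lift_tens m bs ac)
  qed
qed

lemma finsum_exchange:
  assumes P: "module K P" and "finite I" "finite J" and F: "\<And>i j. i \<in> I \<Longrightarrow> j \<in> J \<Longrightarrow> F i j \<in> carrier P"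
  shows "(\<Oplus>\<^bsub>P\<^esub>i\<in>I. \<Oplus>\<^bsub>P\<^esub>j\<in>J. F i j) = (\<Oplus>\<^bsub>P\<^esub>j\<in>J. \<Oplus>\<^bsub>P\<^esub>i\<in>I. F i j)"
proof -
  interpret P: module K P by (rule P)
  show ?thesis
    unfolding finsum_def
    by (rule comm_monoid.finprod_finprod_swap[OF P.M.a_comm_monoid]) (use assms in auto)
qed

text \<open>A spanning family together with coefficient functionals, in the form \<open>v = \<Sum> e\<^sub>b(v) b\<close> in which
  vectors are expanded and traces are taken.\<close>

definition dual_basis ::
  "'k ring \<Rightarrow> ('k, 'a, 'm) module_scheme \<Rightarrow> 'a set \<Rightarrow> ('a \<Rightarrow> 'a \<Rightarrow> 'k) \<Rightarrow> bool" where
  "dual_basis K V B e \<longleftrightarrow> finite B \<and> B \<subseteq> carrier V \<and>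
    (\<forall>b\<in>B. lin K V (scalar_module K) (e b)) \<and>
    (\<forall>v\<in>carrier V. v = (\<Oplus>\<^bsub>V\<^esub>b\<in>B. e b v \<odot>\<^bsub>V\<^esub> b))"

lemma dual_basis_exists:
  assumes V: "vectorspace K V" and fin: "vectorspace.fin_dim K V"
  shows "\<exists>B e. dual_basis K V B e"
proof -
  interpret V: vectorspace K V by (rule V)
  obtain B where B: "finite B" "V.basis B" using V.finite_basis_exists[OF fin] by auto
  then have BV: "B \<subseteq> carrier V" by (simp add: V.basis_def)
  have ex: "\<exists>!a. a \<in> B \<rightarrow>\<^sub>E carrier K \<and> V.lincomb a B = v" if "v \<in> carrier V" for v
    using V.basis_criterion[OF B(1) BV] B(2) that by blast
  define c where "c v = (THE a. a \<in> B \<rightarrow>\<^sub>E carrier K \<and> V.lincomb a B = v)" for v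
  have c: "c v \<in> B \<rightarrow>\<^sub>E carrier K" "V.lincomb (c v) B = v" if "v \<in> carrier V" for v
    using theI'[OF ex[OF that]] by (auto simp: c_def)
  have uniq: "c (V.lincomb a B) b = a b" if a: "a \<in> B \<rightarrow> carrier K" "b \<in> B" for a b
  proof -
    have v: "V.lincomb a B \<in> carrier V" using a BV by (intro V.lincomb_closed)
    have "V.lincomb (restrict a B) B = V.lincomb a B"
      using a BV by (intro V.lincomb_cong) auto
    then have "c (V.lincomb a B) = restrict a B"
      using ex[OF v] c[OF v] a by (metis restrict_PiE)
    then show ?thesis using a by simp
  qed
  have cK: "c v b \<in> carrier K" if "v \<in> carrier V" "b \<in> B" for v b
    using c(1)[OF that(1)] that(2) by auto
  have "lin K V (scalar_module K) (\<lambda>v. c v b)" if b: "b \<in> B" for b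
  proof (rule linI, goal_cases)
    case (1 v)
    then show ?case using cK b by simp
  next
    case (2 v w)
    have "V.lincomb (\<lambda>b. c v b \<oplus>\<^bsub>K\<^esub> c w b) B = v \<oplus>\<^bsub>V\<^esub> w"
      using V.lincomb_sum[OF B(1) BV, of "c v" "c w"] c[OF 2(1)] c[OF 2(2)] by auto
    then show ?case
      using uniq[of "\<lambda>b. c v b \<oplus>\<^bsub>K\<^esub> c w b" b] cK[OF 2(1)] cK[OF 2(2)] b by simp
  next
    case (3 k v)
    have "V.lincomb (\<lambda>b. k \<otimes>\<^bsub>K\<^esub> c v b) B = k \<odot>\<^bsub>V\<^esub> v"
      using V.lincomb_smult[OF BV _ 3(1), of "c v"] c[OF 3(2)] by auto
    then show ?case
      using uniq[of "\<lambda>b. k \<otimes>\<^bsub>K\<^esub> c v b" b] cK[OF 3(2)] 3(1) b by simp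
  qed
  moreover have "v = (\<Oplus>\<^bsub>V\<^esub>b\<in>B. c v b \<odot>\<^bsub>V\<^esub> b)" if "v \<in> carrier V" for v
    using c(2)[OF that] by (simp add: V.lincomb_def)
  ultimately have "dual_basis K V B (\<lambda>b v. c v b)"
    using B(1) BV by (simp add: dual_basis_def)
  then show ?thesis by blast
qed

text \<open>An injective endomorphism maps a basis to a linearly independent set of the same size.\<close>

lemma injective_endo_surjective:
  assumes V: "vectorspace K V" and fin: "vectorspace.fin_dim K V" and T: "lin K V V T"
    and inj: "\<And>v. v \<in> carrier V \<Longrightarrow> T v = \<zero>\<^bsub>V\<^esub> \<Longrightarrow> v = \<zero>\<^bsub>V\<^esub>"
  shows "bij_betw T (carrier V) (carrier V)"
proof -
  interpret V: vectorspace K V by (rule V)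
  interpret T: linear_map K V V T
    by (intro linear_map.intro mod_hom.intro mod_hom_axioms.intro V V.module_axioms T)
  have injT: "inj_on T (carrier V)"
    by (rule T.Ke0_imp_inj) (use inj in \<open>auto simp: T.ker_def\<close>)
  obtain B where B: "finite B" "V.basis B" using V.finite_basis_exists[OF fin] by auto
  then have BV: "B \<subseteq> carrier V" and li: "V.lin_indpt B" by (auto simp: V.basis_def)
  have TB: "T ` B \<subseteq> carrier V" using BV by auto
  have injB: "inj_on T B" using injT BV by (rule inj_on_subset)
  have "V.lin_indpt (T ` B)"
  proof (rule V.finite_lin_indpt2)
    fix a assume a: "a \<in> T ` B \<rightarrow> carrier K" "V.lincomb a (T ` B) = \<zero>\<^bsub>V\<^esub>"
    have aT: "a \<circ> T \<in> B \<rightarrow> carrier K" using a(1) by auto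
    have "T (V.lincomb (a \<circ> T) B) = \<zero>\<^bsub>V\<^esub>"
      using T.lincomb_linear_image[OF injT BV a(1) B(1)] a(2) by simp
    then have "V.lincomb (a \<circ> T) B = \<zero>\<^bsub>V\<^esub>"
      using inj V.lincomb_closed[OF BV aT] by blast
    then show "\<forall>v\<in>T ` B. a v = \<zero>\<^bsub>K\<^esub>"
      using V.not_lindepD[OF li B(1) subset_refl aT] by auto
  qed (use B TB in auto)
  then have "V.basis (T ` B)"
    using B TB V.dim_basis[OF B(1,2)] card_image[OF injB] by (intro V.dim_li_is_basis fin) auto
  then have "carrier V = V.span (T ` B)" by (simp add: V.basis_def)
  also have "\<dots> \<subseteq> T.im"
    using BV by (intro V.span_is_subset T.im_is_submodule) (auto simp: T.im_def)
  finally have "carrier V \<subseteq> T ` carrier V" by (simp add: T.im_def)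
  then show ?thesis using injT by (auto simp: bij_betw_def)
qed

lemma bilinear_flip: "bilinear K A B P f \<Longrightarrow> bilinear K B A P (\<lambda>b a. f a b)"
  by (simp add: bilinear_def)

context hopf
begin

abbreviation "SK \<equiv> scalar_module K"

sublocale SK: module K SK by (rule K_module)

lemmas smultH_bilinear = smult_bilinear[OF H_module]
lemmas smultH_bilinear' = bilinear_flip[OF smultH_bilinear]

lemma SK_sum_closed: "(\<And>j. j \<in> J \<Longrightarrow> f j \<in> carrier K) \<Longrightarrow> (\<Oplus>\<^bsub>SK\<^esub>j\<in>J. f j) \<in> carrier K"
  using SK.M.finsum_closed[of f J] by auto

lemma mulK_bilinear: "bilinear K SK SK SK (\<lambda>c d. c \<otimes>\<^bsub>K\<^esub> d)"
  using smult_bilinear[OF K_module] by simp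

lemma mult_smult_left: "c \<in> carrier K \<Longrightarrow> x \<in> carrier H \<Longrightarrow> y \<in> carrier H \<Longrightarrow>
    (c \<odot> x) \<otimes> y = c \<odot> (x \<otimes> y)"
  and mult_smult_right: "c \<in> carrier K \<Longrightarrow> x \<in> carrier H \<Longrightarrow> y \<in> carrier H \<Longrightarrow>
    x \<otimes> (c \<odot> y) = c \<odot> (x \<otimes> y)"
  using H_algebra by (auto simp: unital_algebra_def)

lemma lin_K: "lin K H SK f \<Longrightarrow> h \<in> carrier H \<Longrightarrow> f h \<in> carrier K"
  using lin_closed by fastforce

lemma lin_K_smult: "lin K H SK f \<Longrightarrow> c \<in> carrier K \<Longrightarrow> h \<in> carrier H \<Longrightarrow> f (c \<odot> h) = c \<otimes>\<^bsub>K\<^esub> f h"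
  using lin_smult[of f K H SK c h] by simp

text \<open>\<open>\<Sum> S\<^sup>2(a\<^sub>2) S(a\<^sub>1) = S(\<Sum> a\<^sub>1 S(a\<^sub>2))\<close>, since \<open>S\<close> reverses products.\<close>

lemma conv_antipode_square:
  assumes "a \<in> carrier H"
  shows "conv H (\<lambda>u s. s \<otimes> u) S (\<lambda>x. S (S x)) a = \<epsilon> a \<odot> \<one>"
proof -
  have "conv H (\<lambda>u s. s \<otimes> u) S (\<lambda>x. S (S x)) a = tensor_lift K H H H (\<lambda>a b. S (a \<otimes> S b)) (\<Delta> a)"
    unfolding conv_def
    by (rule cong_HH[OF H_module _ comult_closed[OF assms]])
      (auto intro!: lin_intros simp: antipode_mult antipode_closed)
  also have "\<dots> = S (tensor_lift K H H H (\<lambda>a b. a \<otimes> S b) (\<Delta> a))"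
    by (rule comp_HH[OF H_module H_module _ antipode_linear comult_closed[OF assms], symmetric])
      (intro lin_intros)
  finally show ?thesis
    by (simp add: antipode_right assms lin_smult[OF antipode_linear] counit_closed antipode_one)
qed

end

locale hopf_dual_basis = hopf K H for K :: "'k ring" and H :: "('k, 'h) hopf" (structure) +
  fixes B :: "'h set" and e :: "'h \<Rightarrow> 'h \<Rightarrow> 'k"
  assumes dual: "dual_basis K H B e"
begin

lemma B_finite: "finite B" and B_closed: "\<And>b. b \<in> B \<Longrightarrow> b \<in> carrier H"
  and e_lin: "\<And>b. b \<in> B \<Longrightarrow> lin K H SK (e b)"
  and e_expand: "\<And>v. v \<in> carrier H \<Longrightarrow> v = (\<Oplus>b\<in>B. e b v \<odot> b)"
  using dual by (auto simp: dual_basis_def)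

lemma e_closed: "b \<in> B \<Longrightarrow> v \<in> carrier H \<Longrightarrow> e b v \<in> carrier K"
  using lin_K[OF e_lin] .

lemma lin_expand:
  assumes "module K P" "lin K H P g" "v \<in> carrier H"
  shows "g v = (\<Oplus>\<^bsub>P\<^esub>b\<in>B. e b v \<odot>\<^bsub>P\<^esub> g b)"
proof -
  interpret P: module K P by fact
  have "g v = g (\<Oplus>b\<in>B. e b v \<odot> b)" using e_expand[OF assms(3)] by simp
  also have "\<dots> = (\<Oplus>\<^bsub>P\<^esub>b\<in>B. g (e b v \<odot> b))"
    using assms B_closed e_closed by (intro lin_finsum[OF H_module assms(1,2) B_finite]) auto
  also have "\<dots> = (\<Oplus>\<^bsub>P\<^esub>b\<in>B. e b v \<odot>\<^bsub>P\<^esub> g b)"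
    using assms B_closed e_closed lin_closed[OF assms(2)]
    by (intro P.finsum_cong') (auto simp: lin_smult[OF assms(2)])
  finally show ?thesis .
qed

lemma functionals_separate:
  assumes "v \<in> carrier H" "w \<in> carrier H" "\<And>q. lin K H SK q \<Longrightarrow> q v = q w"
  shows "v = w"
proof -
  have "v = (\<Oplus>b\<in>B. e b v \<odot> b)" by (rule e_expand[OF assms(1)])
  also have "\<dots> = (\<Oplus>b\<in>B. e b w \<odot> b)"
    using assms(1,2) B_closed e_closed assms(3)[OF e_lin] by (intro HM.finsum_cong') auto
  also have "\<dots> = w" by (rule e_expand[OF assms(2), symmetric])
  finally show ?thesis .
qed

definition trace :: "('h \<Rightarrow> 'h) \<Rightarrow> 'k" where
  "trace T = (\<Oplus>\<^bsub>SK\<^esub>b\<in>B. e b (T b))"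

text \<open>Both traces expand to \<open>\<Sum>\<^sub>b\<^sub>,\<^sub>c e\<^sub>b(T c) e\<^sub>c(U b)\<close>.\<close>

lemma trace_comm:
  assumes T: "lin K H H T" and U: "lin K H H U"
  shows "trace (\<lambda>a. T (U a)) = trace (\<lambda>a. U (T a))"
proof -
  note cl = lin_closed[OF T] lin_closed[OF U] B_closed e_closed
  have expand: "e b (T' (U' b)) = (\<Oplus>\<^bsub>SK\<^esub>c\<in>B. e c (U' b) \<otimes>\<^bsub>K\<^esub> e b (T' c))"
    if "b \<in> B" "lin K H H T'" "lin K H H U'" for b T' U'
    using lin_expand[OF K_module lin_compose[OF e_lin[OF that(1)] that(2)] lin_closed[OF that(3) B_closed[OF that(1)]]]
    by simp
  have "trace (\<lambda>a. T (U a)) = (\<Oplus>\<^bsub>SK\<^esub>b\<in>B. \<Oplus>\<^bsub>SK\<^esub>c\<in>B. e c (U b) \<otimes>\<^bsub>K\<^esub> e b (T c))"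
    unfolding trace_def using cl by (intro SK.finsum_cong') (auto simp: expand T U intro!: SK_sum_closed)
  also have "\<dots> = (\<Oplus>\<^bsub>SK\<^esub>c\<in>B. \<Oplus>\<^bsub>SK\<^esub>b\<in>B. e c (U b) \<otimes>\<^bsub>K\<^esub> e b (T c))"
    using cl by (intro finsum_exchange[OF K_module B_finite B_finite]) auto
  also have "\<dots> = (\<Oplus>\<^bsub>SK\<^esub>c\<in>B. \<Oplus>\<^bsub>SK\<^esub>b\<in>B. e b (T c) \<otimes>\<^bsub>K\<^esub> e c (U b))"
    using cl by (intro SK.finsum_cong') (auto intro!: SK_sum_closed SK.finsum_cong' simp: HM.m_comm)
  also have "\<dots> = trace (\<lambda>a. U (T a))"
    unfolding trace_def using cl by (intro SK.finsum_cong') (auto simp: expand T U intro!: SK_sum_closed)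
  finally show ?thesis .
qed

lemma trace_cong: "(\<And>a. a \<in> carrier H \<Longrightarrow> T a = U a) \<Longrightarrow> (\<And>a. a \<in> carrier H \<Longrightarrow> U a \<in> carrier H) \<Longrightarrow>
    trace T = trace U"
  unfolding trace_def using B_closed e_closed by (intro SK.finsum_cong') auto

lemma trace_closed: "(\<And>a. a \<in> carrier H \<Longrightarrow> T a \<in> carrier H) \<Longrightarrow> trace T \<in> carrier K"
  unfolding trace_def using B_closed e_closed SK.M.finsum_closed[of "\<lambda>b. e b (T b)" B] by auto

lemma trace_finsum:
  assumes J: "finite J" and T: "\<And>j a. j \<in> J \<Longrightarrow> a \<in> carrier H \<Longrightarrow> T j a \<in> carrier H"
  shows "trace (\<lambda>a. \<Oplus>j\<in>J. T j a) = (\<Oplus>\<^bsub>SK\<^esub>j\<in>J. trace (T j))"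
proof -
  have "trace (\<lambda>a. \<Oplus>j\<in>J. T j a) = (\<Oplus>\<^bsub>SK\<^esub>b\<in>B. \<Oplus>\<^bsub>SK\<^esub>j\<in>J. e b (T j b))"
    unfolding trace_def using T B_closed e_closed
    by (intro SK.finsum_cong') (auto intro!: lin_finsum[OF H_module K_module e_lin J] SK_sum_closed)
  also have "\<dots> = (\<Oplus>\<^bsub>SK\<^esub>j\<in>J. \<Oplus>\<^bsub>SK\<^esub>b\<in>B. e b (T j b))"
    using T B_closed e_closed by (intro finsum_exchange[OF K_module B_finite J]) auto
  finally show ?thesis by (simp add: trace_def)
qed

lemma trace_smult:
  assumes "c \<in> carrier K" "\<And>a. a \<in> carrier H \<Longrightarrow> T a \<in> carrier H"
  shows "trace (\<lambda>a. c \<odot> T a) = c \<otimes>\<^bsub>K\<^esub> trace T"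
proof -
  have "trace (\<lambda>a. c \<odot> T a) = (\<Oplus>\<^bsub>SK\<^esub>b\<in>B. c \<otimes>\<^bsub>K\<^esub> e b (T b))"
    unfolding trace_def using assms B_closed e_closed
    by (intro SK.finsum_cong') (auto simp: lin_K_smult[OF e_lin])
  also have "\<dots> = c \<otimes>\<^bsub>K\<^esub> trace T"
    unfolding trace_def using SK.finsum_smult_ldistr[OF B_finite assms(1), of "\<lambda>b. e b (T b)"]
      assms B_closed e_closed by auto
  finally show ?thesis .
qed

lemma trace_lift:
  assumes F: "\<And>a. a \<in> carrier H \<Longrightarrow> bilinear K H H H (\<lambda>x y. F x y a)" and t: "t \<in> carrier HH"
  shows "trace (\<lambda>a. tensor_lift K H H H (\<lambda>x y. F x y a) t) = tensor_lift K H H SK (\<lambda>x y. trace (F x y)) t"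
proof -
  have b: "bilinear K H H SK (\<lambda>x y. e b (F x y b))" if "b \<in> B" for b
    by (intro bilinearI lin_compose[OF e_lin[OF that]] bilinear_left[OF F[OF B_closed[OF that]]]
        bilinear_right[OF F[OF B_closed[OF that]]])
  have "trace (\<lambda>a. tensor_lift K H H H (\<lambda>x y. F x y a) t) = (\<Oplus>\<^bsub>SK\<^esub>b\<in>B. tensor_lift K H H SK (\<lambda>x y. e b (F x y b)) t)"
    unfolding trace_def
  proof (rule SK.finsum_cong'[OF refl])
    show "(\<lambda>b. tensor_lift K H H SK (\<lambda>x y. e b (F x y b)) t) \<in> B \<rightarrow> carrier SK"
      using lift_closed[OF H_module H_module K_module b t] by auto
    show "e b (tensor_lift K H H H (\<lambda>x y. F x y b) t) = tensor_lift K H H SK (\<lambda>x y. e b (F x y b)) t" if "b \<in> B" for b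
      by (rule comp_HH[OF H_module K_module F[OF B_closed[OF that]] e_lin[OF that] t])
  qed
  also have "\<dots> = tensor_lift K H H SK (\<lambda>x y. trace (F x y)) t"
    unfolding trace_def by (rule lift_finsum[OF H_module H_module K_module B_finite b t, symmetric])
  finally show ?thesis .
qed

text \<open>The operator \<open>y \<mapsto> \<Sum> f(y\<^sub>1) y\<^sub>2\<close>.  Such operators compose like the functionals in the dual algebra
  of \<open>H\<close>.\<close>

definition slice :: "('h \<Rightarrow> 'k) \<Rightarrow> 'h \<Rightarrow> 'h" where
  "slice f = conv H (\<lambda>c y. c \<odot> y) f idH"

lemma slice_linear: "lin K H SK f \<Longrightarrow> lin K H H (slice f)"
  unfolding slice_def by (rule conv_linear[OF H_module smultH_bilinear _ lin_id])

lemma slice_slice: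
  assumes f: "lin K H SK f" and g: "lin K H SK g" and y: "y \<in> carrier H"
  shows "slice g (slice f y) = slice (conv SK (\<lambda>c d. c \<otimes>\<^bsub>K\<^esub> d) f g) y"
proof -
  have "slice g (slice f y) = conv H (\<lambda>a b. slice g (a \<odot> b)) f idH y"
    unfolding slice_def[of f]
    by (rule conv_lin_comp[OF H_module H_module smultH_bilinear f lin_id slice_linear[OF g] y])
  also have "\<dots> = conv H (\<lambda>c y. c \<odot> y) f (slice g) y"
    unfolding conv_def
    by (rule cong_HH[OF H_module conv_bilinear[OF smultH_bilinear f slice_linear[OF g]] comult_closed[OF y]])
      (simp add: lin_smult[OF slice_linear[OF g]] lin_K[OF f])
  also have "\<dots> = slice (conv SK (\<lambda>c d. c \<otimes>\<^bsub>K\<^esub> d) f g) y"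
    unfolding slice_def
    by (rule conv_assoc[OF K_module H_module H_module mulK_bilinear smultH_bilinear smultH_bilinear smultH_bilinear
          _ f g lin_id y, symmetric]) (simp add: HM.smult_assoc1)
  finally show ?thesis .
qed

text \<open>A sum of composites of slices depends on the tensor \<open>\<Sum>\<^sub>j f\<^sub>j \<otimes> g\<^sub>j\<close> only, here given as the bilinear
  form \<open>\<beta>\<close>.\<close>

lemma slice_sum:
  assumes f: "\<And>j. j \<in> B \<Longrightarrow> lin K H SK (f j)" and g: "\<And>j. j \<in> B \<Longrightarrow> lin K H SK (g j)"
    and \<beta>: "bilinear K H H SK \<beta>" "\<And>u v. u \<in> carrier H \<Longrightarrow> v \<in> carrier H \<Longrightarrow>
      (\<Oplus>\<^bsub>SK\<^esub>j\<in>B. f j u \<otimes>\<^bsub>K\<^esub> g j v) = \<beta> u v"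
    and y: "y \<in> carrier H"
  shows "(\<Oplus>j\<in>B. slice (g j) (slice (f j) y)) = slice (\<lambda>a. tensor_lift K H H SK \<beta> (\<Delta> a)) y"
proof -
  let ?c = "\<lambda>j. conv SK (\<lambda>c d. c \<otimes>\<^bsub>K\<^esub> d) (f j) (g j)"
  have lc: "lin K H SK (?c j)" if "j \<in> B" for j
    by (rule conv_linear[OF K_module mulK_bilinear f[OF that] g[OF that]])
  have sum: "(\<Oplus>\<^bsub>SK\<^esub>j\<in>B. ?c j a) = tensor_lift K H H SK \<beta> (\<Delta> a)" if a: "a \<in> carrier H" for a
  proof -
    have "(\<Oplus>\<^bsub>SK\<^esub>j\<in>B. ?c j a) = tensor_lift K H H SK (\<lambda>u v. \<Oplus>\<^bsub>SK\<^esub>j\<in>B. f j u \<otimes>\<^bsub>K\<^esub> g j v) (\<Delta> a)"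
      unfolding conv_def
      by (rule lift_finsum[OF H_module H_module K_module B_finite conv_bilinear[OF mulK_bilinear f g] comult_closed[OF a], symmetric])
    also have "\<dots> = tensor_lift K H H SK \<beta> (\<Delta> a)"
      by (rule cong_HH[OF K_module \<beta>(1) comult_closed[OF a] \<beta>(2)])
    finally show ?thesis .
  qed
  have l: "lin K H SK (\<lambda>a. tensor_lift K H H SK \<beta> (\<Delta> a))" by (intro lin_intros \<beta>(1))
  have "(\<Oplus>j\<in>B. slice (g j) (slice (f j) y)) = (\<Oplus>j\<in>B. slice (?c j) y)"
    using lin_closed[OF slice_linear[OF lc] y] by (intro HM.finsum_cong') (auto simp: slice_slice f g y)
  also have "\<dots> = tensor_lift K H H H (\<lambda>a b. \<Oplus>j\<in>B. ?c j a \<odot> b) (\<Delta> y)"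
    unfolding slice_def conv_def[of H]
    by (rule lift_finsum[OF H_module H_module H_module B_finite conv_bilinear[OF smultH_bilinear lc lin_id] comult_closed[OF y], symmetric])
  also have "\<dots> = slice (\<lambda>a. tensor_lift K H H SK \<beta> (\<Delta> a)) y"
    unfolding slice_def conv_def[of H]
  proof (rule cong_HH[OF H_module conv_bilinear[OF smultH_bilinear l lin_id] comult_closed[OF y]])
    fix a b assume ab: "a \<in> carrier H" "b \<in> carrier H"
    have "(\<Oplus>\<^bsub>SK\<^esub>j\<in>B. ?c j a) \<odot> b = (\<Oplus>j\<in>B. ?c j a \<odot> b)"
      using lin_closed[OF lc ab(1)]
      by (intro lin_finsum[OF K_module H_module bilinear_left[OF smultH_bilinear ab(2)] B_finite])
    then show "(\<Oplus>j\<in>B. ?c j a \<odot> b) = tensor_lift K H H SK \<beta> (\<Delta> a) \<odot> b"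
      by (simp add: sum ab)
  qed
  finally show ?thesis .
qed

text \<open>The map \<open>a \<mapsto> \<Sum> p(a\<^sub>2) S\<^sup>2(a\<^sub>1)\<close>\<close>

definition twist :: "('h \<Rightarrow> 'k) \<Rightarrow> 'h \<Rightarrow> 'h" where
  "twist p = conv H (\<lambda>u s. s \<odot> u) (\<lambda>x. S (S x)) p"

text \<open>The trace formula for an integral, which produces one for every functional \<open>p\<close>.\<close>

definition integral :: "('h \<Rightarrow> 'k) \<Rightarrow> 'h \<Rightarrow> 'k" where
  "integral p x = trace (\<lambda>a. x \<otimes> twist p a)"

lemma lin_SS: "lin K H H (\<lambda>x. S (S x))"
  by (intro lin_intros)

lemma twist_linear: "lin K H SK p \<Longrightarrow> lin K H H (twist p)"
  unfolding twist_def by (rule conv_linear[OF H_module smultH_bilinear' lin_SS])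

lemma twist_closed: "lin K H SK p \<Longrightarrow> a \<in> carrier H \<Longrightarrow> twist p a \<in> carrier H"
  using lin_closed[OF twist_linear] .

lemma integral_linear:
  assumes p: "lin K H SK p"
  shows "lin K H SK (integral p)"
  unfolding integral_def trace_def
  by (intro lin_finsum_fun H_module K_module B_finite lin_compose[OF e_lin] lin_intros
      twist_closed[OF p] B_closed)

lemma slice_mult_bilinear:
  assumes q: "lin K H SK q"
  shows "bilinear K H H H (\<lambda>u w. slice (\<lambda>y. q (y \<otimes> u)) w)"
  unfolding slice_def conv_def by (intro lin_intros lin_compose[OF q] lin_K[OF q])

lemma translate_bilinear:
  assumes q: "lin K H SK q" and z: "z \<in> carrier H"
  shows "bilinear K H H H (\<lambda>x1 x2. q x1 \<odot> (x2 \<otimes> z))"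
  by (intro lin_intros z q lin_K[OF q])

text \<open>In \<open>\<Sum> q(x\<^sub>1 S\<^sup>2(a\<^sub>2) S(a\<^sub>1)) x\<^sub>2 S\<^sup>2(a\<^sub>3)\<close> the factors \<open>S\<^sup>2(a\<^sub>2) S(a\<^sub>1)\<close> cancel.\<close>

lemma slice_antipode_square:
  assumes q: "lin K H SK q" and x: "x \<in> carrier H" and a: "a \<in> carrier H"
  shows "conv H (\<lambda>u z. slice (\<lambda>y. q (y \<otimes> u)) (x \<otimes> z)) S (\<lambda>c. S (S c)) a =
    tensor_lift K H H H (\<lambda>x1 x2. q x1 \<odot> (x2 \<otimes> S (S a))) (\<Delta> x)"
proof -
  let ?Q = "\<lambda>x1 x2 u c1 c2. q ((x1 \<otimes> S (S c1)) \<otimes> S u) \<odot> (x2 \<otimes> S (S c2))"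
  note li = lin_intros lin_compose[OF q] lin_K[OF q] q
  have val: "slice (\<lambda>y. q (y \<otimes> S u)) (x \<otimes> S (S c)) =
    tensor_lift K H H H (\<lambda>x1 x2. tensor_lift K H H H (?Q x1 x2 u) (\<Delta> c)) (\<Delta> x)"
    if uc: "u \<in> carrier H" "c \<in> carrier H" for u c
  proof -
    have b: "bilinear K H H H (\<lambda>y1 y2. q (y1 \<otimes> S u) \<odot> y2)" by (intro li uc)
    have "slice (\<lambda>y. q (y \<otimes> S u)) (x \<otimes> S (S c)) =
      tensor_lift K H H H (\<lambda>x1 x2. tensor_lift K H H H (\<lambda>z1 z2.
        q ((x1 \<otimes> z1) \<otimes> S u) \<odot> (x2 \<otimes> z2)) (\<Delta> (S (S c)))) (\<Delta> x)"
      unfolding slice_def conv_def using x uc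
      by (simp add: comult_mult antipode_closed lift_tensor_mult[OF H_algebra H_algebra H_module b] comult_closed)
    also have "\<dots> = tensor_lift K H H H (\<lambda>x1 x2. tensor_lift K H H H (?Q x1 x2 u) (\<Delta> c)) (\<Delta> x)"
    proof (rule cong_HH[OF H_module _ comult_closed[OF x]])
      show "bilinear K H H H (\<lambda>x1 x2. tensor_lift K H H H (?Q x1 x2 u) (\<Delta> c))"
        by (intro li uc)
      fix x1 x2 assume x12: "x1 \<in> carrier H" "x2 \<in> carrier H"
      have b1: "bilinear K H H H (\<lambda>z1 z2. q ((x1 \<otimes> z1) \<otimes> S u) \<odot> (x2 \<otimes> z2))"
        by (intro li uc x12)
      have b2: "bilinear K H H H (\<lambda>a b. q ((x1 \<otimes> S b) \<otimes> S u) \<odot> (x2 \<otimes> S a))"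
        by (intro li uc x12)
      show "tensor_lift K H H H (\<lambda>z1 z2. q ((x1 \<otimes> z1) \<otimes> S u) \<odot> (x2 \<otimes> z2)) (\<Delta> (S (S c))) =
        tensor_lift K H H H (?Q x1 x2 u) (\<Delta> c)"
        by (simp add: lift_comult_antipode[OF H_module b1 antipode_closed[OF uc(2)]]
            lift_comult_antipode[OF H_module b2 uc(2)])
    qed
    finally show ?thesis .
  qed
  have inner: "tensor_lift K H H H (\<lambda>u c. tensor_lift K H H H (?Q x1 x2 u) (\<Delta> c)) (\<Delta> a) =
    q x1 \<odot> (x2 \<otimes> S (S a))" if x12: "x1 \<in> carrier H" "x2 \<in> carrier H" for x1 x2
  proof -
    have tri: "trilinear K H H H H (?Q x1 x2)"
      by (intro li x12)
    have "tensor_lift K H H H (\<lambda>u c. tensor_lift K H H H (?Q x1 x2 u) (\<Delta> c)) (\<Delta> a) =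
      tensor_lift K H H H (\<lambda>a' c2. tensor_lift K H H H (\<lambda>u c1. ?Q x1 x2 u c1 c2) (\<Delta> a')) (\<Delta> a)"
      by (rule coassoc[OF a H_module tri, symmetric])
    also have "\<dots> = conv H (\<lambda>c y. c \<odot> y) (\<lambda>a'. \<epsilon> a' \<odot>\<^bsub>SK\<^esub> q x1) (\<lambda>c2. x2 \<otimes> S (S c2)) a"
      unfolding conv_def
    proof (rule cong_HH[OF H_module _ comult_closed[OF a]])
      show "bilinear K H H H (\<lambda>a b. (\<epsilon> a \<odot>\<^bsub>SK\<^esub> q x1) \<odot> (x2 \<otimes> S (S b)))"
        using lin_K[OF q x12(1)] by (intro conv_bilinear[OF smultH_bilinear] lin_intros counit_linear x12) simp
      fix a' c2 assume ac: "a' \<in> carrier H" "c2 \<in> carrier H"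
      let ?w = "x2 \<otimes> S (S c2)"
      have w: "?w \<in> carrier H" using x12 ac by (simp add: antipode_closed)
      have l: "lin K H H (\<lambda>h. q (x1 \<otimes> h) \<odot> ?w)" by (intro li x12 ac)
      have b3: "bilinear K H H H (\<lambda>u c1. S (S c1) \<otimes> S u)" by (intro li)
      have "tensor_lift K H H H (\<lambda>u c1. ?Q x1 x2 u c1 c2) (\<Delta> a') =
        tensor_lift K H H H (\<lambda>u c1. q (x1 \<otimes> (S (S c1) \<otimes> S u)) \<odot> ?w) (\<Delta> a')"
        by (rule cong_HH[OF H_module _ comult_closed[OF ac(1)]])
          ((intro li x12 ac; assumption)+, simp add: H.m_assoc x12 antipode_closed)
      also have "\<dots> = q (x1 \<otimes> conv H (\<lambda>u s. s \<otimes> u) S (\<lambda>x. S (S x)) a') \<odot> ?w"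
        unfolding conv_def
        by (rule comp_HH[OF H_module H_module b3 l comult_closed[OF ac(1)], symmetric])
      also have "\<dots> = (\<epsilon> a' \<odot>\<^bsub>SK\<^esub> q x1) \<odot> ?w"
        by (simp add: conv_antipode_square ac x12 counit_closed mult_smult_right lin_K_smult[OF q])
      finally show "tensor_lift K H H H (\<lambda>u c1. ?Q x1 x2 u c1 c2) (\<Delta> a') = (\<epsilon> a' \<odot>\<^bsub>SK\<^esub> q x1) \<odot> ?w" .
    qed
    also have "\<dots> = q x1 \<odot> (x2 \<otimes> S (S a))"
      by (rule conv_unit_left[OF K_module H_module smultH_bilinear _ _ a])
        (use x12 lin_K[OF q] in \<open>auto intro!: lin_intros\<close>)
    finally show ?thesis .
  qed
  have "conv H (\<lambda>u z. slice (\<lambda>y. q (y \<otimes> u)) (x \<otimes> z)) S (\<lambda>c. S (S c)) a =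
    tensor_lift K H H H (\<lambda>u c. tensor_lift K H H H (\<lambda>x1 x2. tensor_lift K H H H (?Q x1 x2 u) (\<Delta> c)) (\<Delta> x)) (\<Delta> a)"
    unfolding conv_def
    by (rule cong_HH[OF H_module _ comult_closed[OF a] val]) (intro li x)
  also have "\<dots> = tensor_lift K H H H (\<lambda>x1 x2. tensor_lift K H H H (\<lambda>u c. tensor_lift K H H H (?Q x1 x2 u) (\<Delta> c)) (\<Delta> a)) (\<Delta> x)"
    by (intro lift_swap H_module comult_closed a x li)
  also have "\<dots> = tensor_lift K H H H (\<lambda>x1 x2. q x1 \<odot> (x2 \<otimes> S (S a))) (\<Delta> x)"
    by (rule cong_HH[OF H_module translate_bilinear[OF q] comult_closed[OF x] inner])
      (intro antipode_closed a)
  finally show ?thesis .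
qed

text \<open>Write \<open>L\<close> for left multiplication by \<open>x\<close> and \<open>U\<close> for the twist by \<open>p\<close>.  With
  \<open>W\<^sub>j(y) = \<Sum> q(y\<^sub>1 j) y\<^sub>2\<close> and \<open>V\<^sub>j(y) = \<Sum> e\<^sub>j(S(y\<^sub>1)) y\<^sub>2\<close>, the operator \<open>a \<mapsto> \<Sum> q(x\<^sub>1) x\<^sub>2 U(a)\<close> is
  \<open>\<Sum>\<^sub>j W\<^sub>j L U V\<^sub>j\<close>: this is the preceding lemma after expanding \<open>S(a\<^sub>1)\<close> in the basis.\<close>

lemma translate_twist:
  assumes q: "lin K H SK q" and p: "lin K H SK p" and x: "x \<in> carrier H" and a: "a \<in> carrier H"
  shows "tensor_lift K H H H (\<lambda>x1 x2. q x1 \<odot> (x2 \<otimes> twist p a)) (\<Delta> x) =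
    (\<Oplus>j\<in>B. slice (\<lambda>y. q (y \<otimes> j)) (x \<otimes> twist p (slice (\<lambda>y. e j (S y)) a)))"
proof -
  let ?\<nu> = "\<lambda>u z. slice (\<lambda>y. q (y \<otimes> u)) (x \<otimes> z)"
  let ?R = "\<lambda>z. tensor_lift K H H H (\<lambda>x1 x2. q x1 \<odot> (x2 \<otimes> z)) (\<Delta> x)"
  note li = lin_intros lin_compose[OF q] lin_K[OF q] q
  note sb = slice_mult_bilinear[OF q]
  have b\<nu>: "bilinear K H H H ?\<nu>"
    by (intro bilinearI lin_compose[OF bilinear_right[OF sb]] bilinear_left[OF sb] lin_intros x)
  have lR: "lin K H H ?R" by (intro li x)
  have lg: "lin K H SK (\<lambda>y. e j (S y))" if "j \<in> B" for j
    by (intro lin_compose[OF e_lin[OF that]] lin_intros)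
  have lG: "lin K H H (\<lambda>z. ?\<nu> j (twist p z))" if "j \<in> carrier H" for j
    by (rule lin_compose[OF bilinear_right[OF b\<nu> that] twist_linear[OF p]])
  have "?R (twist p a) = conv H (\<lambda>u s. ?R (s \<odot> u)) (\<lambda>x. S (S x)) p a"
    unfolding twist_def by (rule conv_lin_comp[OF H_module H_module smultH_bilinear' lin_SS p lR a])
  also have "\<dots> = conv H (\<lambda>u s. s \<odot> u) (\<lambda>x. ?R (S (S x))) p a"
    unfolding conv_def
    by (rule cong_HH[OF H_module conv_bilinear[OF smultH_bilinear' lin_compose[OF lR lin_SS] p] comult_closed[OF a]])
      (simp add: lin_smult[OF lR] lin_K[OF p] antipode_closed)
  also have "\<dots> = conv H (\<lambda>u s. s \<odot> u) (conv H ?\<nu> S (\<lambda>x. S (S x))) p a"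
    by (rule conv_cong[OF H_module smultH_bilinear' conv_linear[OF H_module b\<nu> antipode_linear lin_SS] p a])
      (simp_all add: slice_antipode_square[OF q x])
  also have "\<dots> = conv H ?\<nu> S (twist p) a"
    unfolding twist_def
    by (rule conv_assoc[OF H_module H_module H_module b\<nu> smultH_bilinear' smultH_bilinear' b\<nu> _
          antipode_linear lin_SS p a]) (simp add: lin_smult[OF bilinear_right[OF b\<nu>]])
  also have "\<dots> = tensor_lift K H H H (\<lambda>u z. \<Oplus>j\<in>B. e j (S u) \<odot> ?\<nu> j (twist p z)) (\<Delta> a)"
    unfolding conv_def
  proof (rule cong_HH[OF H_module _ comult_closed[OF a]])
    show "bilinear K H H H (\<lambda>u z. \<Oplus>j\<in>B. e j (S u) \<odot> ?\<nu> j (twist p z))"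
      by (intro lin_finsum_bilinear H_module B_finite conv_bilinear[OF smultH_bilinear] lg lG B_closed)
    show "?\<nu> (S u) (twist p z) = (\<Oplus>j\<in>B. e j (S u) \<odot> ?\<nu> j (twist p z))"
      if "u \<in> carrier H" "z \<in> carrier H" for u z
      using lin_expand[OF H_module bilinear_left[OF b\<nu> twist_closed[OF p that(2)]] antipode_closed[OF that(1)]] .
  qed
  also have "\<dots> = (\<Oplus>j\<in>B. tensor_lift K H H H (\<lambda>u z. e j (S u) \<odot> ?\<nu> j (twist p z)) (\<Delta> a))"
    by (intro lift_finsum H_module B_finite conv_bilinear[OF smultH_bilinear] lg lG B_closed comult_closed a)
  also have "\<dots> = (\<Oplus>j\<in>B. ?\<nu> j (twist p (slice (\<lambda>y. e j (S y)) a)))"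
  proof (rule HM.finsum_cong'[OF refl])
    show "(\<lambda>j. ?\<nu> j (twist p (slice (\<lambda>y. e j (S y)) a))) \<in> B \<rightarrow> carrier H"
      using lin_closed[OF lG[OF B_closed] lin_closed[OF slice_linear[OF lg] a]] by auto
    fix j assume j: "j \<in> B"
    have "?\<nu> j (twist p (slice (\<lambda>y. e j (S y)) a)) =
      conv H (\<lambda>c y. ?\<nu> j (twist p (c \<odot> y))) (\<lambda>y. e j (S y)) idH a"
      unfolding slice_def[of "\<lambda>y. e j (S y)"]
      by (rule conv_lin_comp[OF H_module H_module smultH_bilinear lg[OF j] lin_id lG[OF B_closed[OF j]] a])
    also have "\<dots> = tensor_lift K H H H (\<lambda>u z. e j (S u) \<odot> ?\<nu> j (twist p z)) (\<Delta> a)"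
      unfolding conv_def
      by (rule cong_HH[OF H_module conv_bilinear[OF smultH_bilinear lg[OF j] lG[OF B_closed[OF j]]] comult_closed[OF a]])
        (simp add: lin_smult[OF lG[OF B_closed[OF j]]] lin_K[OF lg[OF j]])
    finally show "tensor_lift K H H H (\<lambda>u z. e j (S u) \<odot> ?\<nu> j (twist p z)) (\<Delta> a) =
      ?\<nu> j (twist p (slice (\<lambda>y. e j (S y)) a))" ..
  qed
  finally show ?thesis .
qed

text \<open>Composed in the opposite order, the operators \<open>W\<^sub>j\<close> and \<open>V\<^sub>j\<close> give
  \<open>\<Sum>\<^sub>j V\<^sub>j W\<^sub>j(y) = \<Sum> q(y\<^sub>1 S(y\<^sub>2)) y\<^sub>3 = q(1) y\<close>.\<close>

lemma slice_inverse:
  assumes q: "lin K H SK q" and y: "y \<in> carrier H"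
  shows "(\<Oplus>j\<in>B. slice (\<lambda>y. e j (S y)) (slice (\<lambda>y. q (y \<otimes> j)) y)) = q \<one> \<odot> y"
proof -
  have b: "bilinear K H H SK (\<lambda>u v. q (u \<otimes> S v))" by (intro lin_intros lin_compose[OF q])
  have "(\<Oplus>j\<in>B. slice (\<lambda>y. e j (S y)) (slice (\<lambda>y. q (y \<otimes> j)) y)) =
    slice (\<lambda>a. tensor_lift K H H SK (\<lambda>u v. q (u \<otimes> S v)) (\<Delta> a)) y"
  proof (rule slice_sum[OF _ _ b _ y])
    fix u v assume uv: "u \<in> carrier H" "v \<in> carrier H"
    have "lin K H SK (\<lambda>w. q (u \<otimes> w))" by (intro lin_compose[OF q] lin_intros uv)
    from lin_expand[OF K_module this antipode_closed[OF uv(2)]]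
    have "q (u \<otimes> S v) = (\<Oplus>\<^bsub>SK\<^esub>j\<in>B. e j (S v) \<otimes>\<^bsub>K\<^esub> q (u \<otimes> j))" by simp
    also have "\<dots> = (\<Oplus>\<^bsub>SK\<^esub>j\<in>B. q (u \<otimes> j) \<otimes>\<^bsub>K\<^esub> e j (S v))"
      using uv B_closed by (intro SK.finsum_cong') (auto simp: HM.m_comm e_closed antipode_closed lin_K[OF q])
    finally show "(\<Oplus>\<^bsub>SK\<^esub>j\<in>B. q (u \<otimes> j) \<otimes>\<^bsub>K\<^esub> e j (S v)) = q (u \<otimes> S v)" ..
  qed (intro lin_compose[OF q] lin_compose[OF e_lin] lin_intros B_closed; assumption)+
  also have "\<dots> = conv H (\<lambda>c y. c \<odot> y) (\<lambda>a. \<epsilon> a \<odot>\<^bsub>SK\<^esub> q \<one>) idH y"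
    unfolding slice_def
  proof (rule conv_cong[OF H_module smultH_bilinear _ lin_id y])
    show "lin K H SK (\<lambda>a. \<epsilon> a \<odot>\<^bsub>SK\<^esub> q \<one>)"
      using lin_K[OF q] by (intro lin_intros counit_linear) auto
    fix a assume a: "a \<in> carrier H"
    have bs: "bilinear K H H H (\<lambda>u v. u \<otimes> S v)" by (intro lin_intros)
    have "tensor_lift K H H SK (\<lambda>u v. q (u \<otimes> S v)) (\<Delta> a) = q (tensor_lift K H H H (\<lambda>u v. u \<otimes> S v) (\<Delta> a))"
      by (rule comp_HH[OF H_module K_module bs q comult_closed[OF a], symmetric])
    then show "tensor_lift K H H SK (\<lambda>u v. q (u \<otimes> S v)) (\<Delta> a) = \<epsilon> a \<odot>\<^bsub>SK\<^esub> q \<one>"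
      by (simp add: antipode_right a lin_K_smult[OF q] counit_closed)
  qed simp
  also have "\<dots> = q \<one> \<odot> y"
    by (rule conv_unit_left[OF K_module H_module smultH_bilinear lin_id _ y]) (simp add: lin_K[OF q])
  finally show ?thesis .
qed

text \<open>Under the trace, cyclicity moves the operator \<open>W\<^sub>j\<close> from the front of \<open>W\<^sub>j L U V\<^sub>j\<close> to its end, where it
  meets \<open>V\<^sub>j\<close>.\<close>

lemma integral_invariant_functional:
  assumes q: "lin K H SK q" and p: "lin K H SK p" and x: "x \<in> carrier H"
  shows "tensor_lift K H H SK (\<lambda>x1 x2. q x1 \<otimes>\<^bsub>K\<^esub> integral p x2) (\<Delta> x) = q \<one> \<otimes>\<^bsub>K\<^esub> integral p x"
proof -
  let ?W = "\<lambda>j. slice (\<lambda>y. q (y \<otimes> j))" and ?V = "\<lambda>j. slice (\<lambda>y. e j (S y))"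
  let ?L = "\<lambda>z. x \<otimes> twist p z"
  have lW: "lin K H H (?W j)" if "j \<in> B" for j
    by (intro slice_linear lin_compose[OF q] lin_intros B_closed that)
  have lV: "lin K H H (?V j)" if "j \<in> B" for j
    by (intro slice_linear lin_compose[OF e_lin] lin_intros that)
  have lL: "lin K H H ?L"
    by (intro lin_mult_right H_algebra x twist_linear p)
  note cl = lin_closed[OF lW] lin_closed[OF lV] lin_closed[OF lL]
  have "tensor_lift K H H SK (\<lambda>x1 x2. q x1 \<otimes>\<^bsub>K\<^esub> integral p x2) (\<Delta> x) =
    tensor_lift K H H SK (\<lambda>x1 x2. trace (\<lambda>a. q x1 \<odot> (x2 \<otimes> twist p a))) (\<Delta> x)"
    by (rule cong_HH[OF K_module _ comult_closed[OF x], symmetric])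
      (use conv_bilinear[OF mulK_bilinear q integral_linear[OF p]] in
        \<open>simp_all add: integral_def trace_smult lin_K[OF q] twist_closed[OF p]\<close>)
  also have "\<dots> = trace (\<lambda>a. tensor_lift K H H H (\<lambda>x1 x2. q x1 \<odot> (x2 \<otimes> twist p a)) (\<Delta> x))"
    by (rule trace_lift[OF translate_bilinear[OF q twist_closed[OF p]] comult_closed[OF x], symmetric])
  also have "\<dots> = trace (\<lambda>a. \<Oplus>j\<in>B. ?W j (?L (?V j a)))"
    by (rule trace_cong) (auto simp: translate_twist[OF q p x] intro!: HM.finsum_closed cl)
  also have "\<dots> = (\<Oplus>\<^bsub>SK\<^esub>j\<in>B. trace (\<lambda>a. ?W j (?L (?V j a))))"
    by (rule trace_finsum[OF B_finite]) (intro cl)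
  also have "\<dots> = (\<Oplus>\<^bsub>SK\<^esub>j\<in>B. trace (\<lambda>a. ?L (?V j (?W j a))))"
    by (rule SK.finsum_cong'[OF refl])
      (auto intro!: trace_closed cl trace_comm lW lin_compose[OF lL lV])
  also have "\<dots> = trace (\<lambda>a. \<Oplus>j\<in>B. ?L (?V j (?W j a)))"
    by (rule trace_finsum[OF B_finite, symmetric]) (intro cl)
  also have "\<dots> = trace (\<lambda>a. q \<one> \<odot> ?L a)"
  proof (rule trace_cong)
    fix a assume a: "a \<in> carrier H"
    have "(\<Oplus>j\<in>B. ?L (?V j (?W j a))) = ?L (\<Oplus>j\<in>B. ?V j (?W j a))"
      by (rule lin_finsum[OF H_module H_module lL B_finite, symmetric]) (intro cl a)
    then show "(\<Oplus>j\<in>B. ?L (?V j (?W j a))) = q \<one> \<odot> ?L a"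
      by (simp add: slice_inverse[OF q a] lin_smult[OF lL] lin_K[OF q] a)
  qed (auto intro!: cl lin_K[OF q])
  also have "\<dots> = q \<one> \<otimes>\<^bsub>K\<^esub> integral p x"
    unfolding integral_def by (rule trace_smult) (auto intro!: cl lin_K[OF q])
  finally show ?thesis .
qed

lemma integral_invariant:
  assumes p: "lin K H SK p" and x: "x \<in> carrier H"
  shows "tensor_lift K H H H (\<lambda>x1 x2. integral p x2 \<odot> x1) (\<Delta> x) = integral p x \<odot> \<one>"
proof (rule functionals_separate)
  note I = integral_linear[OF p]
  have b: "bilinear K H H H (\<lambda>x1 x2. integral p x2 \<odot> x1)"
    by (intro lin_intros I lin_K[OF I])
  show "tensor_lift K H H H (\<lambda>x1 x2. integral p x2 \<odot> x1) (\<Delta> x) \<in> carrier H"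
    by (intro lift_closed H_module b comult_closed x)
  show "integral p x \<odot> \<one> \<in> carrier H" using lin_K[OF I x] by simp
  fix q assume q: "lin K H SK q"
  have "q (tensor_lift K H H H (\<lambda>x1 x2. integral p x2 \<odot> x1) (\<Delta> x)) =
    tensor_lift K H H SK (\<lambda>x1 x2. q (integral p x2 \<odot> x1)) (\<Delta> x)"
    by (rule comp_HH[OF H_module K_module b q comult_closed[OF x]])
  also have "\<dots> = tensor_lift K H H SK (\<lambda>x1 x2. q x1 \<otimes>\<^bsub>K\<^esub> integral p x2) (\<Delta> x)"
    by (rule cong_HH[OF K_module conv_bilinear[OF mulK_bilinear q I] comult_closed[OF x]])
      (simp add: lin_K_smult[OF q] lin_K[OF I] lin_K[OF q] HM.m_comm)
  also have "\<dots> = q (integral p x \<odot> \<one>)"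
    by (simp add: integral_invariant_functional[OF q p x] lin_K_smult[OF q] lin_K[OF I] lin_K[OF q] x HM.m_comm)
  finally show "q (tensor_lift K H H H (\<lambda>x1 x2. integral p x2 \<odot> x1) (\<Delta> x)) =
    q (integral p x \<odot> \<one>)" .
qed

text \<open>Invariance of \<open>\<lambda>\<close> at \<open>x S(h\<^sub>1)\<close> rewrites \<open>\<Sum> \<lambda>(x S(h\<^sub>1)) h\<^sub>2\<close> as
  \<open>\<Sum> \<lambda>(x\<^sub>2 S(h\<^sub>1)) x\<^sub>1 S(h\<^sub>2) h\<^sub>3\<close>, in which the last two factors cancel.\<close>

lemma slice_integral_antipode:
  assumes p: "lin K H SK p" and x: "x \<in> carrier H" and h: "h \<in> carrier H"
  shows "slice (\<lambda>a. integral p (x \<otimes> S a)) h =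
    tensor_lift K H H H (\<lambda>x1 x2. integral p (x2 \<otimes> S h) \<odot> x1) (\<Delta> x)"
proof -
  let ?I = "integral p"
  note I = integral_linear[OF p]
  note li = lin_intros lin_compose[OF I] lin_K[OF I] I
  let ?C = "\<lambda>x1 x2. conv H (\<lambda>c y. c \<odot> y) (\<lambda>a. ?I (x2 \<otimes> S a)) (\<lambda>a. x1 \<otimes> S a)"
  have lC: "lin K H H (?C x1 x2)" if "x1 \<in> carrier H" "x2 \<in> carrier H" for x1 x2
    by (intro conv_linear[OF H_module smultH_bilinear] li that)
  have bC: "bilinear K H H H (\<lambda>x1 x2. ?C x1 x2 a)" if "a \<in> carrier H" for a
    unfolding conv_def by (intro li that)
  have \<Gamma>: "?I (x \<otimes> S a) \<odot> \<one> = tensor_lift K H H H (\<lambda>x1 x2. ?C x1 x2 a) (\<Delta> x)"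
    if a: "a \<in> carrier H" for a
  proof -
    have b: "bilinear K H H H (\<lambda>y1 y2. ?I y2 \<odot> y1)" by (intro li)
    have "?I (x \<otimes> S a) \<odot> \<one> = tensor_lift K H H H (\<lambda>y1 y2. ?I y2 \<odot> y1) (\<Delta> (x \<otimes> S a))"
      using integral_invariant[OF p, of "x \<otimes> S a"] x a by (simp add: antipode_closed)
    also have "\<dots> = tensor_lift K H H H (\<lambda>x1 x2. tensor_lift K H H H
        (\<lambda>z1 z2. ?I (x2 \<otimes> z2) \<odot> (x1 \<otimes> z1)) (\<Delta> (S a))) (\<Delta> x)"
      using x a
      by (simp add: comult_mult antipode_closed lift_tensor_mult[OF H_algebra H_algebra H_module b] comult_closed)
    also have "\<dots> = tensor_lift K H H H (\<lambda>x1 x2. ?C x1 x2 a) (\<Delta> x)"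
    proof (rule cong_HH[OF H_module bC[OF a] comult_closed[OF x]])
      fix x1 x2 assume x12: "x1 \<in> carrier H" "x2 \<in> carrier H"
      have b1: "bilinear K H H H (\<lambda>z1 z2. ?I (x2 \<otimes> z2) \<odot> (x1 \<otimes> z1))" by (intro li x12)
      show "tensor_lift K H H H (\<lambda>z1 z2. ?I (x2 \<otimes> z2) \<odot> (x1 \<otimes> z1)) (\<Delta> (S a)) = ?C x1 x2 a"
        by (simp add: conv_def lift_comult_antipode[OF H_module b1 a])
    qed
    finally show ?thesis .
  qed
  have "slice (\<lambda>a. ?I (x \<otimes> S a)) h =
    tensor_lift K H H H (\<lambda>a b. tensor_lift K H H H (\<lambda>x1 x2. ?C x1 x2 a \<otimes> b) (\<Delta> x)) (\<Delta> h)"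
    unfolding slice_def conv_def[of _ _ _ idH]
  proof (rule cong_HH[OF H_module _ comult_closed[OF h]])
    show "bilinear K H H H (\<lambda>a b. tensor_lift K H H H (\<lambda>x1 x2. ?C x1 x2 a \<otimes> b) (\<Delta> x))"
      unfolding conv_def by (intro li x)
    fix a b assume ab: "a \<in> carrier H" "b \<in> carrier H"
    have "?I (x \<otimes> S a) \<odot> b = (?I (x \<otimes> S a) \<odot> \<one>) \<otimes> b"
      using ab x by (simp add: mult_smult_left lin_K[OF I] antipode_closed)
    also have "\<dots> = tensor_lift K H H H (\<lambda>x1 x2. ?C x1 x2 a \<otimes> b) (\<Delta> x)"
      unfolding \<Gamma>[OF ab(1)]
      by (intro comp_HH[OF H_module H_module bC[OF ab(1)] _ comult_closed[OF x]] lin_intros ab)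
    finally show "?I (x \<otimes> S a) \<odot> b = tensor_lift K H H H (\<lambda>x1 x2. ?C x1 x2 a \<otimes> b) (\<Delta> x)" .
  qed
  also have "\<dots> = tensor_lift K H H H (\<lambda>x1 x2. conv H mulH (?C x1 x2) idH h) (\<Delta> x)"
    unfolding conv_def by (intro lift_swap H_module comult_closed x h li)
  also have "\<dots> = tensor_lift K H H H (\<lambda>x1 x2. ?I (x2 \<otimes> S h) \<odot> x1) (\<Delta> x)"
  proof (rule cong_HH[OF H_module _ comult_closed[OF x]])
    show "bilinear K H H H (\<lambda>x1 x2. ?I (x2 \<otimes> S h) \<odot> x1)" by (intro li h)
    fix x1 x2 assume x12: "x1 \<in> carrier H" "x2 \<in> carrier H"
    have f: "lin K H SK (\<lambda>a. ?I (x2 \<otimes> S a))" and g: "lin K H H (\<lambda>a. x1 \<otimes> S a)" by (intro li x12)+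
    have "conv H mulH (?C x1 x2) idH h =
      conv H (\<lambda>c y. c \<odot> y) (\<lambda>a. ?I (x2 \<otimes> S a)) (conv H mulH (\<lambda>a. x1 \<otimes> S a) idH) h"
      by (rule conv_assoc[OF H_module H_module H_module smultH_bilinear mulH_bilinear mulH_bilinear smultH_bilinear
            _ f g lin_id h]) (simp add: mult_smult_left)
    also have "\<dots> = conv H (\<lambda>c y. c \<odot> y) (\<lambda>a. ?I (x2 \<otimes> S a)) (\<lambda>a. \<epsilon> a \<odot> x1) h"
    proof (rule conv_cong[OF H_module smultH_bilinear f _ h])
      show "lin K H H (\<lambda>a. \<epsilon> a \<odot> x1)" by (intro lin_intros counit_linear x12)
      fix a assume a: "a \<in> carrier H"
      have "conv H mulH (\<lambda>a. x1 \<otimes> S a) idH a = conv H (\<lambda>u v. x1 \<otimes> mulH u v) S idH a"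
        unfolding conv_def
        by (rule cong_HH[OF H_module _ comult_closed[OF a]])
          ((intro li x12; assumption)+, simp add: H.m_assoc x12 antipode_closed)
      also have "\<dots> = x1 \<otimes> conv H mulH S idH a"
        by (rule conv_lin_comp[OF H_module H_module mulH_bilinear antipode_linear lin_id _ a, symmetric])
          (intro lin_intros x12)
      finally show "conv H mulH (\<lambda>a. x1 \<otimes> S a) idH a = \<epsilon> a \<odot> x1"
        by (simp add: conv_antipode_id a mult_smult_right counit_closed x12)
    qed simp
    also have "\<dots> = ?I (x2 \<otimes> S h) \<odot> x1"
      by (rule conv_unit_right[OF H_module H_module smultH_bilinear f x12(1) h])
    finally show "conv H mulH (?C x1 x2) idH h = ?I (x2 \<otimes> S h) \<odot> x1" .
  qed
  finally show ?thesis .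
qed

text \<open>If \<open>S(h) = 0\<close> then \<open>\<Sum> \<lambda>(x S(h\<^sub>1)) h\<^sub>2 = 0\<close> for all \<open>x\<close> by the preceding lemma.  Comultiply \<open>h\<^sub>2\<close> and put
  \<open>x = y S\<^sup>2(h\<^sub>2)\<close>: the result is \<open>\<Sum> \<lambda>(y S\<^sup>2(h\<^sub>2) S(h\<^sub>1)) h\<^sub>3 = \<lambda>(y) h\<close>.  Since \<open>x\<close> must not depend on \<open>h\<close>, the
  substitution is made for the basis vectors \<open>j\<close> in the expansion of \<open>S\<^sup>2(h\<^sub>2)\<close>.\<close>

lemma antipode_kernel_integral:
  assumes p: "lin K H SK p" and y: "y \<in> carrier H" and h: "h \<in> carrier H" and Sh: "S h = \<zero>"
  shows "integral p y \<odot> h = \<zero>"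
proof -
  let ?I = "integral p"
  note I = integral_linear[OF p]
  note li = lin_intros lin_compose[OF I] lin_K[OF I] I
  have vanish: "slice (\<lambda>a. ?I (x \<otimes> S a)) h = \<zero>" if x: "x \<in> carrier H" for x
  proof -
    have "slice (\<lambda>a. ?I (x \<otimes> S a)) h = tensor_lift K H H H (\<lambda>x1 x2. \<zero>\<^bsub>K\<^esub> \<odot> x1) (\<Delta> x)"
      unfolding slice_integral_antipode[OF p x h]
      by (rule cong_HH[OF H_module _ comult_closed[OF x]])
        (auto intro!: bilinearI lin_intros lin_zero_map[OF K_module, simplified] H_module simp: Sh lin_zero[OF H_module K_module I, simplified])
    also have "\<dots> = \<zero>\<^bsub>K\<^esub> \<odot> tensor_lift K H H H (\<lambda>x1 x2. \<epsilon> x2 \<odot> x1) (\<Delta> x)"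
    proof -
      have b: "bilinear K H H H (\<lambda>x1 x2. \<epsilon> x2 \<odot> x1)" by (intro lin_intros counit_linear)
      have l: "lin K H H (\<lambda>x. \<zero>\<^bsub>K\<^esub> \<odot> x)" by (intro lin_intros) simp
      show ?thesis
        unfolding comp_HH[OF H_module H_module b l comult_closed[OF x]]
        by (rule cong_HH[OF H_module _ comult_closed[OF x]])
          (auto intro!: lin_compose[OF l] bilinearI lin_intros counit_linear simp: counit_closed)
    qed
    finally show ?thesis by (simp add: counit_right x)
  qed
  let ?\<beta> = "\<lambda>u v. ?I (y \<otimes> (S (S v) \<otimes> S u))"
  have b: "bilinear K H H SK ?\<beta>" by (intro li y)
  have lg: "lin K H SK (\<lambda>v. e j (S (S v)))" if "j \<in> B" for j
    by (intro lin_compose[OF e_lin[OF that]] lin_intros)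
  have lf: "lin K H SK (\<lambda>u. ?I ((y \<otimes> j) \<otimes> S u))" if "j \<in> B" for j
    by (intro li y B_closed that)
  have "?I y \<odot> h = slice (\<lambda>a. \<epsilon> a \<odot>\<^bsub>SK\<^esub> ?I y) h"
    unfolding slice_def
    by (rule conv_unit_left[OF K_module H_module smultH_bilinear lin_id _ h, symmetric]) (simp add: lin_K[OF I] y)
  also have "\<dots> = slice (\<lambda>a. tensor_lift K H H SK ?\<beta> (\<Delta> a)) h"
    unfolding slice_def
  proof (rule conv_cong[OF H_module smultH_bilinear _ lin_id h])
    show "lin K H SK (\<lambda>a. tensor_lift K H H SK ?\<beta> (\<Delta> a))" by (intro lin_intros b)
    fix a assume a: "a \<in> carrier H"
    have bS: "bilinear K H H H (\<lambda>u s. S (S s) \<otimes> S u)" by (intro lin_intros)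
    have l: "lin K H SK (\<lambda>z. ?I (y \<otimes> z))" by (intro li y)
    have "tensor_lift K H H SK ?\<beta> (\<Delta> a) = ?I (y \<otimes> conv H (\<lambda>u s. s \<otimes> u) S (\<lambda>x. S (S x)) a)"
      unfolding conv_def
      by (rule comp_HH[OF H_module K_module bS l comult_closed[OF a], symmetric])
    then show "\<epsilon> a \<odot>\<^bsub>SK\<^esub> ?I y = tensor_lift K H H SK ?\<beta> (\<Delta> a)"
      by (simp add: conv_antipode_square a mult_smult_right counit_closed y lin_K_smult[OF I])
  qed simp
  also have "\<dots> = (\<Oplus>j\<in>B. slice (\<lambda>v. e j (S (S v))) (slice (\<lambda>u. ?I ((y \<otimes> j) \<otimes> S u)) h))"
  proof (rule slice_sum[OF lf lg b _ h, symmetric])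
    fix u v assume uv: "u \<in> carrier H" "v \<in> carrier H"
    have "lin K H SK (\<lambda>w. ?I ((y \<otimes> w) \<otimes> S u))" by (intro li y uv)
    from lin_expand[OF K_module this, of "S (S v)"] uv y
    have "?\<beta> u v = (\<Oplus>\<^bsub>SK\<^esub>j\<in>B. e j (S (S v)) \<otimes>\<^bsub>K\<^esub> ?I ((y \<otimes> j) \<otimes> S u))"
      by (simp add: H.m_assoc antipode_closed)
    also have "\<dots> = (\<Oplus>\<^bsub>SK\<^esub>j\<in>B. ?I ((y \<otimes> j) \<otimes> S u) \<otimes>\<^bsub>K\<^esub> e j (S (S v)))"
      using uv y B_closed
      by (intro SK.finsum_cong') (auto simp: HM.m_comm e_closed antipode_closed lin_K[OF I])
    finally show "(\<Oplus>\<^bsub>SK\<^esub>j\<in>B. ?I ((y \<otimes> j) \<otimes> S u) \<otimes>\<^bsub>K\<^esub> e j (S (S v))) = ?\<beta> u v" ..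
  qed
  also have "\<dots> = (\<Oplus>j\<in>B. \<zero>)"
    using B_closed y by (intro HM.finsum_cong')
      (auto simp: vanish lin_zero[OF H_module H_module slice_linear[OF lg]])
  also have "\<dots> = \<zero>" by (rule HM.M.finsum_zero)
  finally show ?thesis .
qed

text \<open>The sum over the basis of \<open>S(k) e\<^sub>k(a\<^sub>2) S\<^sup>2(a\<^sub>1)\<close> is \<open>S(a\<^sub>2) S\<^sup>2(a\<^sub>1) = S(S(a\<^sub>1) a\<^sub>2)\<close>, so the left-hand side
  is the trace of \<open>a \<mapsto> \<epsilon>(a) 1\<close>, which is \<open>\<epsilon>(1)\<close>.\<close>

lemma integral_total: "(\<Oplus>\<^bsub>SK\<^esub>k\<in>B. integral (e k) (S k)) = \<one>\<^bsub>K\<^esub>"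
proof -
  have cl: "S k \<otimes> twist (e k) a \<in> carrier H" if "k \<in> B" "a \<in> carrier H" for k a
    using that by (simp add: antipode_closed B_closed twist_closed[OF e_lin])
  have sum: "(\<Oplus>k\<in>B. S k \<otimes> twist (e k) a) = \<epsilon> a \<odot> \<one>" if a: "a \<in> carrier H" for a
  proof -
    have b: "bilinear K H H H (\<lambda>u s. S k \<otimes> (e k s \<odot> S (S u)))" if "k \<in> B" for k
      by (intro lin_intros e_lin[OF that] e_closed[OF that] B_closed[OF that])
    have "(\<Oplus>k\<in>B. S k \<otimes> twist (e k) a) =
      (\<Oplus>k\<in>B. tensor_lift K H H H (\<lambda>u s. S k \<otimes> (e k s \<odot> S (S u))) (\<Delta> a))"
    proof (rule HM.finsum_cong'[OF refl])
      show "(\<lambda>k. tensor_lift K H H H (\<lambda>u s. S k \<otimes> (e k s \<odot> S (S u))) (\<Delta> a)) \<in> B \<rightarrow> carrier H"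
        using lift_closed[OF H_module H_module H_module b comult_closed[OF a]] by auto
      fix k assume k: "k \<in> B"
      have l: "lin K H H (\<lambda>z. S k \<otimes> z)" by (intro lin_intros B_closed k)
      show "S k \<otimes> twist (e k) a = tensor_lift K H H H (\<lambda>u s. S k \<otimes> (e k s \<odot> S (S u))) (\<Delta> a)"
        unfolding twist_def conv_def
        by (rule comp_HH[OF H_module H_module conv_bilinear[OF smultH_bilinear' lin_SS e_lin[OF k]] l comult_closed[OF a]])
    qed
    also have "\<dots> = tensor_lift K H H H (\<lambda>u s. \<Oplus>k\<in>B. S k \<otimes> (e k s \<odot> S (S u))) (\<Delta> a)"
      by (rule lift_finsum[OF H_module H_module H_module B_finite b comult_closed[OF a], symmetric])
    also have "\<dots> = tensor_lift K H H H (\<lambda>u s. S (S u \<otimes> s)) (\<Delta> a)"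
    proof (rule cong_HH[OF H_module _ comult_closed[OF a]])
      show "bilinear K H H H (\<lambda>u s. S (S u \<otimes> s))" by (intro lin_intros)
      fix u s assume us: "u \<in> carrier H" "s \<in> carrier H"
      have l: "lin K H H (\<lambda>z. S z \<otimes> S (S u))" by (intro lin_intros us)
      have "S (S u \<otimes> s) = (\<Oplus>k\<in>B. e k s \<odot> (S k \<otimes> S (S u)))"
        using lin_expand[OF H_module l us(2)] us by (simp add: antipode_mult antipode_closed)
      also have "\<dots> = (\<Oplus>k\<in>B. S k \<otimes> (e k s \<odot> S (S u)))"
        using us by (intro HM.finsum_cong') (auto simp: mult_smult_right e_closed antipode_closed B_closed)
      finally show "(\<Oplus>k\<in>B. S k \<otimes> (e k s \<odot> S (S u))) = S (S u \<otimes> s)" ..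
    qed
    also have "\<dots> = S (tensor_lift K H H H (\<lambda>u s. S u \<otimes> s) (\<Delta> a))"
      by (rule comp_HH[OF H_module H_module _ antipode_linear comult_closed[OF a], symmetric])
        (intro lin_intros)
    finally show ?thesis
      by (simp add: antipode_left a lin_smult[OF antipode_linear] counit_closed antipode_one)
  qed
  have "(\<Oplus>\<^bsub>SK\<^esub>k\<in>B. integral (e k) (S k)) = trace (\<lambda>a. \<Oplus>k\<in>B. S k \<otimes> twist (e k) a)"
    unfolding integral_def by (rule trace_finsum[OF B_finite cl, symmetric])
  also have "\<dots> = trace (\<lambda>a. \<epsilon> a \<odot> \<one>)"
    by (rule trace_cong) (simp_all add: sum counit_closed)
  also have "\<dots> = (\<Oplus>\<^bsub>SK\<^esub>b\<in>B. e b \<one> \<otimes>\<^bsub>K\<^esub> \<epsilon> b)"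
    unfolding trace_def
    by (intro SK.finsum_cong') (auto simp: lin_K_smult[OF e_lin] counit_closed B_closed HM.m_comm e_closed)
  also have "\<dots> = \<epsilon> \<one>"
    using lin_expand[OF K_module counit_linear H.one_closed] by simp
  finally show ?thesis by (simp add: counit_one)
qed

lemma antipode_kernel_trivial:
  assumes h: "h \<in> carrier H" and Sh: "S h = \<zero>"
  shows "h = \<zero>"
proof -
  have cl: "integral (e k) (S k) \<in> carrier K" if "k \<in> B" for k
    using lin_K[OF integral_linear[OF e_lin]] that by (simp add: antipode_closed B_closed)
  have "h = (\<Oplus>\<^bsub>SK\<^esub>k\<in>B. integral (e k) (S k)) \<odot> h" by (simp add: integral_total h)
  also have "\<dots> = (\<Oplus>k\<in>B. integral (e k) (S k) \<odot> h)"
    by (rule lin_finsum[OF K_module H_module bilinear_left[OF smultH_bilinear h] B_finite]) (simp add: cl)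
  also have "\<dots> = (\<Oplus>k\<in>B. \<zero>)"
    by (intro HM.finsum_cong')
      (auto simp: antipode_kernel_integral[OF e_lin antipode_closed[OF B_closed] h Sh])
  also have "\<dots> = \<zero>" by (rule HM.M.finsum_zero)
  finally show ?thesis .
qed

end

locale fin_hopf = hopf K H for K :: "'k ring" and H :: "('k, 'h) hopf" (structure) +
  assumes fin_dim: "vectorspace.fin_dim K H"
begin

lemma antipode_bij: "bij_betw S (carrier H) (carrier H)"
proof -
  have V: "vectorspace K H" using H_algebra by (simp add: unital_algebra_def)
  obtain B e where "dual_basis K H B e" using dual_basis_exists[OF V fin_dim] by blast
  then interpret hopf_dual_basis K H B e by unfold_locales
  show ?thesis
    by (rule injective_endo_surjective[OF V fin_dim antipode_linear antipode_kernel_trivial])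
qed

end

section \<open>The opposite Hopf algebra\<close>

lemma hopf_op_simps [simp]:
  "carrier (hopf_op H) = carrier H" "\<zero>\<^bsub>hopf_op H\<^esub> = \<zero>\<^bsub>H\<^esub>" "\<one>\<^bsub>hopf_op H\<^esub> = \<one>\<^bsub>H\<^esub>"
  "(\<oplus>\<^bsub>hopf_op H\<^esub>) = (\<oplus>\<^bsub>H\<^esub>)" "(\<odot>\<^bsub>hopf_op H\<^esub>) = (\<odot>\<^bsub>H\<^esub>)"
  "(\<otimes>\<^bsub>hopf_op H\<^esub>) = (\<lambda>x y. y \<otimes>\<^bsub>H\<^esub> x)" "comult (hopf_op H) = comult H" "counit (hopf_op H) = counit H"
  "antipode (hopf_op H) = inv_into (carrier H) (antipode H)"
  by (simp_all add: hopf_op_def)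

lemma hopf_op_same_module: "same_module (hopf_op H) H"
  by (simp add: same_module_def hopf_op_def)

lemma unital_algebra_op:
  assumes "unital_algebra K H"
  shows "unital_algebra K (hopf_op H)"
proof -
  interpret H: ring H using assms by (rule unital_algebra_ring)
  have m: "module K (hopf_op H)"
    by (rule same_module_module[OF same_module_sym[OF hopf_op_same_module] unital_algebra_module[OF assms]])
  interpret m: module K "hopf_op H" by (rule m)
  have "ring (hopf_op H)"
  proof (rule ringI)
    show "abelian_group (hopf_op H)" by (rule m.abelian_group_axioms)
    show "monoid (hopf_op H)" by (rule monoidI) (auto simp: H.m_assoc)
  qed (auto simp: H.l_distr H.r_distr)
  then show ?thesis using assms m by (simp add: unital_algebra_def vectorspace_def)
qed

context fin_hopf
begin

abbreviation "Hop \<equiv> hopf_op H"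
abbreviation "Si \<equiv> inv_into (carrier H) S"

lemma Si_closed: "h \<in> carrier H \<Longrightarrow> Si h \<in> carrier H"
  using antipode_bij by (metis bij_betw_def inv_into_into)

lemma S_Si: "h \<in> carrier H \<Longrightarrow> S (Si h) = h"
  using antipode_bij by (simp add: bij_betw_inv_into_right)

lemma Si_S: "h \<in> carrier H \<Longrightarrow> Si (S h) = h"
  using antipode_bij by (simp add: bij_betw_inv_into_left)

lemma S_inject: "x \<in> carrier H \<Longrightarrow> y \<in> carrier H \<Longrightarrow> S x = S y \<Longrightarrow> x = y"
  by (metis Si_S)

lemma Si_linear: "lin K H H Si"
proof (rule linI)
  show "Si x \<in> carrier H" if "x \<in> carrier H" for x using that by (rule Si_closed)
  show "Si (x \<oplus> y) = Si x \<oplus> Si y" if "x \<in> carrier H" "y \<in> carrier H" for x y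
    by (rule S_inject) (simp_all add: that Si_closed S_Si lin_add[OF antipode_linear])
  show "Si (c \<odot> x) = c \<odot> Si x" if "c \<in> carrier K" "x \<in> carrier H" for c x
    by (rule S_inject) (simp_all add: that Si_closed S_Si lin_smult[OF antipode_linear])
qed

lemmas lin_Si [lin_intros] = lin_compose[OF Si_linear]
declare Si_closed [lin_intros]

text \<open>The images of these laws under the injective map \<open>S\<close> are the inverse laws of \<open>S\<close>.\<close>

lemma antipode_op_laws:
  assumes h: "h \<in> carrier H"
  shows "tensor_lift K H H H (\<lambda>a b. b \<otimes> Si a) (\<Delta> h) = \<epsilon> h \<odot> \<one>"
    and "tensor_lift K H H H (\<lambda>a b. Si b \<otimes> a) (\<Delta> h) = \<epsilon> h \<odot> \<one>"
proof -
  have b: "bilinear K H H H (\<lambda>a b. b \<otimes> Si a)" "bilinear K H H H (\<lambda>a b. Si b \<otimes> a)"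
    "bilinear K H H H (\<lambda>a b. a \<otimes> S b)" "bilinear K H H H (\<lambda>a b. S a \<otimes> b)"
    by (intro lin_intros; assumption)+
  have one: "S (\<epsilon> h \<odot> \<one>) = \<epsilon> h \<odot> \<one>"
    by (simp add: lin_smult[OF antipode_linear] counit_closed h antipode_one)
  have "S (tensor_lift K H H H (\<lambda>a b. b \<otimes> Si a) (\<Delta> h)) =
    tensor_lift K H H H (\<lambda>a b. S (b \<otimes> Si a)) (\<Delta> h)"
    by (rule comp_HH[OF H_module H_module b(1) antipode_linear comult_closed[OF h]])
  also have "\<dots> = tensor_lift K H H H (\<lambda>a b. a \<otimes> S b) (\<Delta> h)"
    by (rule cong_HH[OF H_module b(3) comult_closed[OF h]])
      (simp add: antipode_mult Si_closed S_Si)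
  finally have 1: "S (tensor_lift K H H H (\<lambda>a b. b \<otimes> Si a) (\<Delta> h)) = S (\<epsilon> h \<odot> \<one>)"
    by (simp add: antipode_right h one)
  show "tensor_lift K H H H (\<lambda>a b. b \<otimes> Si a) (\<Delta> h) = \<epsilon> h \<odot> \<one>"
    by (rule S_inject[OF _ _ 1])
      (auto intro: lift_closed[OF H_module H_module H_module b(1) comult_closed[OF h]] simp: counit_closed h)
  have "S (tensor_lift K H H H (\<lambda>a b. Si b \<otimes> a) (\<Delta> h)) =
    tensor_lift K H H H (\<lambda>a b. S (Si b \<otimes> a)) (\<Delta> h)"
    by (rule comp_HH[OF H_module H_module b(2) antipode_linear comult_closed[OF h]])
  also have "\<dots> = tensor_lift K H H H (\<lambda>a b. S a \<otimes> b) (\<Delta> h)"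
    by (rule cong_HH[OF H_module b(4) comult_closed[OF h]])
      (simp add: antipode_mult Si_closed S_Si)
  finally have 2: "S (tensor_lift K H H H (\<lambda>a b. Si b \<otimes> a) (\<Delta> h)) = S (\<epsilon> h \<odot> \<one>)"
    by (simp add: antipode_left h one)
  show "tensor_lift K H H H (\<lambda>a b. Si b \<otimes> a) (\<Delta> h) = \<epsilon> h \<odot> \<one>"
    by (rule S_inject[OF _ _ 2])
      (auto intro: lift_closed[OF H_module H_module H_module b(2) comult_closed[OF h]] simp: counit_closed h)
qed

text \<open>The two products are the same double Sweedler sum, summed in different orders.\<close>

lemma tensor_algebra_op:
  assumes "s \<in> carrier HH" "t \<in> carrier HH"
  shows "s \<otimes>\<^bsub>tensor_algebra K Hop Hop\<^esub> t = t \<otimes>\<^bsub>tensor_algebra K H H\<^esub> s"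
proof -
  note sp = same_module_tensor_space[OF hopf_op_same_module hopf_op_same_module]
  have lf: "tensor_lift K Hop Hop HH = tensor_lift K H H HH"
    by (rule ext, rule same_module_tensor_lift[OF same_module_refl])
  show ?thesis
    unfolding tensor_algebra_mult sp lf hopf_op_simps
    by (intro lift_swap H_module HH_module assms lin_intros)
qed

lemma hopf_op_hopf: "hopf_algebra K Hop"
proof -
  note sm = hopf_op_same_module
  note sp = same_module_tensor_space[OF sm sm] same_module_tensor_space[OF same_module_refl sm]
    same_module_tensor_space[OF sm same_module_refl]
  have lf: "tensor_lift K Hop Hop Hop = tensor_lift K H H H"
    by (rule ext, rule same_module_tensor_lift[OF sm])
  have comult: "comult Hop \<in> algebra_hom K Hop (tensor_algebra K Hop Hop)"
    unfolding algebra_hom_def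
  proof (rule IntI)
    show "lin K Hop (tensor_algebra K Hop Hop) (comult Hop)"
      using comult_linear
      by (simp add: same_module_lin[OF sm tensor_algebra_same_module] sp)
    show "comult Hop \<in> ring_hom Hop (tensor_algebra K Hop Hop)"
      by (rule ring_hom_memI)
        (auto simp: sp comult_closed comult_mult comult_one tensor_algebra_op lin_add[OF comult_linear])
  qed
  have coassoc: "tensor_assoc K Hop Hop Hop (tensor_map K Hop Hop (tensor_space K Hop Hop) Hop (comult Hop) id (comult Hop h)) =
      tensor_map K Hop Hop Hop (tensor_space K Hop Hop) id (comult Hop) (comult Hop h)"
    if "h \<in> carrier H" for h
    using hopf that
    by (simp add: hopf_algebra_def sp same_module_tensor_assoc[OF sm sm sm]
        same_module_tensor_map[OF sm sm same_module_refl sm] same_module_tensor_map[OF sm sm sm same_module_refl])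
  have "counit Hop \<in> ring_hom Hop K"
    by (rule ring_hom_memI) (auto simp: counit_closed counit_mult counit_one HM.m_comm
        lin_add[OF counit_linear, simplified])
  moreover have "lin K Hop Hop (antipode Hop)"
    using Si_linear by (simp add: same_module_lin[OF sm sm])
  ultimately show ?thesis
    unfolding hopf_algebra_def
    using unital_algebra_op[OF H_algebra] comult coassoc
    by (simp add: lf counit_left counit_right antipode_op_laws counit_smult)
qed

lemma fin_hopf_op: "fin_hopf K Hop"
proof (intro fin_hopf.intro hopf.intro fin_hopf_axioms.intro)
  show "hopf_algebra K Hop" by (rule hopf_op_hopf)
  have V: "vectorspace K H" "vectorspace K Hop"
    using H_algebra unital_algebra_op[OF H_algebra] by (auto simp: unital_algebra_def)
  show "vectorspace.fin_dim K Hop"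
    using fin_dim same_module_span[OF H_module same_module_sym[OF hopf_op_same_module]]
    by (simp add: vectorspace.fin_dim_def[OF V(1)] vectorspace.fin_dim_def[OF V(2)])
qed

end

section \<open>Flipping tensor factors\<close>

text \<open>The flip of the two factors combined with a map on each of them; both functors apply it to the
  coactions.\<close>

definition flip ::
  "'k ring \<Rightarrow> ('k, 'a, 'm) module_scheme \<Rightarrow> ('k, 'b, 'n) module_scheme
    \<Rightarrow> ('k, 'c, 'p) module_scheme \<Rightarrow> ('k, 'd, 'q) module_scheme
    \<Rightarrow> ('a \<Rightarrow> 'd) \<Rightarrow> ('b \<Rightarrow> 'c) \<Rightarrow> ('a \<times> 'b \<Rightarrow> 'k) set \<Rightarrow> ('c \<times> 'd \<Rightarrow> 'k) set" where
  "flip K A B C D f g = tensor_lift K A B (tensor_space K C D) (\<lambda>a b. tens K C D (g b) (f a))"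

context
  fixes K :: "'k ring" and A :: "('k, 'a, 'm) module_scheme" and B :: "('k, 'b, 'n) module_scheme"
    and C :: "('k, 'c, 'p) module_scheme" and D :: "('k, 'd, 'q) module_scheme"
    and f :: "'a \<Rightarrow> 'd" and g :: "'b \<Rightarrow> 'c"
  assumes m: "module K A" "module K B" "module K C" "module K D"
    and f: "lin K A D f" and g: "lin K B C g"
begin

lemma flip_bilinear: "bilinear K A B (tensor_space K C D) (\<lambda>a b. tens K C D (g b) (f a))"
  by (intro lin_intros m f g lin_closed[OF f] lin_closed[OF g])

lemma flip_linear: "lin K (tensor_space K A B) (tensor_space K C D) (flip K A B C D f g)"
  unfolding flip_def by (intro lift_linear m tensor_module flip_bilinear)

lemma flip_tens: "a \<in> carrier A \<Longrightarrow> b \<in> carrier B \<Longrightarrow>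
    flip K A B C D f g (tens K A B a b) = tens K C D (g b) (f a)"
  unfolding flip_def by (intro lift_tens m tensor_module flip_bilinear)

lemma lift_flip:
  assumes P: "module K P" and F: "bilinear K C D P F" and t: "t \<in> carrier (tensor_space K A B)"
  shows "tensor_lift K C D P F (flip K A B C D f g t) = tensor_lift K A B P (\<lambda>a b. F (g b) (f a)) t"
proof -
  have "tensor_lift K C D P F (flip K A B C D f g t) =
    tensor_lift K A B P (\<lambda>a b. tensor_lift K C D P F (tens K C D (g b) (f a))) t"
    unfolding flip_def
    by (rule lin_lift_comp[OF m(1,2) tensor_module[OF m(3,4)] P flip_bilinear lift_linear[OF m(3,4) P F] t])
  also have "\<dots> = tensor_lift K A B P (\<lambda>a b. F (g b) (f a)) t"
  proof (rule lift_cong[OF m(1,2) P _ t])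
    show "bilinear K A B P (\<lambda>a b. F (g b) (f a))"
      by (intro bilinearI lin_compose[OF bilinear_left[OF F] g] lin_compose[OF bilinear_right[OF F] f]
          lin_closed[OF f] lin_closed[OF g])
  qed (simp add: lift_tens m P F lin_closed[OF f] lin_closed[OF g])
  finally show ?thesis .
qed

end

text \<open>Both sides are bilinear in \<open>s\<close> and \<open>t\<close>, so that pure tensors suffice.\<close>

lemma flip_mult:
  assumes alg: "unital_algebra K A" "unital_algebra K B" "unital_algebra K C" "unital_algebra K D"
    and f: "lin K A D f" and g: "lin K B C g"
    and fm: "\<And>x y. x \<in> carrier A \<Longrightarrow> y \<in> carrier A \<Longrightarrow> f (x \<otimes>\<^bsub>A\<^esub> y) = f x \<otimes>\<^bsub>D\<^esub> f y"
    and gm: "\<And>x y. x \<in> carrier B \<Longrightarrow> y \<in> carrier B \<Longrightarrow> g (x \<otimes>\<^bsub>B\<^esub> y) = g x \<otimes>\<^bsub>C\<^esub> g y"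
    and s: "s \<in> carrier (tensor_space K A B)" and t: "t \<in> carrier (tensor_space K A B)"
  shows "flip K A B C D f g (s \<otimes>\<^bsub>tensor_algebra K A B\<^esub> t) =
    flip K A B C D f g s \<otimes>\<^bsub>tensor_algebra K C D\<^esub> flip K A B C D f g t"
proof -
  note m = alg[THEN unital_algebra_module]
  let ?\<phi> = "flip K A B C D f g"
  let ?T = "tensor_space K A B" and ?U = "tensor_space K C D"
  note mT = tensor_module[OF m(1,2)] and mU = tensor_module[OF m(3,4)]
  note L = flip_linear[OF m f g] and ft = flip_tens[OF m f g]
  note b1 = tensor_mult_bilinear[OF alg(1,2)] and b2 = tensor_mult_bilinear[OF alg(3,4)]
  interpret A: ring A by (rule unital_algebra_ring[OF alg(1)])
  interpret B: ring B by (rule unital_algebra_ring[OF alg(2)])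
  show ?thesis
  proof (rule tensor_ext[OF m(1,2) mU _ _ _ s])
    show "lin K ?T ?U (\<lambda>s. ?\<phi> (s \<otimes>\<^bsub>tensor_algebra K A B\<^esub> t))"
      by (rule lin_compose[OF L bilinear_left[OF b1 t]])
    show "lin K ?T ?U (\<lambda>s. ?\<phi> s \<otimes>\<^bsub>tensor_algebra K C D\<^esub> ?\<phi> t)"
      by (rule lin_compose[OF bilinear_left[OF b2 lin_closed[OF L t]] L])
    fix a b assume ab: "a \<in> carrier A" "b \<in> carrier B"
    then have s: "tens K A B a b \<in> carrier ?T" by (intro tens_closed m)
    show "?\<phi> (tens K A B a b \<otimes>\<^bsub>tensor_algebra K A B\<^esub> t) =
      ?\<phi> (tens K A B a b) \<otimes>\<^bsub>tensor_algebra K C D\<^esub> ?\<phi> t"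
    proof (rule tensor_ext[OF m(1,2) mU _ _ _ t])
      show "lin K ?T ?U (\<lambda>t. ?\<phi> (tens K A B a b \<otimes>\<^bsub>tensor_algebra K A B\<^esub> t))"
        by (rule lin_compose[OF L bilinear_right[OF b1 s]])
      show "lin K ?T ?U (\<lambda>t. ?\<phi> (tens K A B a b) \<otimes>\<^bsub>tensor_algebra K C D\<^esub> ?\<phi> t)"
        by (rule lin_compose[OF bilinear_right[OF b2 lin_closed[OF L s]] L])
    qed (simp add: ab ft tensor_mult_tens[OF alg(1,2)] tensor_mult_tens[OF alg(3,4)]
        lin_closed[OF f] lin_closed[OF g] fm gm)
  qed
qed

lemma algebra_homI:
  assumes "lin K A B f"
    and "\<And>x y. x \<in> carrier A \<Longrightarrow> y \<in> carrier A \<Longrightarrow> f (x \<otimes>\<^bsub>A\<^esub> y) = f x \<otimes>\<^bsub>B\<^esub> f y"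
    and "f \<one>\<^bsub>A\<^esub> = \<one>\<^bsub>B\<^esub>"
  shows "f \<in> algebra_hom K A B"
  using assms lin_closed[OF assms(1)] lin_add[OF assms(1)]
  by (auto simp: algebra_hom_def intro!: ring_hom_memI)

lemma algebra_homD:
  assumes "f \<in> algebra_hom K A B"
  shows "lin K A B f"
    and "x \<in> carrier A \<Longrightarrow> y \<in> carrier A \<Longrightarrow> f (x \<otimes>\<^bsub>A\<^esub> y) = f x \<otimes>\<^bsub>B\<^esub> f y"
    and "f \<one>\<^bsub>A\<^esub> = \<one>\<^bsub>B\<^esub>"
  using assms by (auto simp: algebra_hom_def ring_hom_def)

section \<open>Transport of Yetter--Drinfeld structures\<close>

context hopf
begin

text \<open>For an \<open>H\<close>-bimodule \<open>M\<close>, \<open>\<phi> * S = S * \<psi>\<close> implies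
  \<open>id * \<phi> = id * \<phi> * S * id = id * S * \<psi> * id = \<psi> * id\<close>.\<close>

lemma conv_intertwine:
  assumes M: "module K M" and l: "bilinear K H M M l" and r: "bilinear K M H M r"
    and la: "\<And>a b m. a \<in> carrier H \<Longrightarrow> b \<in> carrier H \<Longrightarrow> m \<in> carrier M \<Longrightarrow> l (a \<otimes> b) m = l a (l b m)"
    and l1: "\<And>m. m \<in> carrier M \<Longrightarrow> l \<one> m = m"
    and ra: "\<And>a b m. a \<in> carrier H \<Longrightarrow> b \<in> carrier H \<Longrightarrow> m \<in> carrier M \<Longrightarrow> r (r m a) b = r m (a \<otimes> b)"
    and r1: "\<And>m. m \<in> carrier M \<Longrightarrow> r m \<one> = m"
    and lr: "\<And>a b m. a \<in> carrier H \<Longrightarrow> b \<in> carrier H \<Longrightarrow> m \<in> carrier M \<Longrightarrow> r (l a m) b = l a (r m b)"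
    and \<phi>: "lin K H M \<phi>" and \<psi>: "lin K H M \<psi>"
    and eq: "\<And>k. k \<in> carrier H \<Longrightarrow> conv M r \<phi> S k = conv M l S \<psi> k"
    and k: "k \<in> carrier H"
  shows "conv M l idH \<phi> k = conv M r \<psi> idH k"
proof -
  note mh = mulH_bilinear
  have lS: "lin K H M (conv M l S \<psi>)" by (rule conv_linear[OF M l antipode_linear \<psi>])
  have rS: "lin K H M (conv M r \<phi> S)" by (rule conv_linear[OF M r \<phi> antipode_linear])
  have unit: "lin K H H unitH" by (intro lin_intros counit_linear)
  have SI: "lin K H H (conv H mulH S idH)" by (rule conv_linear[OF H_module mh antipode_linear lin_id])
  have \<phi>_eq: "\<phi> x = conv M r (conv M l S \<psi>) idH x" if x: "x \<in> carrier H" for x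
  proof -
    have "\<phi> x = conv M r \<phi> unitH x"
      using conv_unit_right[OF H_module M r \<phi> H.one_closed x] by (simp add: r1 lin_closed[OF \<phi> x])
    also have "\<dots> = conv M r \<phi> (conv H mulH S idH) x"
      by (rule conv_cong[OF M r \<phi> SI x]) (simp_all add: conv_antipode_id)
    also have "\<dots> = conv M r (conv M r \<phi> S) idH x"
      by (rule conv_assoc[OF M H_module M r r mh r ra \<phi> antipode_linear lin_id x, symmetric])
    also have "\<dots> = conv M r (conv M l S \<psi>) idH x"
      by (rule conv_cong[OF M r lS lin_id x]) (simp_all add: eq)
    finally show ?thesis .
  qed
  have "conv M l idH \<phi> k = conv M l idH (conv M r (conv M l S \<psi>) idH) k"
    by (rule conv_cong[OF M l lin_id conv_linear[OF M r lS lin_id] k]) (simp_all add: \<phi>_eq)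
  also have "\<dots> = conv M r (conv M l idH (conv M l S \<psi>)) idH k"
    by (rule conv_assoc[OF M M M l r r l lr lin_id lS lin_id k, symmetric])
  also have "\<dots> = conv M r \<psi> idH k"
  proof (rule conv_cong[OF M r \<psi> lin_id k])
    fix x assume x: "x \<in> carrier H"
    have "conv M l idH (conv M l S \<psi>) x = conv M l (conv H mulH idH S) \<psi> x"
      by (rule conv_assoc[OF H_module M M mh l l l la lin_id antipode_linear \<psi> x, symmetric])
    also have "\<dots> = conv M l unitH \<psi> x"
      by (rule conv_cong[OF M l unit \<psi> x]) (simp_all add: conv_id_antipode)
    also have "\<dots> = \<psi> x"
      using conv_unit_left[OF H_module M l \<psi> H.one_closed x] by (simp add: l1 lin_closed[OF \<psi> x])
    finally show "conv M l idH (conv M l S \<psi>) x = \<psi> x" .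
  qed simp
  finally show ?thesis .
qed

text \<open>The bimodule to which the convolution identity is applied: \<open>H\<close> multiplies the factor \<open>H\<close> of
  \<open>H \<otimes> X\<close> from both sides, whatever the module \<open>X\<close>.\<close>

lemma fst_actions:
  assumes X: "module K X"
  defines "M \<equiv> tensor_space K H X"
  defines "l \<equiv> (\<lambda>h m. tensor_lift K H X M (\<lambda>a x. tens K H X (h \<otimes> a) x) m)"
    and "r \<equiv> (\<lambda>m h. tensor_lift K H X M (\<lambda>a x. tens K H X (a \<otimes> h) x) m)"
  shows "bilinear K H M M l" "bilinear K M H M r"
    and "a \<in> carrier H \<Longrightarrow> b \<in> carrier H \<Longrightarrow> m \<in> carrier M \<Longrightarrow> l (a \<otimes> b) m = l a (l b m)"
    and "m \<in> carrier M \<Longrightarrow> l \<one> m = m"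
    and "a \<in> carrier H \<Longrightarrow> b \<in> carrier H \<Longrightarrow> m \<in> carrier M \<Longrightarrow> r (r m a) b = r m (a \<otimes> b)"
    and "m \<in> carrier M \<Longrightarrow> r m \<one> = m"
    and "a \<in> carrier H \<Longrightarrow> b \<in> carrier H \<Longrightarrow> m \<in> carrier M \<Longrightarrow> r (l a m) b = l a (r m b)"
proof -
  have M: "module K M" unfolding M_def by (intro lin_intros X)
  have bl: "bilinear K H X M (\<lambda>a x. tens K H X (h \<otimes> a) x)"
    and br: "bilinear K H X M (\<lambda>a x. tens K H X (a \<otimes> h) x)" if "h \<in> carrier H" for h
    unfolding M_def by (intro lin_intros X that; assumption)+
  have ll: "lin K M M (l h)" and lr: "lin K M M (\<lambda>m. r m h)" if "h \<in> carrier H" for h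
    unfolding l_def r_def using lift_linear[OF H_module X M bl[OF that]] lift_linear[OF H_module X M br[OF that]]
    by (simp_all add: M_def)
  have lt: "l h (tens K H X a x) = tens K H X (h \<otimes> a) x" "r (tens K H X a x) h = tens K H X (a \<otimes> h) x"
    if "h \<in> carrier H" "a \<in> carrier H" "x \<in> carrier X" for h a x
    unfolding l_def r_def by (intro lift_tens H_module X M bl br that)+
  show "bilinear K H M M l"
    unfolding l_def M_def by (intro lin_intros X)
  show "bilinear K M H M r"
    unfolding r_def M_def by (intro lin_intros X)
  note ext = tensor_ext[OF H_module X M, folded M_def]
  show "l (a \<otimes> b) m = l a (l b m)" if "a \<in> carrier H" "b \<in> carrier H" "m \<in> carrier M" for a b m
    by (rule ext[OF ll lin_compose[OF ll ll] _ that(3)]) (simp_all add: that lt H.m_assoc)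
  show "l \<one> m = m" if "m \<in> carrier M" for m
    by (rule ext[OF ll lin_id _ that]) (simp_all add: lt)
  show "r (r m a) b = r m (a \<otimes> b)" if "a \<in> carrier H" "b \<in> carrier H" "m \<in> carrier M" for a b m
    by (rule ext[OF lin_compose[OF lr lr] lr _ that(3)]) (simp_all add: that lt H.m_assoc)
  show "r m \<one> = m" if "m \<in> carrier M" for m
    by (rule ext[OF lr lin_id _ that]) (simp_all add: lt)
  show "r (l a m) b = l a (r m b)" if "a \<in> carrier H" "b \<in> carrier H" "m \<in> carrier M" for a b m
    by (rule ext[OF lin_compose[OF lr ll] lin_compose[OF ll lr] _ that(3)]) (simp_all add: that lt H.m_assoc)
qed

lemma snd_actions:
  assumes X: "module K X"
  defines "M \<equiv> tensor_space K X H"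
  defines "l \<equiv> (\<lambda>h m. tensor_lift K X H M (\<lambda>x a. tens K X H x (h \<otimes> a)) m)"
    and "r \<equiv> (\<lambda>m h. tensor_lift K X H M (\<lambda>x a. tens K X H x (a \<otimes> h)) m)"
  shows "bilinear K H M M l" "bilinear K M H M r"
    and "a \<in> carrier H \<Longrightarrow> b \<in> carrier H \<Longrightarrow> m \<in> carrier M \<Longrightarrow> l (a \<otimes> b) m = l a (l b m)"
    and "m \<in> carrier M \<Longrightarrow> l \<one> m = m"
    and "a \<in> carrier H \<Longrightarrow> b \<in> carrier H \<Longrightarrow> m \<in> carrier M \<Longrightarrow> r (r m a) b = r m (a \<otimes> b)"
    and "m \<in> carrier M \<Longrightarrow> r m \<one> = m"
    and "a \<in> carrier H \<Longrightarrow> b \<in> carrier H \<Longrightarrow> m \<in> carrier M \<Longrightarrow> r (l a m) b = l a (r m b)"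
proof -
  have M: "module K M" unfolding M_def by (intro lin_intros X)
  have bl: "bilinear K X H M (\<lambda>x a. tens K X H x (h \<otimes> a))"
    and br: "bilinear K X H M (\<lambda>x a. tens K X H x (a \<otimes> h))" if "h \<in> carrier H" for h
    unfolding M_def by (intro lin_intros X that; assumption)+
  have ll: "lin K M M (l h)" and lr: "lin K M M (\<lambda>m. r m h)" if "h \<in> carrier H" for h
    unfolding l_def r_def using lift_linear[OF X H_module M bl[OF that]] lift_linear[OF X H_module M br[OF that]]
    by (simp_all add: M_def)
  have lt: "l h (tens K X H x a) = tens K X H x (h \<otimes> a)" "r (tens K X H x a) h = tens K X H x (a \<otimes> h)"
    if "h \<in> carrier H" "a \<in> carrier H" "x \<in> carrier X" for h a x
    unfolding l_def r_def by (intro lift_tens H_module X M bl br that)+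
  show "bilinear K H M M l"
    unfolding l_def M_def by (intro lin_intros X)
  show "bilinear K M H M r"
    unfolding r_def M_def by (intro lin_intros X)
  note ext = tensor_ext[OF X H_module M, folded M_def]
  show "l (a \<otimes> b) m = l a (l b m)" if "a \<in> carrier H" "b \<in> carrier H" "m \<in> carrier M" for a b m
    by (rule ext[OF ll lin_compose[OF ll ll] _ that(3)]) (simp_all add: that lt H.m_assoc)
  show "l \<one> m = m" if "m \<in> carrier M" for m
    by (rule ext[OF ll lin_id _ that]) (simp_all add: lt)
  show "r (r m a) b = r m (a \<otimes> b)" if "a \<in> carrier H" "b \<in> carrier H" "m \<in> carrier M" for a b m
    by (rule ext[OF lin_compose[OF lr lr] lr _ that(3)]) (simp_all add: that lt H.m_assoc)
  show "r m \<one> = m" if "m \<in> carrier M" for m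
    by (rule ext[OF lr lin_id _ that]) (simp_all add: lt)
  show "r (l a m) b = l a (r m b)" if "a \<in> carrier H" "b \<in> carrier H" "m \<in> carrier M" for a b m
    by (rule ext[OF lin_compose[OF lr ll] lin_compose[OF ll lr] _ that(3)]) (simp_all add: that lt H.m_assoc)
qed

end

text \<open>The data through which the coassociativity, the counit and the unit law of a coaction depend on the
  Hopf algebra; \<open>H\<close>, \<open>H\<^sup>o\<^sup>p\<close> and \<open>(H\<^sup>o\<^sup>p)\<^sup>o\<^sup>p\<close> share them.\<close>

definition same_coalgebra :: "('k, 'h) hopf \<Rightarrow> ('k, 'h) hopf \<Rightarrow> bool" where
  "same_coalgebra G H \<longleftrightarrow> same_module G H \<and> \<one>\<^bsub>G\<^esub> = \<one>\<^bsub>H\<^esub> \<and> comult G = comult H \<and> counit G = counit H"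

lemma same_coalgebra_op: "same_coalgebra (hopf_op H) H" "same_coalgebra (hopf_op (hopf_op H)) H"
  by (simp_all add: same_coalgebra_def same_module_def)

context hopf
begin

context
  fixes G :: "('k, 'h) hopf" and X :: "('k, 'x) module"
  assumes G: "same_coalgebra G H" and X: "module K X"
begin

abbreviation (input) "XH \<equiv> tensor_space K X H"
abbreviation (input) "HX \<equiv> tensor_space K H X"

private lemma sm: "same_module G H" and fields: "\<one>\<^bsub>G\<^esub> = \<one>" "comult G = \<Delta>" "counit G = \<epsilon>"
  using G by (simp_all add: same_coalgebra_def)

private lemma sp: "tensor_space K X G = XH" "tensor_space K G X = HX" "tensor_space K G G = HH"
  "tens K X G = tens K X H" "tens K G X = tens K H X"
  using same_module_tensor_space[OF same_module_refl sm] same_module_tensor_space[OF sm same_module_refl]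
    same_module_tensor_space[OF sm sm] by auto

private lemma lf: "tensor_lift K X G P f = tensor_lift K X H P f" "tensor_lift K G X P g = tensor_lift K H X P g"
  by (rule same_module_tensor_lift[OF same_module_refl])+

private lemma sm_algebra: "same_module (tensor_algebra K X G) XH" "same_module (tensor_algebra K G X) HX"
  using tensor_algebra_same_module[of K X G] tensor_algebra_same_module[of K G X] by (simp_all add: sp)

private lemmas maps =
  same_module_tensor_assoc[OF same_module_refl[of X] sm sm, of K]
  same_module_tensor_assoc[OF sm sm same_module_refl[of X], of K]
  same_module_tensor_map[OF same_module_refl[of X] sm same_module_refl[of XH] sm, of K]
  same_module_tensor_map[OF same_module_refl[of X] sm same_module_refl[of X] same_module_refl[of HH], of K]
  same_module_tensor_map[OF sm same_module_refl[of X] same_module_refl[of HH] same_module_refl[of X], of K]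
  same_module_tensor_map[OF sm same_module_refl[of X] sm same_module_refl[of HX], of K]

text \<open>The structures of a coaction of \<open>G\<close> are expressed over \<open>H\<close>, with the exception of the product of the
  tensor product algebra, in which \<open>G\<close> may be \<open>H\<^sup>o\<^sup>p\<close>.  The last part tests coassociativity with an
  arbitrary trilinear map.\<close>

lemma right_coactionD:
  fixes P :: "('k, 'p, 'q) module_scheme"
  assumes co: "right_coaction K G X \<delta>"
  shows "\<delta> \<in> extensional (carrier X)" "lin K X XH \<delta>"
    and "x \<in> carrier X \<Longrightarrow> y \<in> carrier X \<Longrightarrow> \<delta> (x \<otimes>\<^bsub>X\<^esub> y) = \<delta> x \<otimes>\<^bsub>tensor_algebra K X G\<^esub> \<delta> y"
    and "\<delta> \<one>\<^bsub>X\<^esub> = tens K X H \<one>\<^bsub>X\<^esub> \<one>"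
    and "x \<in> carrier X \<Longrightarrow> tensor_lift K X H X (\<lambda>x0 x1. \<epsilon> x1 \<odot>\<^bsub>X\<^esub> x0) (\<delta> x) = x"
    and "x \<in> carrier X \<Longrightarrow> module K P \<Longrightarrow> trilinear K X H H P F \<Longrightarrow>
      tensor_lift K X H P (\<lambda>x0 x1. tensor_lift K X H P (\<lambda>a b. F a b x1) (\<delta> x0)) (\<delta> x) =
      tensor_lift K X H P (\<lambda>x0 x1. tensor_lift K H H P (F x0) (\<Delta> x1)) (\<delta> x)"
proof -
  have hom: "\<delta> \<in> algebra_hom K X (tensor_algebra K X G)"
    using co by (simp add: right_coaction_def)
  note a = algebra_homD[OF hom]
  show lin: "lin K X XH \<delta>"
    using a(1) by (simp add: same_module_lin[OF same_module_refl sm_algebra(1)])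
  show "\<delta> \<in> extensional (carrier X)" using co by (simp add: right_coaction_def)
  show "\<delta> \<one>\<^bsub>X\<^esub> = tens K X H \<one>\<^bsub>X\<^esub> \<one>" using a(3) by (simp add: sp fields)
  show "\<delta> (x \<otimes>\<^bsub>X\<^esub> y) = \<delta> x \<otimes>\<^bsub>tensor_algebra K X G\<^esub> \<delta> y" if "x \<in> carrier X" "y \<in> carrier X" for x y
    using a(2) that .
  show "tensor_lift K X H X (\<lambda>x0 x1. \<epsilon> x1 \<odot>\<^bsub>X\<^esub> x0) (\<delta> x) = x" if "x \<in> carrier X" for x
    using co that by (simp add: right_coaction_def fields lf)
  show "tensor_lift K X H P (\<lambda>x0 x1. tensor_lift K X H P (\<lambda>a b. F a b x1) (\<delta> x0)) (\<delta> x) =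
      tensor_lift K X H P (\<lambda>x0 x1. tensor_lift K H H P (F x0) (\<Delta> x1)) (\<delta> x)"
    if x: "x \<in> carrier X" and P: "module K P" and F: "trilinear K X H H P F"
    for x F and P :: "('k, 'p, 'q) module_scheme"
  proof (rule coassoc_trilinear[OF X H_module H_module X H_module P lin lin_closed[OF lin x] comult_linear lin_closed[OF lin x] _ F])
    show "tensor_assoc K X H H (tensor_map K X H XH H \<delta> id (\<delta> x)) = tensor_map K X H X HH id \<Delta> (\<delta> x)"
      using co x by (simp add: right_coaction_def sp fields maps)
  qed
qed

lemma left_coactionD:
  fixes P :: "('k, 'p, 'q) module_scheme"
  assumes co: "left_coaction K G X \<delta>"
  shows "\<delta> \<in> extensional (carrier X)" "lin K X HX \<delta>"
    and "x \<in> carrier X \<Longrightarrow> y \<in> carrier X \<Longrightarrow> \<delta> (x \<otimes>\<^bsub>X\<^esub> y) = \<delta> x \<otimes>\<^bsub>tensor_algebra K G X\<^esub> \<delta> y"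
    and "\<delta> \<one>\<^bsub>X\<^esub> = tens K H X \<one> \<one>\<^bsub>X\<^esub>"
    and "x \<in> carrier X \<Longrightarrow> tensor_lift K H X X (\<lambda>x1 x0. \<epsilon> x1 \<odot>\<^bsub>X\<^esub> x0) (\<delta> x) = x"
    and "x \<in> carrier X \<Longrightarrow> module K P \<Longrightarrow> trilinear K H H X P F \<Longrightarrow>
      tensor_lift K H X P (\<lambda>x1 x0. tensor_lift K H H P (\<lambda>a b. F a b x0) (\<Delta> x1)) (\<delta> x) =
      tensor_lift K H X P (\<lambda>x1 x0. tensor_lift K H X P (F x1) (\<delta> x0)) (\<delta> x)"
proof -
  have hom: "\<delta> \<in> algebra_hom K X (tensor_algebra K G X)"
    using co by (simp add: left_coaction_def)
  note a = algebra_homD[OF hom]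
  show lin: "lin K X HX \<delta>"
    using a(1) by (simp add: same_module_lin[OF same_module_refl sm_algebra(2)])
  show "\<delta> \<in> extensional (carrier X)" using co by (simp add: left_coaction_def)
  show "\<delta> \<one>\<^bsub>X\<^esub> = tens K H X \<one> \<one>\<^bsub>X\<^esub>" using a(3) by (simp add: sp fields)
  show "\<delta> (x \<otimes>\<^bsub>X\<^esub> y) = \<delta> x \<otimes>\<^bsub>tensor_algebra K G X\<^esub> \<delta> y" if "x \<in> carrier X" "y \<in> carrier X" for x y
    using a(2) that .
  show "tensor_lift K H X X (\<lambda>x1 x0. \<epsilon> x1 \<odot>\<^bsub>X\<^esub> x0) (\<delta> x) = x" if "x \<in> carrier X" for x
    using co that by (simp add: left_coaction_def fields lf)
  show "tensor_lift K H X P (\<lambda>x1 x0. tensor_lift K H H P (\<lambda>a b. F a b x0) (\<Delta> x1)) (\<delta> x) =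
      tensor_lift K H X P (\<lambda>x1 x0. tensor_lift K H X P (F x1) (\<delta> x0)) (\<delta> x)"
    if x: "x \<in> carrier X" and P: "module K P" and F: "trilinear K H H X P F"
    for x F and P :: "('k, 'p, 'q) module_scheme"
  proof (rule coassoc_trilinear[OF H_module H_module X H_module X P comult_linear lin_closed[OF lin x] lin lin_closed[OF lin x] _ F])
    show "tensor_assoc K H H X (tensor_map K H X HH X \<Delta> id (\<delta> x)) = tensor_map K H X H HX id \<delta> (\<delta> x)"
      using co x by (simp add: left_coaction_def sp fields maps)
  qed
qed

text \<open>By \<open>coassocI\<close> it suffices to test coassociativity in the threefold tensor product; its canonical
  trilinear map is an instance of \<open>F\<close>.\<close>

lemma right_coactionI:
  assumes ext: "\<delta> \<in> extensional (carrier X)" and lin: "lin K X XH \<delta>"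
    and mult: "\<And>x y. x \<in> carrier X \<Longrightarrow> y \<in> carrier X \<Longrightarrow>
      \<delta> (x \<otimes>\<^bsub>X\<^esub> y) = \<delta> x \<otimes>\<^bsub>tensor_algebra K X G\<^esub> \<delta> y"
    and one: "\<delta> \<one>\<^bsub>X\<^esub> = tens K X H \<one>\<^bsub>X\<^esub> \<one>"
    and counit: "\<And>x. x \<in> carrier X \<Longrightarrow> tensor_lift K X H X (\<lambda>x0 x1. \<epsilon> x1 \<odot>\<^bsub>X\<^esub> x0) (\<delta> x) = x"
    and coassoc: "\<And>x P F. P = tensor_space K X HH \<Longrightarrow> x \<in> carrier X \<Longrightarrow> module K P \<Longrightarrow> trilinear K X H H P F \<Longrightarrow>
      tensor_lift K X H P (\<lambda>x0 x1. tensor_lift K X H P (\<lambda>a b. F a b x1) (\<delta> x0)) (\<delta> x) =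
      tensor_lift K X H P (\<lambda>x0 x1. tensor_lift K H H P (F x0) (\<Delta> x1)) (\<delta> x)"
  shows "right_coaction K G X \<delta>"
proof -
  have "tensor_assoc K X H H (tensor_map K X H XH H \<delta> id (\<delta> x)) = tensor_map K X H X HH id \<Delta> (\<delta> x)"
    if x: "x \<in> carrier X" for x
    by (rule coassocI[OF X H_module H_module X H_module lin lin_closed[OF lin x] comult_linear lin_closed[OF lin x]],
        rule coassoc[OF refl x]) (intro lin_intros X)+
  moreover have "\<delta> \<in> algebra_hom K X (tensor_algebra K X G)"
    by (rule algebra_homI) (use lin mult one in \<open>simp_all add: same_module_lin[OF same_module_refl sm_algebra(1)] sp fields\<close>)
  ultimately show ?thesis
    using ext counit by (simp add: right_coaction_def sp fields maps lf)
qed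

lemma left_coactionI:
  assumes ext: "\<delta> \<in> extensional (carrier X)" and lin: "lin K X HX \<delta>"
    and mult: "\<And>x y. x \<in> carrier X \<Longrightarrow> y \<in> carrier X \<Longrightarrow>
      \<delta> (x \<otimes>\<^bsub>X\<^esub> y) = \<delta> x \<otimes>\<^bsub>tensor_algebra K G X\<^esub> \<delta> y"
    and one: "\<delta> \<one>\<^bsub>X\<^esub> = tens K H X \<one> \<one>\<^bsub>X\<^esub>"
    and counit: "\<And>x. x \<in> carrier X \<Longrightarrow> tensor_lift K H X X (\<lambda>x1 x0. \<epsilon> x1 \<odot>\<^bsub>X\<^esub> x0) (\<delta> x) = x"
    and coassoc: "\<And>x P F. P = tensor_space K H HX \<Longrightarrow> x \<in> carrier X \<Longrightarrow> module K P \<Longrightarrow> trilinear K H H X P F \<Longrightarrow>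
      tensor_lift K H X P (\<lambda>x1 x0. tensor_lift K H H P (\<lambda>a b. F a b x0) (\<Delta> x1)) (\<delta> x) =
      tensor_lift K H X P (\<lambda>x1 x0. tensor_lift K H X P (F x1) (\<delta> x0)) (\<delta> x)"
  shows "left_coaction K G X \<delta>"
proof -
  have "tensor_assoc K H H X (tensor_map K H X HH X \<Delta> id (\<delta> x)) = tensor_map K H X H HX id \<delta> (\<delta> x)"
    if x: "x \<in> carrier X" for x
    by (rule coassocI[OF H_module H_module X H_module X comult_linear lin_closed[OF lin x] lin lin_closed[OF lin x]],
        rule coassoc[OF refl x]) (intro lin_intros X)+
  moreover have "\<delta> \<in> algebra_hom K X (tensor_algebra K G X)"
    by (rule algebra_homI) (use lin mult one in \<open>simp_all add: same_module_lin[OF same_module_refl sm_algebra(2)] sp fields\<close>)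
  ultimately show ?thesis
    using ext counit by (simp add: left_coaction_def sp fields maps lf)
qed

end

end

text \<open>Linear constructions do not distinguish \<open>H\<close> from \<open>H\<^sup>o\<^sup>p\<close>.\<close>

lemma op_transparent:
  "tensor_space K X (hopf_op H) = tensor_space K X H" "tensor_space K (hopf_op H) Y = tensor_space K H Y"
  "tens K X (hopf_op H) = tens K X H" "tens K (hopf_op H) Y = tens K H Y"
  "tensor_lift K X (hopf_op H) P f = tensor_lift K X H P f"
  "tensor_lift K (hopf_op H) Y P g = tensor_lift K H Y P g"
  "module_hom K (hopf_op H) Q = module_hom K H Q"
  subgoal by (rule same_module_tensor_space[OF same_module_refl hopf_op_same_module])
  subgoal by (rule same_module_tensor_space[OF hopf_op_same_module same_module_refl])
  subgoal by (rule same_module_tensor_space[OF same_module_refl hopf_op_same_module])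
  subgoal by (rule same_module_tensor_space[OF hopf_op_same_module same_module_refl])
  subgoal by (rule same_module_tensor_lift[OF same_module_refl])
  subgoal by (rule same_module_tensor_lift[OF same_module_refl])
  subgoal by (simp add: module_hom_def)
  done

context fin_hopf
begin

text \<open>Reversing the product of \<open>H\<close> exchanges left and right modules; the coproduct is kept, and with it
  the compatibility of the action with products in \<open>X\<close>.\<close>

lemma right_action_op:
  assumes X: "unital_algebra K X" and act: "left_action K H X act"
  shows "right_action K Hop X (\<lambda>x\<in>carrier X. \<lambda>h\<in>carrier H. act h x)"
proof -
  interpret X: ring X by (rule unital_algebra_ring[OF X])
  note mX = unital_algebra_module[OF X]
  have act': "act h x \<in> carrier X" if "h \<in> carrier H" "x \<in> carrier X" for h x
    using act that by (auto simp: left_action_def)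
  have l1: "lin K X X (act h)" if "h \<in> carrier H" for h
    using act that by (simp add: left_action_def)
  have l2: "lin K H X (\<lambda>h. act h x)" if "x \<in> carrier X" for x
    using act that by (simp add: left_action_def)
  have b: "bilinear K H H X (\<lambda>h1 h2. act h1 x \<otimes>\<^bsub>X\<^esub> act h2 y)" if "x \<in> carrier X" "y \<in> carrier X" for x y
    by (intro lin_intros X l2 act' that)
  have lift_eq: "tensor_lift K H H X (\<lambda>h1 h2. (if h1 \<in> carrier H then act h1 x else undefined) \<otimes>\<^bsub>X\<^esub>
      (if h2 \<in> carrier H then act h2 y else undefined)) (\<Delta> h) =
    tensor_lift K H H X (\<lambda>h1 h2. act h1 x \<otimes>\<^bsub>X\<^esub> act h2 y) (\<Delta> h)"
    if "x \<in> carrier X" "y \<in> carrier X" "h \<in> carrier H" for x y h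
    by (rule cong_HH[OF mX b[OF that(1,2)] comult_closed[OF that(3)]]) simp
  have "lin K X X (\<lambda>x. (\<lambda>x\<in>carrier X. \<lambda>h\<in>carrier H. act h x) x h)" if "h \<in> carrier H" for h
    using l1[OF that] that by (subst lin_cong[OF _ mX, of _ "act h"]) auto
  moreover have "lin K H X ((\<lambda>x\<in>carrier X. \<lambda>h\<in>carrier H. act h x) x)" if "x \<in> carrier X" for x
    using l2[OF that] that by (subst lin_cong[OF _ H_module, of _ "\<lambda>h. act h x"]) auto
  ultimately show ?thesis
    using act unfolding left_action_def right_action_def
    by (auto simp: op_transparent act' restrict_def lift_eq)
qed

lemma left_action_op:
  assumes X: "unital_algebra K X" and act: "right_action K H X act"
  shows "left_action K Hop X (\<lambda>h\<in>carrier H. \<lambda>x\<in>carrier X. act x h)"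
proof -
  interpret X: ring X by (rule unital_algebra_ring[OF X])
  note mX = unital_algebra_module[OF X]
  have act': "act x h \<in> carrier X" if "h \<in> carrier H" "x \<in> carrier X" for h x
    using act that by (auto simp: right_action_def)
  have l1: "lin K X X (\<lambda>x. act x h)" if "h \<in> carrier H" for h
    using act that by (simp add: right_action_def)
  have l2: "lin K H X (act x)" if "x \<in> carrier X" for x
    using act that by (simp add: right_action_def)
  have b: "bilinear K H H X (\<lambda>h1 h2. act x h1 \<otimes>\<^bsub>X\<^esub> act y h2)" if "x \<in> carrier X" "y \<in> carrier X" for x y
    by (intro lin_intros X l2 act' that)
  have lift_eq: "tensor_lift K H H X (\<lambda>h1 h2. (if h1 \<in> carrier H then \<lambda>x. if x \<in> carrier X then act x h1 else undefined else undefined) x \<otimes>\<^bsub>X\<^esub>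
      (if h2 \<in> carrier H then \<lambda>x. if x \<in> carrier X then act x h2 else undefined else undefined) y) (\<Delta> h) =
    tensor_lift K H H X (\<lambda>h1 h2. act x h1 \<otimes>\<^bsub>X\<^esub> act y h2) (\<Delta> h)"
    if "x \<in> carrier X" "y \<in> carrier X" "h \<in> carrier H" for x y h
    by (rule cong_HH[OF mX b[OF that(1,2)] comult_closed[OF that(3)]]) (simp add: that)
  have "lin K H X (\<lambda>h. (\<lambda>h\<in>carrier H. \<lambda>x\<in>carrier X. act x h) h x)" if "x \<in> carrier X" for x
    using l2[OF that] that by (subst lin_cong[OF _ H_module, of _ "act x"]) auto
  moreover have "lin K X X ((\<lambda>h\<in>carrier H. \<lambda>x\<in>carrier X. act x h) h)" if "h \<in> carrier H" for h
    using l1[OF that] that by (subst lin_cong[OF _ mX, of _ "\<lambda>x. act x h"]) auto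
  ultimately show ?thesis
    using act unfolding left_action_def right_action_def
    by (auto simp: op_transparent act' restrict_def lift_eq)
qed

text \<open>The flip reverses the order of the two copies of \<open>H\<close> in \<open>(\<delta> \<otimes> id) \<circ> \<delta>\<close>, and \<open>S\<close> reverses the coproduct, so
  coassociativity persists; multiplicativity persists because \<open>S : H\<^sup>o\<^sup>p \<rightarrow> H\<close> is an algebra map.\<close>

lemma left_coaction_op:
  assumes X: "unital_algebra K X" and co: "right_coaction K Hop X \<delta>"
  shows "left_coaction K (hopf_op Hop) X (\<lambda>x\<in>carrier X. flip K X H H X (\<lambda>x. x) S (\<delta> x))"
proof -
  interpret X: ring X by (rule unital_algebra_ring[OF X])
  note mX = unital_algebra_module[OF X]
  note D = right_coactionD[OF same_coalgebra_op(1) mX co]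
  let ?\<delta> = "\<lambda>x\<in>carrier X. flip K X H H X (\<lambda>x. x) S (\<delta> x)"
  note fl = mX H_module H_module mX lin_id antipode_linear
  have \<delta>: "\<delta> x \<in> carrier (tensor_space K X H)" if "x \<in> carrier X" for x
    using lin_closed[OF D(2) that] .
  have lin: "lin K X (tensor_space K H X) ?\<delta>"
    by (subst lin_cong[OF _ mX, of _ "\<lambda>x. flip K X H H X (\<lambda>x. x) S (\<delta> x)"])
      (auto intro: lin_compose[OF flip_linear[OF fl] D(2)])
  have lift: "tensor_lift K H X P F (?\<delta> x) = tensor_lift K X H P (\<lambda>a b. F (S b) a) (\<delta> x)"
    if "x \<in> carrier X" "module K P" "bilinear K H X P F" for x F and P :: "('k, 'p, 'q) module_scheme"
    using that by (simp add: lift_flip[OF fl that(2,3)] \<delta>)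
  show ?thesis
  proof (rule left_coactionI[OF same_coalgebra_op(2) mX])
    show "?\<delta> \<in> extensional (carrier X)" by simp
    show "lin K X (tensor_space K H X) ?\<delta>" by (rule lin)
    have eq: "flip K X Hop (hopf_op Hop) X (\<lambda>x. x) S = flip K X H H X (\<lambda>x. x) S"
      by (simp add: flip_def op_transparent fun_eq_iff)
    have linS: "lin K Hop (hopf_op Hop) S"
      using antipode_linear by (simp add: module_hom_def)
    show "?\<delta> (x \<otimes>\<^bsub>X\<^esub> y) = ?\<delta> x \<otimes>\<^bsub>tensor_algebra K (hopf_op Hop) X\<^esub> ?\<delta> y"
      if "x \<in> carrier X" "y \<in> carrier X" for x y
    proof -
      note alg = X unital_algebra_op[OF H_algebra] unital_algebra_op[OF unital_algebra_op[OF H_algebra]] X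
      have "flip K X Hop (hopf_op Hop) X (\<lambda>x. x) S (\<delta> x \<otimes>\<^bsub>tensor_algebra K X Hop\<^esub> \<delta> y) =
        flip K X Hop (hopf_op Hop) X (\<lambda>x. x) S (\<delta> x) \<otimes>\<^bsub>tensor_algebra K (hopf_op Hop) X\<^esub>
        flip K X Hop (hopf_op Hop) X (\<lambda>x. x) S (\<delta> y)"
        by (rule flip_mult[OF alg lin_id linS]) (simp_all only: antipode_mult op_transparent \<delta> that hopf_op_simps)
      then show ?thesis using that D(3)[OF that] by (simp add: eq)
    qed
    show "?\<delta> \<one>\<^bsub>X\<^esub> = tens K H X \<one> \<one>\<^bsub>X\<^esub>"
      by (simp add: D(4) flip_tens[OF fl] antipode_one)
    fix x assume x: "x \<in> carrier X"
    have bc: "bilinear K H X X (\<lambda>x1 x0. \<epsilon> x1 \<odot>\<^bsub>X\<^esub> x0)"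
      by (intro lin_intros mX counit_linear)
    have "tensor_lift K H X X (\<lambda>x1 x0. \<epsilon> x1 \<odot>\<^bsub>X\<^esub> x0) (?\<delta> x) =
      tensor_lift K X H X (\<lambda>x0 x1. \<epsilon> (S x1) \<odot>\<^bsub>X\<^esub> x0) (\<delta> x)"
      by (rule lift[OF x mX bc])
    also have "\<dots> = tensor_lift K X H X (\<lambda>x0 x1. \<epsilon> x1 \<odot>\<^bsub>X\<^esub> x0) (\<delta> x)"
      by (rule lift_cong[OF mX H_module mX bilinear_flip[OF bc] \<delta>[OF x]]) (simp add: counit_antipode)
    finally show "tensor_lift K H X X (\<lambda>x1 x0. \<epsilon> x1 \<odot>\<^bsub>X\<^esub> x0) (?\<delta> x) = x"
      by (simp add: D(5) x)
  next
    fix x F and P :: "('k, ('h \<times> ('h \<times> 'x \<Rightarrow> 'k) set \<Rightarrow> 'k) set) module"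
    assume x: "x \<in> carrier X" and P: "module K P" and F: "trilinear K H H X P F"
    note F' = trilinearD[OF F]
    have tri: "trilinear K X H H P (\<lambda>a b c. F (S c) (S b) a)"
      by (intro trilinearI bilinearI lin_compose[OF F'(2)] lin_compose[OF F'(3)] F'(4) lin_intros)
    have "tensor_lift K H X P (\<lambda>x1 x0. tensor_lift K H H P (\<lambda>a b. F a b x0) (\<Delta> x1)) (?\<delta> x) =
      tensor_lift K X H P (\<lambda>x0 x1. tensor_lift K H H P (\<lambda>a b. F a b x0) (\<Delta> (S x1))) (\<delta> x)"
      by (rule lift[OF x P]) (intro lin_intros mX P F')
    also have "\<dots> = tensor_lift K X H P (\<lambda>x0 x1. tensor_lift K H H P (\<lambda>b c. F (S c) (S b) x0) (\<Delta> x1)) (\<delta> x)"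
      by (rule lift_cong[OF mX H_module P _ \<delta>[OF x]])
        ((intro lin_intros mX P trilinearD[OF tri]; assumption)+, simp add: lift_comult_antipode[OF P F'(5)])
    also have "\<dots> = tensor_lift K X H P (\<lambda>x0 x1. tensor_lift K X H P (\<lambda>a b. F (S x1) (S b) a) (\<delta> x0)) (\<delta> x)"
      by (rule D(6)[OF x P tri, symmetric])
    also have "\<dots> = tensor_lift K X H P (\<lambda>x0 x1. tensor_lift K H X P (F (S x1)) (?\<delta> x0)) (\<delta> x)"
      by (rule lift_cong[OF mX H_module P _ \<delta>[OF x], symmetric])
        ((intro lin_intros mX P trilinearD[OF tri] D(2) \<delta>; assumption)+,
          simp add: lift[OF _ P F'(1)] antipode_closed del: restrict_apply restrict_apply')
    also have "\<dots> = tensor_lift K H X P (\<lambda>x1 x0. tensor_lift K H X P (F x1) (?\<delta> x0)) (?\<delta> x)"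
      by (rule lift[OF x P, symmetric]) (intro lin_intros mX P F' lin lin_closed[OF lin])
    finally show "tensor_lift K H X P (\<lambda>x1 x0. tensor_lift K H H P (\<lambda>a b. F a b x0) (\<Delta> x1)) (?\<delta> x) =
      tensor_lift K H X P (\<lambda>x1 x0. tensor_lift K H X P (F x1) (?\<delta> x0)) (?\<delta> x)" .
  qed
qed

lemma right_coaction_op:
  assumes X: "unital_algebra K X" and co: "left_coaction K Hop X \<delta>"
  shows "right_coaction K (hopf_op Hop) X (\<lambda>x\<in>carrier X. flip K H X X H S (\<lambda>x. x) (\<delta> x))"
proof -
  interpret X: ring X by (rule unital_algebra_ring[OF X])
  note mX = unital_algebra_module[OF X]
  note D = left_coactionD[OF same_coalgebra_op(1) mX co]
  let ?\<delta> = "\<lambda>x\<in>carrier X. flip K H X X H S (\<lambda>x. x) (\<delta> x)"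
  note fl = H_module mX mX H_module antipode_linear lin_id
  have \<delta>: "\<delta> x \<in> carrier (tensor_space K H X)" if "x \<in> carrier X" for x
    using lin_closed[OF D(2) that] .
  have lin: "lin K X (tensor_space K X H) ?\<delta>"
    by (subst lin_cong[OF _ mX, of _ "\<lambda>x. flip K H X X H S (\<lambda>x. x) (\<delta> x)"])
      (auto intro: lin_compose[OF flip_linear[OF fl] D(2)])
  have lift: "tensor_lift K X H P F (?\<delta> x) = tensor_lift K H X P (\<lambda>a b. F b (S a)) (\<delta> x)"
    if "x \<in> carrier X" "module K P" "bilinear K X H P F" for x F and P :: "('k, 'p, 'q) module_scheme"
    using that by (simp add: lift_flip[OF fl that(2,3)] \<delta>)
  show ?thesis
  proof (rule right_coactionI[OF same_coalgebra_op(2) mX])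
    show "?\<delta> \<in> extensional (carrier X)" by simp
    show "lin K X (tensor_space K X H) ?\<delta>" by (rule lin)
    have eq: "flip K Hop X X (hopf_op Hop) S (\<lambda>x. x) = flip K H X X H S (\<lambda>x. x)"
      by (simp add: flip_def op_transparent fun_eq_iff)
    have linS: "lin K Hop (hopf_op Hop) S"
      using antipode_linear by (simp add: module_hom_def)
    show "?\<delta> (x \<otimes>\<^bsub>X\<^esub> y) = ?\<delta> x \<otimes>\<^bsub>tensor_algebra K X (hopf_op Hop)\<^esub> ?\<delta> y"
      if "x \<in> carrier X" "y \<in> carrier X" for x y
    proof -
      note alg = unital_algebra_op[OF H_algebra] X X unital_algebra_op[OF unital_algebra_op[OF H_algebra]]
      have "flip K Hop X X (hopf_op Hop) S (\<lambda>x. x) (\<delta> x \<otimes>\<^bsub>tensor_algebra K Hop X\<^esub> \<delta> y) =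
        flip K Hop X X (hopf_op Hop) S (\<lambda>x. x) (\<delta> x) \<otimes>\<^bsub>tensor_algebra K X (hopf_op Hop)\<^esub>
        flip K Hop X X (hopf_op Hop) S (\<lambda>x. x) (\<delta> y)"
        by (rule flip_mult[OF alg linS lin_id]) (simp_all only: antipode_mult op_transparent \<delta> that hopf_op_simps)
      then show ?thesis using that D(3)[OF that] by (simp add: eq)
    qed
    show "?\<delta> \<one>\<^bsub>X\<^esub> = tens K X H \<one>\<^bsub>X\<^esub> \<one>"
      by (simp add: D(4) flip_tens[OF fl] antipode_one)
    fix x assume x: "x \<in> carrier X"
    have bc: "bilinear K X H X (\<lambda>x0 x1. \<epsilon> x1 \<odot>\<^bsub>X\<^esub> x0)"
      by (intro lin_intros mX counit_linear)
    have "tensor_lift K X H X (\<lambda>x0 x1. \<epsilon> x1 \<odot>\<^bsub>X\<^esub> x0) (?\<delta> x) =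
      tensor_lift K H X X (\<lambda>x1 x0. \<epsilon> (S x1) \<odot>\<^bsub>X\<^esub> x0) (\<delta> x)"
      by (rule lift[OF x mX bc])
    also have "\<dots> = tensor_lift K H X X (\<lambda>x1 x0. \<epsilon> x1 \<odot>\<^bsub>X\<^esub> x0) (\<delta> x)"
      by (rule lift_cong[OF H_module mX mX bilinear_flip[OF bc] \<delta>[OF x]]) (simp add: counit_antipode)
    finally show "tensor_lift K X H X (\<lambda>x0 x1. \<epsilon> x1 \<odot>\<^bsub>X\<^esub> x0) (?\<delta> x) = x"
      by (simp add: D(5) x)
  next
    fix x F and P :: "('k, ('x \<times> ('h \<times> 'h \<Rightarrow> 'k) set \<Rightarrow> 'k) set) module"
    assume x: "x \<in> carrier X" and P: "module K P" and F: "trilinear K X H H P F"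
    note F' = trilinearD[OF F]
    have tri: "trilinear K H H X P (\<lambda>u v a. F a (S v) (S u))"
      by (intro trilinearI bilinearI lin_compose[OF F'(4)] lin_compose[OF F'(3)] F'(2) lin_intros)
    have "tensor_lift K X H P (\<lambda>x0 x1. tensor_lift K X H P (\<lambda>a b. F a b x1) (?\<delta> x0)) (?\<delta> x) =
      tensor_lift K H X P (\<lambda>x1 x0. tensor_lift K X H P (\<lambda>a b. F a b (S x1)) (?\<delta> x0)) (\<delta> x)"
      by (rule lift[OF x P]) (intro lin_intros mX P F' lin lin_closed[OF lin])
    also have "\<dots> = tensor_lift K H X P (\<lambda>x1 x0. tensor_lift K H X P (\<lambda>v a. F a (S v) (S x1)) (\<delta> x0)) (\<delta> x)"
      by (rule lift_cong[OF H_module mX P _ \<delta>[OF x]])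
        ((intro lin_intros mX P trilinearD[OF tri] D(2) \<delta>; assumption)+,
          simp add: lift[OF _ P F'(5)] antipode_closed del: restrict_apply restrict_apply')
    also have "\<dots> = tensor_lift K H X P (\<lambda>x1 x0. tensor_lift K H H P (\<lambda>u v. F x0 (S v) (S u)) (\<Delta> x1)) (\<delta> x)"
      by (rule D(6)[OF x P tri, symmetric])
    also have "\<dots> = tensor_lift K H X P (\<lambda>x1 x0. tensor_lift K H H P (F x0) (\<Delta> (S x1))) (\<delta> x)"
      by (rule lift_cong[OF H_module mX P _ \<delta>[OF x]])
        ((intro lin_intros mX P F'; assumption)+, simp add: lift_comult_antipode[OF P F'(1)])
    also have "\<dots> = tensor_lift K X H P (\<lambda>x0 x1. tensor_lift K H H P (F x0) (\<Delta> x1)) (?\<delta> x)"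
      by (rule lift[OF x P, symmetric]) (intro lin_intros mX P F')
    finally show "tensor_lift K X H P (\<lambda>x0 x1. tensor_lift K X H P (\<lambda>a b. F a b x1) (?\<delta> x0)) (?\<delta> x) =
      tensor_lift K X H P (\<lambda>x0 x1. tensor_lift K H H P (F x0) (\<Delta> x1)) (?\<delta> x)" .
  qed
qed

lemma lr_to_rl_eq: "lr_to_rl K H (X, act, \<delta>) =
    (X, \<lambda>x\<in>carrier X. \<lambda>h\<in>carrier H. act h x, \<lambda>x\<in>carrier X. flip K X H H X (\<lambda>x. x) S (\<delta> x))"
  by (simp add: lr_to_rl_def flip_def)

lemma rl_to_lr_eq: "rl_to_lr K H (X, act, \<delta>) =
    (X, \<lambda>h\<in>carrier H. \<lambda>x\<in>carrier X. act x h, \<lambda>x\<in>carrier X. flip K H X X H S (\<lambda>x. x) (\<delta> x))"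
  by (simp add: rl_to_lr_def flip_def)

text \<open>Only the compatibility condition remains.  The bimodule is \<open>H \<otimes> X\<close>, and \<open>\<phi>\<close>, \<open>\<psi>\<close> are the maps
  \<open>k \<mapsto> \<Sum> S(x\<^sub>[\<^sub>1\<^sub>]) \<otimes> (k \<rhd> x\<^sub>[\<^sub>0\<^sub>])\<close> and \<open>k \<mapsto> \<delta>\<^sub>S(k \<rhd> x)\<close>.  The image under the flip of the condition over \<open>H\<close> is
  \<open>\<phi> * S = S * \<psi>\<close>.\<close>

lemma lr_to_rl_object:
  assumes YD: "lr_yetter_drinfeld K H (X, act, \<delta>)"
  shows "rl_yetter_drinfeld K Hop (lr_to_rl K H (X, act, \<delta>))"
proof -
  have X: "unital_algebra K X" and act: "left_action K H X act" and co: "right_coaction K Hop X \<delta>"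
    using YD by (auto simp: lr_yetter_drinfeld_def)
  note mX = unital_algebra_module[OF X]
  note D = right_coactionD[OF same_coalgebra_op(1) mX co]
  let ?XH = "tensor_space K X H" and ?HX = "tensor_space K H X"
  let ?flip = "flip K X H H X (\<lambda>x. x) S"
  note fl = mX H_module H_module mX lin_id antipode_linear
  have mXH: "module K ?XH" and mHX: "module K ?HX" by (intro lin_intros mX)+
  have \<delta>: "\<delta> x \<in> carrier ?XH" if "x \<in> carrier X" for x
    using lin_closed[OF D(2) that] .
  have ac: "act h x \<in> carrier X" if "h \<in> carrier H" "x \<in> carrier X" for h x
    using act that by (auto simp: left_action_def)
  have "bilinear K H X X act"
    using act by (auto simp: left_action_def bilinear_def)
  note lact = lin_compose[OF bilinear_left[OF this]] lin_compose[OF bilinear_right[OF this]]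
  note li = lin_intros mX lact ac
  let ?l = "\<lambda>h m. tensor_lift K H X ?HX (\<lambda>a x. tens K H X (h \<otimes> a) x) m"
  let ?r = "\<lambda>m h. tensor_lift K H X ?HX (\<lambda>a x. tens K H X (a \<otimes> h) x) m"
  note bim = fst_actions[OF mX]
  have lL: "lin K ?HX ?HX (?l h)" if "h \<in> carrier H" for h by (rule bilinear_right[OF bim(1) that])
  have lR: "lin K ?HX ?HX (\<lambda>m. ?r m h)" if "h \<in> carrier H" for h by (rule bilinear_left[OF bim(2) that])
  have lt: "?l h (tens K H X a x) = tens K H X (h \<otimes> a) x" "?r (tens K H X a x) h = tens K H X (a \<otimes> h) x"
    if "h \<in> carrier H" "a \<in> carrier H" "x \<in> carrier X" for h a x
    by (rule lift_tens, (intro li mHX that; assumption)+)+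
  note fL = flip_linear[OF fl]
  have cond: "tensor_lift K H H ?HX (\<lambda>k1 k2. tensor_lift K H X ?HX
      (\<lambda>x1 x0. tens K H X (k1 \<otimes> x1) (act k2 x0)) (?flip (\<delta> x))) (\<Delta> k) =
    tensor_lift K H H ?HX (\<lambda>k1 k2. tensor_lift K H X ?HX
      (\<lambda>y1 y0. tens K H X (y1 \<otimes> k2) y0) (?flip (\<delta> (act k1 x)))) (\<Delta> k)"
    if k: "k \<in> carrier H" and x: "x \<in> carrier X" for k x
  proof -
    let ?\<phi> = "\<lambda>k. tensor_lift K X H ?HX (\<lambda>x0 x1. tens K H X (S x1) (act k x0)) (\<delta> x)"
    let ?\<psi> = "\<lambda>k. ?flip (\<delta> (act k x))"
    have l\<phi>: "lin K H ?HX ?\<phi>" by (intro li mHX \<delta> x)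
    have l\<psi>: "lin K H ?HX ?\<psi>" by (intro lin_compose[OF fL] lin_compose[OF D(2)] li x)
    have b\<phi>: "bilinear K X H ?HX (\<lambda>x0 x1. tens K H X (S x1) (act k x0))" if "k \<in> carrier H" for k
      by (intro li that)
    have l_\<phi>: "?l h (?\<phi> k) = tensor_lift K X H ?HX (\<lambda>x0 x1. tens K H X (h \<otimes> S x1) (act k x0)) (\<delta> x)"
      and r_\<phi>: "?r (?\<phi> k) h = tensor_lift K X H ?HX (\<lambda>x0 x1. tens K H X (S x1 \<otimes> h) (act k x0)) (\<delta> x)"
      if hk: "h \<in> carrier H" "k \<in> carrier H" for h k
    proof -
      have "?l h (?\<phi> k) = tensor_lift K X H ?HX (\<lambda>x0 x1. ?l h (tens K H X (S x1) (act k x0))) (\<delta> x)"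
        by (rule lin_lift_comp[OF mX H_module mHX mHX b\<phi>[OF hk(2)] lL[OF hk(1)] \<delta>[OF x]])
      also have "\<dots> = tensor_lift K X H ?HX (\<lambda>x0 x1. tens K H X (h \<otimes> S x1) (act k x0)) (\<delta> x)"
        by (rule lift_cong[OF mX H_module mHX _ \<delta>[OF x]])
          ((intro li hk; assumption)+, simp add: lt hk antipode_closed ac)
      finally show "?l h (?\<phi> k) = tensor_lift K X H ?HX (\<lambda>x0 x1. tens K H X (h \<otimes> S x1) (act k x0)) (\<delta> x)" .
      have "?r (?\<phi> k) h = tensor_lift K X H ?HX (\<lambda>x0 x1. ?r (tens K H X (S x1) (act k x0)) h) (\<delta> x)"
        by (rule lin_lift_comp[OF mX H_module mHX mHX b\<phi>[OF hk(2)] lR[OF hk(1)] \<delta>[OF x]])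
      also have "\<dots> = tensor_lift K X H ?HX (\<lambda>x0 x1. tens K H X (S x1 \<otimes> h) (act k x0)) (\<delta> x)"
        by (rule lift_cong[OF mX H_module mHX _ \<delta>[OF x]])
          ((intro li hk; assumption)+, simp add: lt hk antipode_closed ac)
      finally show "?r (?\<phi> k) h = tensor_lift K X H ?HX (\<lambda>x0 x1. tens K H X (S x1 \<otimes> h) (act k x0)) (\<delta> x)" .
    qed
    have eq: "conv ?HX ?r ?\<phi> S k = conv ?HX ?l S ?\<psi> k" if k: "k \<in> carrier H" for k
    proof -
      \<comment> \<open>The summands of the two sides of the condition over \<open>H\<close>\<close>
      let ?E1 = "\<lambda>k1 k2. tensor_lift K X H ?XH (\<lambda>x0 x1. tens K X H (act k1 x0) (k2 \<otimes> x1)) (\<delta> x)"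
      let ?E2 = "\<lambda>k1 k2. tensor_lift K X H ?XH (\<lambda>y0 y1. tens K X H y0 (y1 \<otimes> k1)) (\<delta> (act k2 x))"
      have b1: "bilinear K H H ?XH ?E1" by (intro li mXH \<delta> x)
      have b2: "bilinear K H H ?XH ?E2" by (intro li mXH \<delta> x lin_compose[OF D(2)])
      have "conv ?HX ?r ?\<phi> S k = tensor_lift K H H ?HX (\<lambda>k1 k2. ?flip (?E1 k1 k2)) (\<Delta> k)"
        unfolding conv_def
      proof (rule cong_HH[OF mHX _ comult_closed[OF k], symmetric])
        show "bilinear K H H ?HX (\<lambda>k1 k2. ?r (?\<phi> k1) (S k2))"
          by (rule conv_bilinear[OF bim(2) l\<phi> antipode_linear])
        fix k1 k2 assume kk: "k1 \<in> carrier H" "k2 \<in> carrier H"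
        have "?flip (?E1 k1 k2) = tensor_lift K X H ?HX (\<lambda>x0 x1. ?flip (tens K X H (act k1 x0) (k2 \<otimes> x1))) (\<delta> x)"
          by (rule lin_lift_comp[OF mX H_module mXH mHX _ fL \<delta>[OF x]]) (intro li kk)
        also have "\<dots> = tensor_lift K X H ?HX (\<lambda>x0 x1. tens K H X (S x1 \<otimes> S k2) (act k1 x0)) (\<delta> x)"
          by (rule lift_cong[OF mX H_module mHX _ \<delta>[OF x]])
            ((intro li kk; assumption)+, simp add: flip_tens[OF fl] kk ac antipode_mult)
        finally show "?flip (?E1 k1 k2) = ?r (?\<phi> k1) (S k2)"
          by (simp add: r_\<phi> kk antipode_closed)
      qed
      also have "\<dots> = ?flip (tensor_lift K H H ?XH ?E1 (\<Delta> k))"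
        by (rule comp_HH[OF mXH mHX b1 fL comult_closed[OF k], symmetric])
      also have "tensor_lift K H H ?XH ?E1 (\<Delta> k) = tensor_lift K H H ?XH ?E2 (\<Delta> k)"
        using YD k x by (simp add: lr_yetter_drinfeld_def)
      also have "?flip (tensor_lift K H H ?XH ?E2 (\<Delta> k)) = tensor_lift K H H ?HX (\<lambda>k1 k2. ?flip (?E2 k1 k2)) (\<Delta> k)"
        by (rule comp_HH[OF mXH mHX b2 fL comult_closed[OF k]])
      also have "\<dots> = conv ?HX ?l S ?\<psi> k"
        unfolding conv_def
      proof (rule cong_HH[OF mHX _ comult_closed[OF k]])
        show "bilinear K H H ?HX (\<lambda>k1 k2. ?l (S k1) (?\<psi> k2))"
          by (rule conv_bilinear[OF bim(1) antipode_linear l\<psi>])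
        fix k1 k2 assume kk: "k1 \<in> carrier H" "k2 \<in> carrier H"
        note t = \<delta>[OF ac[OF kk(2) x]]
        have "?flip (?E2 k1 k2) = tensor_lift K X H ?HX (\<lambda>y0 y1. ?flip (tens K X H y0 (y1 \<otimes> k1))) (\<delta> (act k2 x))"
          by (rule lin_lift_comp[OF mX H_module mXH mHX _ fL t]) (intro li kk)
        also have "\<dots> = tensor_lift K X H ?HX (\<lambda>y0 y1. tens K H X (S k1 \<otimes> S y1) y0) (\<delta> (act k2 x))"
          by (rule lift_cong[OF mX H_module mHX _ t])
            ((intro li kk; assumption)+, simp add: flip_tens[OF fl] kk ac antipode_mult)
        also have "\<dots> = ?l (S k1) (?\<psi> k2)"
          by (rule lift_flip[OF fl mHX _ t, symmetric]) (intro li kk)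
        finally show "?flip (?E2 k1 k2) = ?l (S k1) (?\<psi> k2)" .
      qed
      finally show ?thesis .
    qed
    have "conv ?HX ?l idH ?\<phi> k = conv ?HX ?r ?\<psi> idH k"
      by (rule conv_intertwine[OF mHX bim l\<phi> l\<psi> eq k])
    moreover have "tensor_lift K H H ?HX (\<lambda>k1 k2. tensor_lift K H X ?HX
        (\<lambda>x1 x0. tens K H X (k1 \<otimes> x1) (act k2 x0)) (?flip (\<delta> x))) (\<Delta> k) = conv ?HX ?l idH ?\<phi> k"
      unfolding conv_def
    proof (rule cong_HH[OF mHX conv_bilinear[OF bim(1) lin_id l\<phi>] comult_closed[OF k]])
      fix k1 k2 assume kk: "k1 \<in> carrier H" "k2 \<in> carrier H"
      have "bilinear K H X ?HX (\<lambda>x1 x0. tens K H X (k1 \<otimes> x1) (act k2 x0))" by (intro li kk)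
      then show "tensor_lift K H X ?HX (\<lambda>x1 x0. tens K H X (k1 \<otimes> x1) (act k2 x0)) (?flip (\<delta> x)) = ?l k1 (?\<phi> k2)"
        by (simp add: l_\<phi> kk lift_flip[OF fl mHX _ \<delta>[OF x]])
    qed
    ultimately show ?thesis by (simp add: conv_def)
  qed
  \<comment> \<open>The same condition with action and coaction restricted to the carriers\<close>
  have cond': "tensor_lift K H H ?HX (\<lambda>k1 k2. tensor_lift K H X ?HX
      (\<lambda>x1 x0. tens K H X (k1 \<otimes> x1) ((\<lambda>x\<in>carrier X. \<lambda>h\<in>carrier H. act h x) x0 k2)) (?flip (\<delta> x))) (\<Delta> k) =
    tensor_lift K H H ?HX (\<lambda>k1 k2. tensor_lift K H X ?HX
      (\<lambda>y1 y0. tens K H X (y1 \<otimes> k2) y0)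
        ((\<lambda>x\<in>carrier X. ?flip (\<delta> x)) ((\<lambda>x\<in>carrier X. \<lambda>h\<in>carrier H. act h x) x k1))) (\<Delta> k)"
    if k: "k \<in> carrier H" and x: "x \<in> carrier X" for k x
  proof -
    have fx: "?flip (\<delta> x) \<in> carrier ?HX" by (rule lin_closed[OF fL \<delta>[OF x]])
    have "tensor_lift K H H ?HX (\<lambda>k1 k2. tensor_lift K H X ?HX
      (\<lambda>x1 x0. tens K H X (k1 \<otimes> x1) ((\<lambda>x\<in>carrier X. \<lambda>h\<in>carrier H. act h x) x0 k2)) (?flip (\<delta> x))) (\<Delta> k) =
      tensor_lift K H H ?HX (\<lambda>k1 k2. tensor_lift K H X ?HX
      (\<lambda>x1 x0. tens K H X (k1 \<otimes> x1) (act k2 x0)) (?flip (\<delta> x))) (\<Delta> k)"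
      by (rule cong_HH[OF mHX _ comult_closed[OF k]], (intro li mHX fx; assumption)+,
          rule lift_cong[OF H_module mX mHX _ fx], (intro li; assumption)+, simp)
    also have "\<dots> = tensor_lift K H H ?HX (\<lambda>k1 k2. tensor_lift K H X ?HX
      (\<lambda>y1 y0. tens K H X (y1 \<otimes> k2) y0) (?flip (\<delta> (act k1 x)))) (\<Delta> k)"
      by (rule cond[OF k x])
    also have "\<dots> = tensor_lift K H H ?HX (\<lambda>k1 k2. tensor_lift K H X ?HX
      (\<lambda>y1 y0. tens K H X (y1 \<otimes> k2) y0)
        ((\<lambda>x\<in>carrier X. ?flip (\<delta> x)) ((\<lambda>x\<in>carrier X. \<lambda>h\<in>carrier H. act h x) x k1))) (\<Delta> k)"
      by (rule cong_HH[OF mHX _ comult_closed[OF k], symmetric])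
        ((intro li mHX lin_compose[OF fL] lin_compose[OF D(2)] lin_closed[OF fL] \<delta> x; assumption)+, simp add: x ac)
    finally show ?thesis .
  qed
  show ?thesis
    unfolding lr_to_rl_eq rl_yetter_drinfeld_def
    using X right_action_op[OF X act] left_coaction_op[OF X co] cond'
    by (simp add: op_transparent)
qed

text \<open>Here the bimodule is \<open>X \<otimes> H\<close>, and the coproduct legs in the compatibility condition occur in the other
  order, so that \<open>\<phi>\<close> and \<open>\<psi>\<close> exchange their roles: the condition over \<open>H\<close> gives \<open>\<psi> * S = S * \<phi>\<close>, and the
  one over \<open>H\<^sup>o\<^sup>p\<close> is \<open>id * \<psi> = \<phi> * id\<close>.\<close>

lemma rl_to_lr_object:
  assumes YD: "rl_yetter_drinfeld K H (X, act, \<delta>)"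
  shows "lr_yetter_drinfeld K Hop (rl_to_lr K H (X, act, \<delta>))"
proof -
  have X: "unital_algebra K X" and act: "right_action K H X act" and co: "left_coaction K Hop X \<delta>"
    using YD by (auto simp: rl_yetter_drinfeld_def)
  note mX = unital_algebra_module[OF X]
  note D = left_coactionD[OF same_coalgebra_op(1) mX co]
  let ?XH = "tensor_space K X H" and ?HX = "tensor_space K H X"
  let ?flip = "flip K H X X H S (\<lambda>x. x)"
  note fl = H_module mX mX H_module antipode_linear lin_id
  have mXH: "module K ?XH" and mHX: "module K ?HX" by (intro lin_intros mX)+
  have \<delta>: "\<delta> x \<in> carrier ?HX" if "x \<in> carrier X" for x
    using lin_closed[OF D(2) that] .
  have ac: "act x h \<in> carrier X" if "h \<in> carrier H" "x \<in> carrier X" for h x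
    using act that by (auto simp: right_action_def)
  have "bilinear K X H X act"
    using act by (auto simp: right_action_def bilinear_def)
  note lact = lin_compose[OF bilinear_left[OF this]] lin_compose[OF bilinear_right[OF this]]
  note li = lin_intros mX lact ac
  let ?l = "\<lambda>h m. tensor_lift K X H ?XH (\<lambda>x a. tens K X H x (h \<otimes> a)) m"
  let ?r = "\<lambda>m h. tensor_lift K X H ?XH (\<lambda>x a. tens K X H x (a \<otimes> h)) m"
  note bim = snd_actions[OF mX]
  have lL: "lin K ?XH ?XH (?l h)" if "h \<in> carrier H" for h by (rule bilinear_right[OF bim(1) that])
  have lR: "lin K ?XH ?XH (\<lambda>m. ?r m h)" if "h \<in> carrier H" for h by (rule bilinear_left[OF bim(2) that])
  have lt: "?l h (tens K X H x a) = tens K X H x (h \<otimes> a)" "?r (tens K X H x a) h = tens K X H x (a \<otimes> h)"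
    if "h \<in> carrier H" "a \<in> carrier H" "x \<in> carrier X" for h a x
    by (rule lift_tens, (intro li mXH that; assumption)+)+
  note fL = flip_linear[OF fl]
  have cond: "tensor_lift K H H ?XH (\<lambda>k1 k2. tensor_lift K X H ?XH
      (\<lambda>x0 x1. tens K X H (act x0 k1) (x1 \<otimes> k2)) (?flip (\<delta> x))) (\<Delta> k) =
    tensor_lift K H H ?XH (\<lambda>k1 k2. tensor_lift K X H ?XH
      (\<lambda>y0 y1. tens K X H y0 (k1 \<otimes> y1)) (?flip (\<delta> (act x k2)))) (\<Delta> k)"
    if k: "k \<in> carrier H" and x: "x \<in> carrier X" for k x
  proof -
    let ?\<phi> = "\<lambda>k. tensor_lift K H X ?XH (\<lambda>x1 x0. tens K X H (act x0 k) (S x1)) (\<delta> x)"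
    let ?\<psi> = "\<lambda>k. ?flip (\<delta> (act x k))"
    have l\<phi>: "lin K H ?XH ?\<phi>" by (intro li mXH \<delta> x)
    have l\<psi>: "lin K H ?XH ?\<psi>" by (intro lin_compose[OF fL] lin_compose[OF D(2)] li x)
    have b\<phi>: "bilinear K H X ?XH (\<lambda>x1 x0. tens K X H (act x0 k) (S x1))" if "k \<in> carrier H" for k
      by (intro li that)
    have l_\<phi>: "?l h (?\<phi> k) = tensor_lift K H X ?XH (\<lambda>x1 x0. tens K X H (act x0 k) (h \<otimes> S x1)) (\<delta> x)"
      and r_\<phi>: "?r (?\<phi> k) h = tensor_lift K H X ?XH (\<lambda>x1 x0. tens K X H (act x0 k) (S x1 \<otimes> h)) (\<delta> x)"
      if hk: "h \<in> carrier H" "k \<in> carrier H" for h k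
    proof -
      have "?l h (?\<phi> k) = tensor_lift K H X ?XH (\<lambda>x1 x0. ?l h (tens K X H (act x0 k) (S x1))) (\<delta> x)"
        by (rule lin_lift_comp[OF H_module mX mXH mXH b\<phi>[OF hk(2)] lL[OF hk(1)] \<delta>[OF x]])
      also have "\<dots> = tensor_lift K H X ?XH (\<lambda>x1 x0. tens K X H (act x0 k) (h \<otimes> S x1)) (\<delta> x)"
        by (rule lift_cong[OF H_module mX mXH _ \<delta>[OF x]])
          ((intro li hk; assumption)+, simp add: lt hk antipode_closed ac)
      finally show "?l h (?\<phi> k) = tensor_lift K H X ?XH (\<lambda>x1 x0. tens K X H (act x0 k) (h \<otimes> S x1)) (\<delta> x)" .
      have "?r (?\<phi> k) h = tensor_lift K H X ?XH (\<lambda>x1 x0. ?r (tens K X H (act x0 k) (S x1)) h) (\<delta> x)"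
        by (rule lin_lift_comp[OF H_module mX mXH mXH b\<phi>[OF hk(2)] lR[OF hk(1)] \<delta>[OF x]])
      also have "\<dots> = tensor_lift K H X ?XH (\<lambda>x1 x0. tens K X H (act x0 k) (S x1 \<otimes> h)) (\<delta> x)"
        by (rule lift_cong[OF H_module mX mXH _ \<delta>[OF x]])
          ((intro li hk; assumption)+, simp add: lt hk antipode_closed ac)
      finally show "?r (?\<phi> k) h = tensor_lift K H X ?XH (\<lambda>x1 x0. tens K X H (act x0 k) (S x1 \<otimes> h)) (\<delta> x)" .
    qed
    have eq: "conv ?XH ?r ?\<psi> S k = conv ?XH ?l S ?\<phi> k" if k: "k \<in> carrier H" for k
    proof -
      \<comment> \<open>The summands of the two sides of the condition over \<open>H\<close>\<close>
      let ?E1 = "\<lambda>k1 k2. tensor_lift K H X ?HX (\<lambda>x1 x0. tens K H X (x1 \<otimes> k1) (act x0 k2)) (\<delta> x)"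
      let ?E2 = "\<lambda>k1 k2. tensor_lift K H X ?HX (\<lambda>y1 y0. tens K H X (k2 \<otimes> y1) y0) (\<delta> (act x k1))"
      have b1: "bilinear K H H ?HX ?E1" by (intro li mHX \<delta> x)
      have b2: "bilinear K H H ?HX ?E2" by (intro li mHX \<delta> x lin_compose[OF D(2)])
      have "conv ?XH ?l S ?\<phi> k = tensor_lift K H H ?XH (\<lambda>k1 k2. ?flip (?E1 k1 k2)) (\<Delta> k)"
        unfolding conv_def
      proof (rule cong_HH[OF mXH _ comult_closed[OF k], symmetric])
        show "bilinear K H H ?XH (\<lambda>k1 k2. ?l (S k1) (?\<phi> k2))"
          by (rule conv_bilinear[OF bim(1) antipode_linear l\<phi>])
        fix k1 k2 assume kk: "k1 \<in> carrier H" "k2 \<in> carrier H"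
        have "?flip (?E1 k1 k2) = tensor_lift K H X ?XH (\<lambda>x1 x0. ?flip (tens K H X (x1 \<otimes> k1) (act x0 k2))) (\<delta> x)"
          by (rule lin_lift_comp[OF H_module mX mHX mXH _ fL \<delta>[OF x]]) (intro li kk)
        also have "\<dots> = tensor_lift K H X ?XH (\<lambda>x1 x0. tens K X H (act x0 k2) (S k1 \<otimes> S x1)) (\<delta> x)"
          by (rule lift_cong[OF H_module mX mXH _ \<delta>[OF x]])
            ((intro li kk; assumption)+, simp add: flip_tens[OF fl] kk ac antipode_mult)
        finally show "?flip (?E1 k1 k2) = ?l (S k1) (?\<phi> k2)"
          by (simp add: l_\<phi> kk antipode_closed)
      qed
      also have "\<dots> = ?flip (tensor_lift K H H ?HX ?E1 (\<Delta> k))"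
        by (rule comp_HH[OF mHX mXH b1 fL comult_closed[OF k], symmetric])
      also have "tensor_lift K H H ?HX ?E1 (\<Delta> k) = tensor_lift K H H ?HX ?E2 (\<Delta> k)"
        using YD k x by (simp add: rl_yetter_drinfeld_def)
      also have "?flip (tensor_lift K H H ?HX ?E2 (\<Delta> k)) = tensor_lift K H H ?XH (\<lambda>k1 k2. ?flip (?E2 k1 k2)) (\<Delta> k)"
        by (rule comp_HH[OF mHX mXH b2 fL comult_closed[OF k]])
      also have "\<dots> = conv ?XH ?r ?\<psi> S k"
        unfolding conv_def
      proof (rule cong_HH[OF mXH _ comult_closed[OF k]])
        show "bilinear K H H ?XH (\<lambda>k1 k2. ?r (?\<psi> k1) (S k2))"
          by (rule conv_bilinear[OF bim(2) l\<psi> antipode_linear])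
        fix k1 k2 assume kk: "k1 \<in> carrier H" "k2 \<in> carrier H"
        note t = \<delta>[OF ac[OF kk(1) x]]
        have "?flip (?E2 k1 k2) = tensor_lift K H X ?XH (\<lambda>y1 y0. ?flip (tens K H X (k2 \<otimes> y1) y0)) (\<delta> (act x k1))"
          by (rule lin_lift_comp[OF H_module mX mHX mXH _ fL t]) (intro li kk)
        also have "\<dots> = tensor_lift K H X ?XH (\<lambda>y1 y0. tens K X H y0 (S y1 \<otimes> S k2)) (\<delta> (act x k1))"
          by (rule lift_cong[OF H_module mX mXH _ t])
            ((intro li kk; assumption)+, simp add: flip_tens[OF fl] kk ac antipode_mult)
        also have "\<dots> = ?r (?\<psi> k1) (S k2)"
          by (rule lift_flip[OF fl mXH _ t, symmetric]) (intro li kk)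
        finally show "?flip (?E2 k1 k2) = ?r (?\<psi> k1) (S k2)" .
      qed
      finally show ?thesis by (rule sym)
    qed
    have "conv ?XH ?l idH ?\<psi> k = conv ?XH ?r ?\<phi> idH k"
      by (rule conv_intertwine[OF mXH bim l\<psi> l\<phi> eq k])
    moreover have "tensor_lift K H H ?XH (\<lambda>k1 k2. tensor_lift K X H ?XH
        (\<lambda>x0 x1. tens K X H (act x0 k1) (x1 \<otimes> k2)) (?flip (\<delta> x))) (\<Delta> k) = conv ?XH ?r ?\<phi> idH k"
      unfolding conv_def
    proof (rule cong_HH[OF mXH conv_bilinear[OF bim(2) l\<phi> lin_id] comult_closed[OF k]])
      fix k1 k2 assume kk: "k1 \<in> carrier H" "k2 \<in> carrier H"
      have "bilinear K X H ?XH (\<lambda>x0 x1. tens K X H (act x0 k1) (x1 \<otimes> k2))" by (intro li kk)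
      then show "tensor_lift K X H ?XH (\<lambda>x0 x1. tens K X H (act x0 k1) (x1 \<otimes> k2)) (?flip (\<delta> x)) = ?r (?\<phi> k1) k2"
        by (simp add: r_\<phi> kk lift_flip[OF fl mXH _ \<delta>[OF x]])
    qed
    ultimately show ?thesis by (simp add: conv_def)
  qed
  \<comment> \<open>The same condition with action and coaction restricted to the carriers\<close>
  have cond': "tensor_lift K H H ?XH (\<lambda>k1 k2. tensor_lift K X H ?XH
      (\<lambda>x0 x1. tens K X H ((\<lambda>h\<in>carrier H. \<lambda>x\<in>carrier X. act x h) k1 x0) (x1 \<otimes> k2)) (?flip (\<delta> x))) (\<Delta> k) =
    tensor_lift K H H ?XH (\<lambda>k1 k2. tensor_lift K X H ?XH
      (\<lambda>y0 y1. tens K X H y0 (k1 \<otimes> y1))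
        ((\<lambda>x\<in>carrier X. ?flip (\<delta> x)) ((\<lambda>h\<in>carrier H. \<lambda>x\<in>carrier X. act x h) k2 x))) (\<Delta> k)"
    if k: "k \<in> carrier H" and x: "x \<in> carrier X" for k x
  proof -
    have fx: "?flip (\<delta> x) \<in> carrier ?XH" by (rule lin_closed[OF fL \<delta>[OF x]])
    have "tensor_lift K H H ?XH (\<lambda>k1 k2. tensor_lift K X H ?XH
      (\<lambda>x0 x1. tens K X H ((\<lambda>h\<in>carrier H. \<lambda>x\<in>carrier X. act x h) k1 x0) (x1 \<otimes> k2)) (?flip (\<delta> x))) (\<Delta> k) =
      tensor_lift K H H ?XH (\<lambda>k1 k2. tensor_lift K X H ?XH
      (\<lambda>x0 x1. tens K X H (act x0 k1) (x1 \<otimes> k2)) (?flip (\<delta> x))) (\<Delta> k)"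
      by (rule cong_HH[OF mXH _ comult_closed[OF k]], (intro li mXH fx; assumption)+,
          rule lift_cong[OF mX H_module mXH _ fx], (intro li; assumption)+, simp)
    also have "\<dots> = tensor_lift K H H ?XH (\<lambda>k1 k2. tensor_lift K X H ?XH
      (\<lambda>y0 y1. tens K X H y0 (k1 \<otimes> y1)) (?flip (\<delta> (act x k2)))) (\<Delta> k)"
      by (rule cond[OF k x])
    also have "\<dots> = tensor_lift K H H ?XH (\<lambda>k1 k2. tensor_lift K X H ?XH
      (\<lambda>y0 y1. tens K X H y0 (k1 \<otimes> y1))
        ((\<lambda>x\<in>carrier X. ?flip (\<delta> x)) ((\<lambda>h\<in>carrier H. \<lambda>x\<in>carrier X. act x h) k2 x))) (\<Delta> k)"
      by (rule cong_HH[OF mXH _ comult_closed[OF k], symmetric])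
        ((intro li mXH lin_compose[OF fL] lin_compose[OF D(2)] lin_closed[OF fL] \<delta> x; assumption)+, simp add: x ac)
    finally show ?thesis .
  qed
  show ?thesis
    unfolding rl_to_lr_eq lr_yetter_drinfeld_def
    using X left_action_op[OF X act] right_coaction_op[OF X co] cond'
    by (simp add: op_transparent)
qed

end

section \<open>The categories of Yetter--Drinfeld algebras\<close>

lemma naturally_isomorphic_id:
  assumes "is_category C"
  shows "naturally_isomorphic (id_functor C) (id_functor C)"
proof -
  have "isomorphism C X X (ident C X)" if "X \<in> Obj C" for X
    using assms that unfolding is_category_def isomorphism_def by blast
  moreover have "cmp C X X Y f (ident C X) = cmp C X Y Y (ident C Y) f"
    if "X \<in> Obj C" "Y \<in> Obj C" "f \<in> Hom C X Y" for X Y f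
    using assms that unfolding is_category_def by metis
  ultimately show ?thesis
    unfolding naturally_isomorphic_def by (auto simp: id_functor_def intro!: exI[of _ "ident C"])
qed

text \<open>When both composites are identities, the identity morphisms are natural isomorphisms.\<close>

lemma equivalence_of_inverse_functors:
  assumes "is_functor F" "is_functor G" "src G = tgt F" "tgt G = src F"
    and "comp_functor G F = id_functor (src F)" "comp_functor F G = id_functor (tgt F)"
  shows "equivalence_of_categories F"
proof -
  have "is_category (src F)" "is_category (tgt F)" using assms(1) by (simp_all add: is_functor_def)
  then have "naturally_isomorphic (comp_functor G F) (id_functor (src F))"
    "naturally_isomorphic (comp_functor F G) (id_functor (tgt F))"
    unfolding assms(5,6) by (simp_all add: naturally_isomorphic_id)
  with assms(1-4) show ?thesis unfolding equivalence_of_categories_def by blast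
qed

lemma algebra_hom_compose:
  assumes "f \<in> algebra_hom K A B" "g \<in> algebra_hom K B C" "unital_algebra K A"
  shows "compose (carrier A) g f \<in> algebra_hom K A C"
proof -
  interpret A: ring A by (rule unital_algebra_ring[OF assms(3)])
  note f = algebra_homD[OF assms(1)] and g = algebra_homD[OF assms(2)]
  show ?thesis
  proof (rule algebra_homI)
    show "lin K A C (compose (carrier A) g f)"
      by (subst lin_cong[OF _ unital_algebra_module[OF assms(3)], of _ "\<lambda>x. g (f x)"])
        (auto simp: compose_def intro: lin_compose[OF g(1) f(1)])
  qed (auto simp: compose_def f g lin_closed[OF f(1)])
qed

lemma algebra_hom_restrict_id:
  assumes "unital_algebra K A"
  shows "(\<lambda>x\<in>carrier A. x) \<in> algebra_hom K A A"
proof -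
  interpret A: ring A by (rule unital_algebra_ring[OF assms])
  show ?thesis
  proof (rule algebra_homI)
    show "lin K A A (\<lambda>x\<in>carrier A. x)"
      by (subst lin_cong[OF _ unital_algebra_module[OF assms], of _ "\<lambda>x. x"]) (auto intro: lin_id)
  qed auto
qed

lemma tensor_map_lift:
  assumes m: "module K A" "module K B" "module K C" "module K D" and l: "lin K A C f" "lin K B D g"
    and eq: "\<And>a. a \<in> carrier A \<Longrightarrow> f' a = f a" "\<And>b. b \<in> carrier B \<Longrightarrow> g' b = g b"
    and t: "t \<in> carrier (tensor_space K A B)"
  shows "tensor_map K A B C D f' g' t = tensor_lift K A B (tensor_space K C D) (\<lambda>a b. tens K C D (f a) (g b)) t"
  unfolding tensor_map_def
  by (rule lift_cong[OF m(1,2) tensor_module[OF m(3,4)] _ t])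
    ((intro lin_intros m l lin_closed[OF l(1)] lin_closed[OF l(2)]; assumption)+, simp add: eq)

lemma tensor_map_identity:
  assumes m: "module K A" "module K B" and eq: "\<And>a. a \<in> carrier A \<Longrightarrow> f a = a" "\<And>b. b \<in> carrier B \<Longrightarrow> g b = b"
    and t: "t \<in> carrier (tensor_space K A B)"
  shows "tensor_map K A B A B f g t = t"
  by (simp add: tensor_map_lift[OF m m lin_id lin_id eq t] lift_tens_id[OF m t])

lemma tensor_map_compose:
  assumes m: "module K A" "module K B" "module K C" "module K D" "module K E" "module K F"
    and l: "lin K A C f" "lin K B D g" "lin K C E f'" "lin K D F g'"
    and eq: "\<And>a. a \<in> carrier A \<Longrightarrow> k a = f' (f a)" "\<And>b. b \<in> carrier B \<Longrightarrow> k' b = g' (g b)"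
    and t: "t \<in> carrier (tensor_space K A B)"
  shows "tensor_map K A B E F k k' t = tensor_map K C D E F f' g' (tensor_map K A B C D f g t)"
proof -
  have b: "bilinear K C D (tensor_space K E F) (\<lambda>a b. tens K E F (f' a) (g' b))"
    by (intro lin_intros m l lin_closed[OF l(3)] lin_closed[OF l(4)])
  have "tensor_map K C D E F f' g' (tensor_map K A B C D f g t) =
    tensor_lift K A B (tensor_space K E F) (\<lambda>a b. tens K E F (f' (f a)) (g' (g b))) t"
    unfolding tensor_map_def[of K C D E F]
    by (rule lift_tensor_map[OF m(1-4) tensor_module[OF m(5,6)] l(1,2) b t])
  then show ?thesis
    using tensor_map_lift[OF m(1,2,5,6) lin_compose[OF l(3,1)] lin_compose[OF l(4,2)] eq t] by simp
qed

context hopf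
begin

lemma lr_objectD:
  assumes "lr_yetter_drinfeld K H (X, act, \<delta>)"
  shows "unital_algebra K X" "module K X" "lin K X (tensor_space K X H) \<delta>" "\<delta> \<in> extensional (carrier X)"
    and "act \<in> carrier H \<rightarrow>\<^sub>E carrier X \<rightarrow>\<^sub>E carrier X"
proof -
  have X: "unital_algebra K X" and co: "right_coaction K (hopf_op H) X \<delta>"
    and act: "left_action K H X act" using assms by (auto simp: lr_yetter_drinfeld_def)
  show "unital_algebra K X" "module K X" using X unital_algebra_module by auto
  then show "lin K X (tensor_space K X H) \<delta>" "\<delta> \<in> extensional (carrier X)"
    using right_coactionD[OF same_coalgebra_op(1) _ co] by auto
  show "act \<in> carrier H \<rightarrow>\<^sub>E carrier X \<rightarrow>\<^sub>E carrier X" using act by (simp add: left_action_def)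
qed

lemma rl_objectD:
  assumes "rl_yetter_drinfeld K H (X, act, \<delta>)"
  shows "unital_algebra K X" "module K X" "lin K X (tensor_space K H X) \<delta>" "\<delta> \<in> extensional (carrier X)"
    and "act \<in> carrier X \<rightarrow>\<^sub>E carrier H \<rightarrow>\<^sub>E carrier X"
proof -
  have X: "unital_algebra K X" and co: "left_coaction K (hopf_op H) X \<delta>"
    and act: "right_action K H X act" using assms by (auto simp: rl_yetter_drinfeld_def)
  show "unital_algebra K X" "module K X" using X unital_algebra_module by auto
  then show "lin K X (tensor_space K H X) \<delta>" "\<delta> \<in> extensional (carrier X)"
    using left_coactionD[OF same_coalgebra_op(1) _ co] by auto
  show "act \<in> carrier X \<rightarrow>\<^sub>E carrier H \<rightarrow>\<^sub>E carrier X" using act by (simp add: right_action_def)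
qed

lemma lr_YD_simps:
  "A \<in> Obj (lr_YD K H) \<longleftrightarrow> lr_yetter_drinfeld K H A"
  "f \<in> Hom (lr_YD K H) (X, act, \<delta>) (Y, act', \<delta>') \<longleftrightarrow>
    f \<in> extensional (carrier X) \<and> f \<in> algebra_hom K X Y \<and>
    (\<forall>h\<in>carrier H. \<forall>x\<in>carrier X. f (act h x) = act' h (f x)) \<and>
    (\<forall>x\<in>carrier X. tensor_map K X H Y H f id (\<delta> x) = \<delta>' (f x))"
  "ident (lr_YD K H) (X, act, \<delta>) = (\<lambda>x\<in>carrier X. x)"
  "cmp (lr_YD K H) (X, act, \<delta>) B C g f = compose (carrier X) g f"
  by (simp_all add: lr_YD_def)

lemma rl_YD_simps:
  "A \<in> Obj (rl_YD K H) \<longleftrightarrow> rl_yetter_drinfeld K H A"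
  "f \<in> Hom (rl_YD K H) (X, ract, \<gamma>) (Y, ract', \<gamma>') \<longleftrightarrow>
    f \<in> extensional (carrier X) \<and> f \<in> algebra_hom K X Y \<and>
    (\<forall>h\<in>carrier H. \<forall>x\<in>carrier X. f (ract x h) = ract' (f x) h) \<and>
    (\<forall>x\<in>carrier X. tensor_map K H X H Y id f (\<gamma> x) = \<gamma>' (f x))"
  "ident (rl_YD K H) (X, ract, \<gamma>) = (\<lambda>x\<in>carrier X. x)"
  "cmp (rl_YD K H) (X, ract, \<gamma>) B C g f = compose (carrier X) g f"
  by (simp_all add: rl_YD_def)

lemma lr_YD_ident:
  assumes A: "lr_yetter_drinfeld K H (X, act, \<delta>)"
  shows "(\<lambda>x\<in>carrier X. x) \<in> Hom (lr_YD K H) (X, act, \<delta>) (X, act, \<delta>)"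
proof -
  note D = lr_objectD[OF A]
  have "tensor_map K X H X H (\<lambda>x\<in>carrier X. x) id (\<delta> x) = \<delta> x" if "x \<in> carrier X" for x
    by (rule tensor_map_identity[OF D(2) H_module _ _ lin_closed[OF D(3) that]]) simp_all
  moreover have "act h x \<in> carrier X" if "h \<in> carrier H" "x \<in> carrier X" for h x
    using D(5) that by auto
  ultimately show ?thesis
    by (simp add: lr_YD_simps algebra_hom_restrict_id[OF D(1)])
qed

lemma rl_YD_ident:
  assumes A: "rl_yetter_drinfeld K H (X, act, \<delta>)"
  shows "(\<lambda>x\<in>carrier X. x) \<in> Hom (rl_YD K H) (X, act, \<delta>) (X, act, \<delta>)"
proof -
  note D = rl_objectD[OF A]
  have "tensor_map K H X H X id (\<lambda>x\<in>carrier X. x) (\<delta> x) = \<delta> x" if "x \<in> carrier X" for x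
    by (rule tensor_map_identity[OF H_module D(2) _ _ lin_closed[OF D(3) that]]) simp_all
  moreover have "act x h \<in> carrier X" if "h \<in> carrier H" "x \<in> carrier X" for h x
    using D(5) that by auto
  ultimately show ?thesis
    by (simp add: rl_YD_simps algebra_hom_restrict_id[OF D(1)])
qed

lemma lr_YD_compose:
  assumes A: "lr_yetter_drinfeld K H (X, act, \<delta>)" and B: "lr_yetter_drinfeld K H (Y, act', \<delta>')"
    and C: "lr_yetter_drinfeld K H (Z, act'', \<delta>'')"
    and f: "f \<in> Hom (lr_YD K H) (X, act, \<delta>) (Y, act', \<delta>')"
    and g: "g \<in> Hom (lr_YD K H) (Y, act', \<delta>') (Z, act'', \<delta>'')"
  shows "compose (carrier X) g f \<in> Hom (lr_YD K H) (X, act, \<delta>) (Z, act'', \<delta>'')"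
proof -
  note D = lr_objectD[OF A] and E = lr_objectD[OF B] and F = lr_objectD[OF C]
  have fh: "f \<in> algebra_hom K X Y" and gh: "g \<in> algebra_hom K Y Z"
    using f g by (auto simp: lr_YD_simps)
  note fl = algebra_homD(1)[OF fh] and gl = algebra_homD(1)[OF gh]
  have "tensor_map K X H Z H (compose (carrier X) g f) id (\<delta> x) = \<delta>'' (compose (carrier X) g f x)"
    if x: "x \<in> carrier X" for x
  proof -
    have "tensor_map K X H Z H (compose (carrier X) g f) id (\<delta> x) =
      tensor_map K Y H Z H g id (tensor_map K X H Y H f id (\<delta> x))"
      by (rule tensor_map_compose[OF D(2) H_module E(2) H_module F(2) H_module fl _ gl _ _ _ lin_closed[OF D(3) x]])
        (auto simp: compose_def id_def lin_id)
    then show ?thesis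
      using f g x lin_closed[OF fl x] by (simp add: lr_YD_simps compose_def)
  qed
  moreover have "act h x \<in> carrier X" if "h \<in> carrier H" "x \<in> carrier X" for h x
    using D(5) that by auto
  ultimately show ?thesis
    using f g lin_closed[OF fl] algebra_hom_compose[OF fh gh D(1)]
    by (simp add: lr_YD_simps compose_eq)
qed

lemma rl_YD_compose:
  assumes A: "rl_yetter_drinfeld K H (X, act, \<delta>)" and B: "rl_yetter_drinfeld K H (Y, act', \<delta>')"
    and C: "rl_yetter_drinfeld K H (Z, act'', \<delta>'')"
    and f: "f \<in> Hom (rl_YD K H) (X, act, \<delta>) (Y, act', \<delta>')"
    and g: "g \<in> Hom (rl_YD K H) (Y, act', \<delta>') (Z, act'', \<delta>'')"
  shows "compose (carrier X) g f \<in> Hom (rl_YD K H) (X, act, \<delta>) (Z, act'', \<delta>'')"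
proof -
  note D = rl_objectD[OF A] and E = rl_objectD[OF B] and F = rl_objectD[OF C]
  have fh: "f \<in> algebra_hom K X Y" and gh: "g \<in> algebra_hom K Y Z"
    using f g by (auto simp: rl_YD_simps)
  note fl = algebra_homD(1)[OF fh] and gl = algebra_homD(1)[OF gh]
  have "tensor_map K H X H Z id (compose (carrier X) g f) (\<delta> x) = \<delta>'' (compose (carrier X) g f x)"
    if x: "x \<in> carrier X" for x
  proof -
    have "tensor_map K H X H Z id (compose (carrier X) g f) (\<delta> x) =
      tensor_map K H Y H Z id g (tensor_map K H X H Y id f (\<delta> x))"
      by (rule tensor_map_compose[OF H_module D(2) H_module E(2) H_module F(2) _ fl _ gl _ _ lin_closed[OF D(3) x]])
        (auto simp: compose_def id_def lin_id)
    then show ?thesis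
      using f g x lin_closed[OF fl x] by (simp add: rl_YD_simps compose_def)
  qed
  moreover have "act x h \<in> carrier X" if "h \<in> carrier H" "x \<in> carrier X" for h x
    using D(5) that by auto
  ultimately show ?thesis
    using f g lin_closed[OF fl] algebra_hom_compose[OF fh gh D(1)]
    by (simp add: rl_YD_simps compose_eq)
qed

lemma compose_laws:
  assumes "f \<in> algebra_hom K X Y" "f \<in> extensional (carrier X)"
  shows "compose (carrier X) f (\<lambda>x\<in>carrier X. x) = f" "compose (carrier X) (\<lambda>x\<in>carrier Y. x) f = f"
    and "compose (carrier X) (compose (carrier Y) h g) f = compose (carrier X) h (compose (carrier X) g f)"
  using assms lin_closed[OF algebra_homD(1)[OF assms(1)]]
  by (auto simp: compose_def restrict_def extensional_def fun_eq_iff)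

lemma lr_YD_category: "is_category (lr_YD K H)"
  unfolding is_category_def
proof (intro conjI ballI)
  fix A assume "A \<in> Obj (lr_YD K H)"
  then show "ident (lr_YD K H) A \<in> Hom (lr_YD K H) A A"
    by (cases A) (simp add: lr_YD_simps(1,3) lr_YD_ident)
next
  fix A B C f g assume "A \<in> Obj (lr_YD K H)" "B \<in> Obj (lr_YD K H)" "C \<in> Obj (lr_YD K H)"
    "f \<in> Hom (lr_YD K H) A B" "g \<in> Hom (lr_YD K H) B C"
  then show "cmp (lr_YD K H) A B C g f \<in> Hom (lr_YD K H) A C"
    by (cases A, cases B, cases C) (simp add: lr_YD_simps(1,4) lr_YD_compose)
next
  fix A B f assume "A \<in> Obj (lr_YD K H)" "B \<in> Obj (lr_YD K H)" and f: "f \<in> Hom (lr_YD K H) A B"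
  show "cmp (lr_YD K H) A A B f (ident (lr_YD K H) A) = f"
    using f by (cases A, cases B) (auto simp: lr_YD_simps compose_laws)
  show "cmp (lr_YD K H) A B B (ident (lr_YD K H) B) f = f"
    using f by (cases A, cases B) (auto simp: lr_YD_simps compose_laws)
next
  fix A B C D f g h assume "f \<in> Hom (lr_YD K H) A B"
  then show "cmp (lr_YD K H) A B D (cmp (lr_YD K H) B C D h g) f =
    cmp (lr_YD K H) A C D h (cmp (lr_YD K H) A B C g f)"
    by (cases A, cases B, cases C) (auto simp: lr_YD_simps compose_laws)
qed

lemma rl_YD_category: "is_category (rl_YD K H)"
  unfolding is_category_def
proof (intro conjI ballI)
  fix A assume "A \<in> Obj (rl_YD K H)"
  then show "ident (rl_YD K H) A \<in> Hom (rl_YD K H) A A"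
    by (cases A) (simp add: rl_YD_simps(1,3) rl_YD_ident)
next
  fix A B C f g assume "A \<in> Obj (rl_YD K H)" "B \<in> Obj (rl_YD K H)" "C \<in> Obj (rl_YD K H)"
    "f \<in> Hom (rl_YD K H) A B" "g \<in> Hom (rl_YD K H) B C"
  then show "cmp (rl_YD K H) A B C g f \<in> Hom (rl_YD K H) A C"
    by (cases A, cases B, cases C) (simp add: rl_YD_simps(1,4) rl_YD_compose)
next
  fix A B f assume "A \<in> Obj (rl_YD K H)" "B \<in> Obj (rl_YD K H)" and f: "f \<in> Hom (rl_YD K H) A B"
  show "cmp (rl_YD K H) A A B f (ident (rl_YD K H) A) = f"
    using f by (cases A, cases B) (auto simp: rl_YD_simps compose_laws)
  show "cmp (rl_YD K H) A B B (ident (rl_YD K H) B) f = f"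
    using f by (cases A, cases B) (auto simp: rl_YD_simps compose_laws)
next
  fix A B C D f g h assume "f \<in> Hom (rl_YD K H) A B"
  then show "cmp (rl_YD K H) A B D (cmp (rl_YD K H) B C D h g) f =
    cmp (rl_YD K H) A C D h (cmp (rl_YD K H) A B C g f)"
    by (cases A, cases B, cases C) (auto simp: rl_YD_simps compose_laws)
qed

end

section \<open>Independence of the antipode\<close>

lemma tensor_map_op:
  "tensor_map K (hopf_op H1) Y1 C1 D1 f1 g1 = tensor_map K H1 Y1 C1 D1 f1 g1"
  "tensor_map K X2 (hopf_op H2) C2 D2 f2 g2 = tensor_map K X2 H2 C2 D2 f2 g2"
  "tensor_map K X3 Y3 (hopf_op H3) D3 f3 g3 = tensor_map K X3 Y3 H3 D3 f3 g3"
  "tensor_map K X4 Y4 C4 (hopf_op H4) f4 g4 = tensor_map K X4 Y4 C4 H4 f4 g4"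
  by (simp_all add: tensor_map_def op_transparent fun_eq_iff)

lemma tensor_assoc_op:
  "tensor_assoc K X (hopf_op H) (hopf_op H) = tensor_assoc K X H H"
  "tensor_assoc K (hopf_op G) (hopf_op G) Y = tensor_assoc K G G Y"
  by (simp_all add: tensor_assoc_def op_transparent fun_eq_iff)

lemmas op_transparent_maps = tensor_map_op tensor_assoc_op

lemma tensor_algebra_op_op:
  "tensor_algebra K X (hopf_op (hopf_op H)) = tensor_algebra K X H"
  "tensor_algebra K (hopf_op (hopf_op H)) Y = tensor_algebra K H Y"
  by (simp_all add: tensor_algebra_def op_transparent)

lemma action_op_op:
  "left_action K (hopf_op (hopf_op H)) X = left_action K H X"
  "right_action K (hopf_op (hopf_op H)) X = right_action K H X"
  by (simp_all add: left_action_def right_action_def op_transparent fun_eq_iff)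

lemma coaction_op_op:
  "right_coaction K (hopf_op (hopf_op H)) X = right_coaction K H X"
  "left_coaction K (hopf_op (hopf_op H)) X = left_coaction K H X"
  by (simp_all add: right_coaction_def left_coaction_def op_transparent op_transparent_maps
      tensor_algebra_op_op fun_eq_iff)

lemma yetter_drinfeld_op_op:
  "lr_yetter_drinfeld K (hopf_op (hopf_op H)) A = lr_yetter_drinfeld K H A"
  "rl_yetter_drinfeld K (hopf_op (hopf_op H)) B = rl_yetter_drinfeld K H B"
  by (cases A, simp add: lr_yetter_drinfeld_def op_transparent action_op_op coaction_op_op)
    (cases B, simp add: rl_yetter_drinfeld_def op_transparent action_op_op coaction_op_op)

text \<open>Reversing the product twice restores it, and the antipode does not occur in the definition of the
  categories.\<close>

lemma YD_op_op:
  "lr_YD K (hopf_op (hopf_op H)) = lr_YD K H"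
  "rl_YD K (hopf_op (hopf_op H)) = rl_YD K H"
  by (simp_all add: lr_YD_def rl_YD_def yetter_drinfeld_op_op op_transparent op_transparent_maps)

section \<open>The functors\<close>

context fin_hopf
begin

interpretation op: fin_hopf K Hop by (rule fin_hopf_op)

lemma lr_to_rl_hom:
  assumes A: "lr_yetter_drinfeld K H A" and B: "lr_yetter_drinfeld K H B" and f: "f \<in> Hom (lr_YD K H) A B"
  shows "f \<in> Hom (rl_YD K Hop) (lr_to_rl K H A) (lr_to_rl K H B)"
proof -
  obtain X act \<delta> Y act' \<delta>' where AB: "A = (X, act, \<delta>)" "B = (Y, act', \<delta>')"
    by (cases A, cases B)
  note D = lr_objectD[OF A[unfolded AB]] and E = lr_objectD[OF B[unfolded AB]]
  have fh: "f \<in> algebra_hom K X Y" and fe: "f \<in> extensional (carrier X)"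
    and fa: "\<And>h x. h \<in> carrier H \<Longrightarrow> x \<in> carrier X \<Longrightarrow> f (act h x) = act' h (f x)"
    and fd: "\<And>x. x \<in> carrier X \<Longrightarrow> tensor_map K X H Y H f id (\<delta> x) = \<delta>' (f x)"
    using f by (auto simp: AB lr_YD_simps)
  note fl = algebra_homD(1)[OF fh]
  note fc = lin_closed[OF fl]
  let ?HY = "tensor_space K H Y"
  have "tensor_map K H X H Y id f (flip K X H H X (\<lambda>x. x) S (\<delta> x)) = flip K Y H H Y (\<lambda>x. x) S (\<delta>' (f x))"
    if x: "x \<in> carrier X" for x
  proof -
    note t = lin_closed[OF D(3) x]
    have mHY: "module K ?HY" by (intro lin_intros E)
    have b: "bilinear K H X ?HY (\<lambda>a b. tens K H Y (id a) (f b))"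
      unfolding id_def by (intro lin_intros E fl fc)
    have "tensor_map K H X H Y id f (flip K X H H X (\<lambda>x. x) S (\<delta> x)) =
      tensor_lift K X H ?HY (\<lambda>a b. tens K H Y (S b) (f a)) (\<delta> x)"
      unfolding tensor_map_def
      using lift_flip[OF D(2) H_module H_module D(2) lin_id antipode_linear mHY b t] by simp
    also have "\<dots> = flip K Y H H Y (\<lambda>x. x) S (tensor_map K X H Y H f id (\<delta> x))"
      unfolding flip_def
      using lift_tensor_map[OF D(2) H_module E(2) H_module mHY fl lin_id[folded id_def]
          flip_bilinear[OF E(2) H_module H_module E(2) lin_id antipode_linear] t] by simp
    finally show ?thesis by (simp add: fd x)
  qed
  then show ?thesis
    using fh fe fa D(5) fc
    by (auto simp: AB lr_to_rl_eq op.rl_YD_simps op_transparent op_transparent_maps)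
qed

lemma rl_to_lr_hom:
  assumes A: "rl_yetter_drinfeld K H A" and B: "rl_yetter_drinfeld K H B" and f: "f \<in> Hom (rl_YD K H) A B"
  shows "f \<in> Hom (lr_YD K Hop) (rl_to_lr K H A) (rl_to_lr K H B)"
proof -
  obtain X act \<delta> Y act' \<delta>' where AB: "A = (X, act, \<delta>)" "B = (Y, act', \<delta>')"
    by (cases A, cases B)
  note D = rl_objectD[OF A[unfolded AB]] and E = rl_objectD[OF B[unfolded AB]]
  have fh: "f \<in> algebra_hom K X Y" and fe: "f \<in> extensional (carrier X)"
    and fa: "\<And>h x. h \<in> carrier H \<Longrightarrow> x \<in> carrier X \<Longrightarrow> f (act x h) = act' (f x) h"
    and fd: "\<And>x. x \<in> carrier X \<Longrightarrow> tensor_map K H X H Y id f (\<delta> x) = \<delta>' (f x)"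
    using f by (auto simp: AB rl_YD_simps)
  note fl = algebra_homD(1)[OF fh]
  note fc = lin_closed[OF fl]
  let ?YH = "tensor_space K Y H"
  have "tensor_map K X H Y H f id (flip K H X X H S (\<lambda>x. x) (\<delta> x)) = flip K H Y Y H S (\<lambda>x. x) (\<delta>' (f x))"
    if x: "x \<in> carrier X" for x
  proof -
    note t = lin_closed[OF D(3) x]
    have mYH: "module K ?YH" by (intro lin_intros E)
    have b: "bilinear K X H ?YH (\<lambda>a b. tens K Y H (f a) (id b))"
      unfolding id_def by (intro lin_intros E fl fc)
    have "tensor_map K X H Y H f id (flip K H X X H S (\<lambda>x. x) (\<delta> x)) =
      tensor_lift K H X ?YH (\<lambda>a b. tens K Y H (f b) (S a)) (\<delta> x)"
      unfolding tensor_map_def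
      using lift_flip[OF H_module D(2) D(2) H_module antipode_linear lin_id mYH b t] by simp
    also have "\<dots> = flip K H Y Y H S (\<lambda>x. x) (tensor_map K H X H Y id f (\<delta> x))"
      unfolding flip_def
      using lift_tensor_map[OF H_module D(2) H_module E(2) mYH lin_id[folded id_def] fl
          flip_bilinear[OF H_module E(2) E(2) H_module antipode_linear lin_id] t] by simp
    finally show ?thesis by (simp add: fd x)
  qed
  then show ?thesis
    using fh fe fa D(5) fc
    by (auto simp: AB rl_to_lr_eq op.lr_YD_simps op_transparent op_transparent_maps)
qed

text \<open>This is the point at which the antipode has to be invertible.\<close>

lemma flip_flip:
  assumes X: "module K X"
  shows "t \<in> carrier (tensor_space K X H) \<Longrightarrow> flip K H X X H Si (\<lambda>x. x) (flip K X H H X (\<lambda>x. x) S t) = t"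
    and "u \<in> carrier (tensor_space K H X) \<Longrightarrow> flip K X H H X (\<lambda>x. x) Si (flip K H X X H S (\<lambda>x. x) u) = u"
proof -
  assume t: "t \<in> carrier (tensor_space K X H)"
  have m: "module K (tensor_space K X H)" by (intro lin_intros X)
  have "flip K H X X H Si (\<lambda>x. x) (flip K X H H X (\<lambda>x. x) S t) =
    tensor_lift K X H (tensor_space K X H) (\<lambda>a b. tens K X H a (Si (S b))) t"
    unfolding flip_def[of K H X X H]
    by (rule lift_flip[OF X H_module H_module X lin_id antipode_linear m _ t]) (intro lin_intros X)
  also have "\<dots> = tensor_lift K X H (tensor_space K X H) (tens K X H) t"
    by (rule lift_cong[OF X H_module m tens_bilinear[OF X H_module] t]) (simp add: Si_S)
  finally show "flip K H X X H Si (\<lambda>x. x) (flip K X H H X (\<lambda>x. x) S t) = t"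
    by (simp add: lift_tens_id[OF X H_module t])
next
  assume u: "u \<in> carrier (tensor_space K H X)"
  have m: "module K (tensor_space K H X)" by (intro lin_intros X)
  have "flip K X H H X (\<lambda>x. x) Si (flip K H X X H S (\<lambda>x. x) u) =
    tensor_lift K H X (tensor_space K H X) (\<lambda>a b. tens K H X (Si (S a)) b) u"
    unfolding flip_def[of K X H H X]
    by (rule lift_flip[OF H_module X X H_module antipode_linear lin_id m _ u]) (intro lin_intros X)
  also have "\<dots> = tensor_lift K H X (tensor_space K H X) (tens K H X) u"
    by (rule lift_cong[OF H_module X m tens_bilinear[OF H_module X] u]) (simp add: Si_S)
  finally show "flip K X H H X (\<lambda>x. x) Si (flip K H X X H S (\<lambda>x. x) u) = u"
    by (simp add: lift_tens_id[OF H_module X u])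
qed

lemma rl_to_lr_to_rl:
  assumes A: "lr_yetter_drinfeld K H A"
  shows "rl_to_lr K Hop (lr_to_rl K H A) = A"
proof -
  obtain X act \<delta> where A_eq: "A = (X, act, \<delta>)" by (cases A)
  note D = lr_objectD[OF A[unfolded A_eq]]
  have "(\<lambda>x\<in>carrier X. flip K H X X H Si (\<lambda>x. x) ((\<lambda>x\<in>carrier X. flip K X H H X (\<lambda>x. x) S (\<delta> x)) x)) = \<delta>"
    using D(4) flip_flip(1)[OF D(2) lin_closed[OF D(3)]] by (auto simp: fun_eq_iff extensional_def)
  moreover have "(\<lambda>h\<in>carrier H. \<lambda>x\<in>carrier X. (\<lambda>x\<in>carrier X. \<lambda>h\<in>carrier H. act h x) x h) = act"
    using D(5) by (auto simp: fun_eq_iff PiE_iff extensional_def)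
  moreover have "flip K Hop X X Hop Si (\<lambda>x. x) = flip K H X X H Si (\<lambda>x. x)"
    by (simp add: flip_def op_transparent fun_eq_iff)
  ultimately show ?thesis
    by (simp add: A_eq lr_to_rl_eq op.rl_to_lr_eq)
qed

lemma lr_to_rl_to_lr:
  assumes A: "rl_yetter_drinfeld K H A"
  shows "lr_to_rl K Hop (rl_to_lr K H A) = A"
proof -
  obtain X act \<delta> where A_eq: "A = (X, act, \<delta>)" by (cases A)
  note D = rl_objectD[OF A[unfolded A_eq]]
  have "(\<lambda>x\<in>carrier X. flip K X H H X (\<lambda>x. x) Si ((\<lambda>x\<in>carrier X. flip K H X X H S (\<lambda>x. x) (\<delta> x)) x)) = \<delta>"
    using D(4) flip_flip(2)[OF D(2) lin_closed[OF D(3)]] by (auto simp: fun_eq_iff extensional_def)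
  moreover have "(\<lambda>x\<in>carrier X. \<lambda>h\<in>carrier H. (\<lambda>h\<in>carrier H. \<lambda>x\<in>carrier X. act x h) h x) = act"
    using D(5) by (auto simp: fun_eq_iff PiE_iff extensional_def)
  moreover have "flip K X Hop Hop X (\<lambda>x. x) Si = flip K X H H X (\<lambda>x. x) Si"
    by (simp add: flip_def op_transparent fun_eq_iff)
  ultimately show ?thesis
    by (simp add: A_eq rl_to_lr_eq op.lr_to_rl_eq)
qed

text \<open>Off the carrier the two antipodes may be different, because the inverse of the inverse is an
  arbitrary value there.\<close>

lemma antipode_op_op: "h \<in> carrier H \<Longrightarrow> antipode (hopf_op Hop) h = S h"
  using op.S_inject[of "antipode (hopf_op Hop) h" "S h"] op.S_Si[of h] op.Si_closed[of h]
  by (simp add: antipode_closed Si_S)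

lemma lr_to_rl_op_op:
  assumes A: "lr_yetter_drinfeld K H A"
  shows "lr_to_rl K (hopf_op Hop) A = lr_to_rl K H A"
proof -
  obtain X act \<delta> where A_eq: "A = (X, act, \<delta>)" by (cases A)
  note D = lr_objectD[OF A[unfolded A_eq]]
  have "tensor_lift K X H (tensor_space K H X) (\<lambda>x0 x1. tens K H X (antipode (hopf_op Hop) x1) x0) (\<delta> x) =
    tensor_lift K X H (tensor_space K H X) (\<lambda>x0 x1. tens K H X (S x1) x0) (\<delta> x)" if "x \<in> carrier X" for x
    by (rule lift_cong[OF D(2) H_module tensor_module[OF H_module D(2)]
          flip_bilinear[OF D(2) H_module H_module D(2) lin_id antipode_linear] lin_closed[OF D(3) that]])
      (simp only: antipode_op_op)
  then show ?thesis
    unfolding A_eq lr_to_rl_def split_conv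
    by (simp only: op_transparent) (simp cong: restrict_cong)
qed

lemma rl_to_lr_op_op:
  assumes A: "rl_yetter_drinfeld K H A"
  shows "rl_to_lr K (hopf_op Hop) A = rl_to_lr K H A"
proof -
  obtain X act \<delta> where A_eq: "A = (X, act, \<delta>)" by (cases A)
  note D = rl_objectD[OF A[unfolded A_eq]]
  have "tensor_lift K H X (tensor_space K X H) (\<lambda>x1 x0. tens K X H x0 (antipode (hopf_op Hop) x1)) (\<delta> x) =
    tensor_lift K H X (tensor_space K X H) (\<lambda>x1 x0. tens K X H x0 (S x1)) (\<delta> x)" if "x \<in> carrier X" for x
    by (rule lift_cong[OF H_module D(2) tensor_module[OF D(2) H_module]
          flip_bilinear[OF H_module D(2) D(2) H_module antipode_linear lin_id] lin_closed[OF D(3) that]])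
      (simp only: antipode_op_op)
  then show ?thesis
    unfolding A_eq rl_to_lr_def split_conv
    by (simp only: op_transparent) (simp cong: restrict_cong)
qed

lemma lr_to_rl_object': "lr_yetter_drinfeld K H A \<Longrightarrow> rl_yetter_drinfeld K Hop (lr_to_rl K H A)"
  by (cases A) (simp add: lr_to_rl_object)

lemma rl_to_lr_object': "rl_yetter_drinfeld K H A \<Longrightarrow> lr_yetter_drinfeld K Hop (rl_to_lr K H A)"
  by (cases A) (simp add: rl_to_lr_object)

lemma lr_to_rl_ident_cmp:
  "ident (rl_YD K Hop) (lr_to_rl K H A) = ident (lr_YD K H) A"
  "cmp (rl_YD K Hop) (lr_to_rl K H A) (lr_to_rl K H B) (lr_to_rl K H C) g f = cmp (lr_YD K H) A B C g f"
  by (cases A, simp add: lr_to_rl_def lr_YD_def rl_YD_def)+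

lemma rl_to_lr_ident_cmp:
  "ident (lr_YD K Hop) (rl_to_lr K H A) = ident (rl_YD K H) A"
  "cmp (lr_YD K Hop) (rl_to_lr K H A) (rl_to_lr K H B) (rl_to_lr K H C) g f = cmp (rl_YD K H) A B C g f"
  by (cases A, simp add: rl_to_lr_def lr_YD_def rl_YD_def)+

lemma YD_functor_functor: "is_functor (YD_functor K H :: (('k, 'h, 'x) lr_object, 'x \<Rightarrow> 'x, ('k, 'h, 'x) rl_object, 'x \<Rightarrow> 'x) cat_functor)"
  (is "is_functor ?F")
proof -
  let ?C = "lr_YD K H :: (('k, 'h, 'x) lr_object, 'x \<Rightarrow> 'x) category"
  have cat: "is_category ?C" by (rule lr_YD_category)
  have id: "ident ?C A \<in> Hom ?C A A" if "A \<in> Obj ?C" for A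
    using cat that by (auto simp: is_category_def)
  have cmp: "cmp ?C A B D g f \<in> Hom ?C A D"
    if "A \<in> Obj ?C" "B \<in> Obj ?C" "D \<in> Obj ?C" "f \<in> Hom ?C A B" "g \<in> Hom ?C B D" for A B D f g
    using cat that by (auto simp: is_category_def)
  show ?thesis
    unfolding is_functor_def
    by (auto simp: YD_functor_def cat op.rl_YD_category lr_to_rl_ident_cmp id cmp
        lr_YD_simps(1) op.rl_YD_simps(1) lr_to_rl_object' lr_to_rl_hom)
qed

lemma YD_functor'_functor: "is_functor (YD_functor' K H :: (('k, 'h, 'x) rl_object, 'x \<Rightarrow> 'x, ('k, 'h, 'x) lr_object, 'x \<Rightarrow> 'x) cat_functor)"
  (is "is_functor ?F")
proof -
  let ?C = "rl_YD K H :: (('k, 'h, 'x) rl_object, 'x \<Rightarrow> 'x) category"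
  have cat: "is_category ?C" by (rule rl_YD_category)
  have id: "ident ?C A \<in> Hom ?C A A" if "A \<in> Obj ?C" for A
    using cat that by (auto simp: is_category_def)
  have cmp: "cmp ?C A B D g f \<in> Hom ?C A D"
    if "A \<in> Obj ?C" "B \<in> Obj ?C" "D \<in> Obj ?C" "f \<in> Hom ?C A B" "g \<in> Hom ?C B D" for A B D f g
    using cat that by (auto simp: is_category_def)
  show ?thesis
    unfolding is_functor_def
    by (auto simp: YD_functor'_def cat op.lr_YD_category rl_to_lr_ident_cmp id cmp
        rl_YD_simps(1) op.lr_YD_simps(1) rl_to_lr_object' rl_to_lr_hom)
qed

lemma comp_functor_lr: "comp_functor (YD_functor' K Hop) (YD_functor K H) =
    id_functor (lr_YD K H :: (('k, 'h, 'x) lr_object, 'x \<Rightarrow> 'x) category)"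
  by (auto simp: comp_functor_def id_functor_def YD_functor_def YD_functor'_def YD_op_op
      lr_YD_simps(1) op.rl_YD_simps(1) lr_to_rl_object' lr_to_rl_hom rl_to_lr_to_rl
      intro!: restrict_ext)

lemma comp_functor_rl: "comp_functor (YD_functor K Hop) (YD_functor' K H) =
    id_functor (rl_YD K H :: (('k, 'h, 'x) rl_object, 'x \<Rightarrow> 'x) category)"
  by (auto simp: comp_functor_def id_functor_def YD_functor_def YD_functor'_def YD_op_op
      rl_YD_simps(1) op.lr_YD_simps(1) rl_to_lr_object' rl_to_lr_hom lr_to_rl_to_lr
      intro!: restrict_ext)

text \<open>The coactions take values in tensors over the carrier of \<open>H\<close>, where the two antipodes agree.\<close>

lemma YD_functor_op_op:
  "YD_functor K (hopf_op Hop) = (YD_functor K H :: (('k, 'h, 'x) lr_object, 'x \<Rightarrow> 'x, ('k, 'h, 'x) rl_object, 'x \<Rightarrow> 'x) cat_functor)"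
  "YD_functor' K (hopf_op Hop) = (YD_functor' K H :: (('k, 'h, 'x) rl_object, 'x \<Rightarrow> 'x, ('k, 'h, 'x) lr_object, 'x \<Rightarrow> 'x) cat_functor)"
  by (auto simp: YD_functor_def YD_functor'_def YD_op_op lr_YD_simps(1) rl_YD_simps(1)
      lr_to_rl_op_op rl_to_lr_op_op intro!: restrict_ext)

end

theorem proposition6p5:
  fixes K :: "'k ring" and H :: "('k, 'h) hopf"
  assumes "hopf_algebra K H" and "vectorspace.fin_dim K H"
  shows "equivalence_of_categories (YD_functor K H ::
        (('k, 'h, 'x) lr_object, 'x \<Rightarrow> 'x, ('k, 'h, 'x) rl_object, 'x \<Rightarrow> 'x) cat_functor)
    \<and> equivalence_of_categories (YD_functor' K H ::
        (('k, 'h, 'x) rl_object, 'x \<Rightarrow> 'x, ('k, 'h, 'x) lr_object, 'x \<Rightarrow> 'x) cat_functor)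
    \<and> comp_functor (YD_functor' K (hopf_op H)) (YD_functor K H) =
        id_functor (lr_YD K H :: (('k, 'h, 'x) lr_object, 'x \<Rightarrow> 'x) category)
    \<and> comp_functor (YD_functor K (hopf_op H)) (YD_functor' K H) =
        id_functor (rl_YD K H :: (('k, 'h, 'x) rl_object, 'x \<Rightarrow> 'x) category)"
proof -
  interpret H: fin_hopf K H
    using assms by (intro fin_hopf.intro hopf.intro fin_hopf_axioms.intro)
  interpret op: fin_hopf K "hopf_op H" by (rule H.fin_hopf_op)
  let ?F = "YD_functor K H :: (('k, 'h, 'x) lr_object, 'x \<Rightarrow> 'x, ('k, 'h, 'x) rl_object, 'x \<Rightarrow> 'x) cat_functor"
  let ?F' = "YD_functor' K H :: (('k, 'h, 'x) rl_object, 'x \<Rightarrow> 'x, ('k, 'h, 'x) lr_object, 'x \<Rightarrow> 'x) cat_functor"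
  let ?G = "YD_functor' K (hopf_op H) :: (('k, 'h, 'x) rl_object, 'x \<Rightarrow> 'x, ('k, 'h, 'x) lr_object, 'x \<Rightarrow> 'x) cat_functor"
  let ?G' = "YD_functor K (hopf_op H) :: (('k, 'h, 'x) lr_object, 'x \<Rightarrow> 'x, ('k, 'h, 'x) rl_object, 'x \<Rightarrow> 'x) cat_functor"
  have "equivalence_of_categories ?F"
  proof (rule equivalence_of_inverse_functors[OF H.YD_functor_functor op.YD_functor'_functor])
    show "comp_functor ?G ?F = id_functor (src ?F)"
      using H.comp_functor_lr by (simp add: YD_functor_def)
    show "comp_functor ?F ?G = id_functor (tgt ?F)"
      using op.comp_functor_rl by (simp add: H.YD_functor_op_op) (simp add: YD_functor_def)
  qed (simp_all add: YD_functor_def YD_functor'_def YD_op_op)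
  moreover have "equivalence_of_categories ?F'"
  proof (rule equivalence_of_inverse_functors[OF H.YD_functor'_functor op.YD_functor_functor])
    show "comp_functor ?G' ?F' = id_functor (src ?F')"
      using H.comp_functor_rl by (simp add: YD_functor'_def)
    show "comp_functor ?F' ?G' = id_functor (tgt ?F')"
      using op.comp_functor_lr by (simp add: H.YD_functor_op_op) (simp add: YD_functor'_def)
  qed (simp_all add: YD_functor_def YD_functor'_def YD_op_op)
  ultimately show ?thesis
    using H.comp_functor_lr H.comp_functor_rl by blast
qed

end
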